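(* Let $\Omega$, $\{\mathcal T_h\}_{h>0}$, $\mathcal N_h$, $Q_h$, $\boldsymbol U_h$, $i_{Q_h}$, $(\cdot,\cdot)_h$, $\gamma>0$, $\alpha\ge0$ be as in the context, and let $T>0$. There exists a constant $C>0$, independent of $h$ and of $\boldsymbol u_0$ (it may depend on $T,\gamma,\alpha,\Omega$ and the mesh-regularity constants), such that the following holds. Let $\boldsymbol u_0\in\boldsymbol H^1(\Omega)$ with $|\boldsymbol u_0|=1$ a.e. in $\Omega$, and $\boldsymbol u_{0h}\in\boldsymbol U_h$ with $|\boldsymbol u_{0h}(\boldsymbol a)|=1$ for all $\boldsymbol a\in\mathcal N_h$ and $\|\nabla\boldsymbol u_{0h}\|\le\|\nabla\boldsymbol u_0\|$. Let $(\boldsymbol u_h,q_h)\in C^\infty([0,+\infty);\boldsymbol U_h)\times C^\infty([0,+\infty);Q_h)$ satisfy $\boldsymbol u_h(0)=\boldsymbol u_{0h}$ and, for all $t\ge0$ and all $(\bar{\boldsymbol u}_h,\bar q_h)\in\boldsymbol U_h\times Q_h$, $$(\partial_t\boldsymbol u_h,\bar{\boldsymbol u}_h)_h+\gamma(\nabla\boldsymbol u_h,\nabla\bar{\boldsymbol u}_h)+\gamma(q_h,i_{Q_h}(\boldsymbol u_h\cdot\bar{\boldsymbol u}_h))+\alpha(\boldsymbol u_h\times\partial_t\boldsymbol u_h,\bar{\boldsymbol u}_h)_h=0,$$ $$(i_{Q_h}(\boldsymbol u_h\cdot\boldsymbol u_h),\bar q_h)=(1,\bar q_h).$$ Then $$\|q_h\|_{L^2(0,T;(H^1(\Omega)\cap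 L^\infty(\Omega))')}\le C\,(1+\|\nabla\boldsymbol u_0\|)\,\|\nabla\boldsymbol u_0\| .$$
   Context: $M\in\{2,3\}$; $\Omega\subset\mathbb R^M$ is a bounded domain with polygonal/polyhedral Lipschitz boundary; $\{\mathcal T_h\}_{h>0}$ is a shape-regular, quasi-uniform family of conforming triangulations of $\overline\Omega$ into triangles ($M=2$) or tetrahedra ($M=3$), $h=\max_{K\in\mathcal T_h}\operatorname{diam}K$; $\mathcal N_h$ is the set of all nodes (vertices) of $\mathcal T_h$. $X_h=\{v_h\in C^0(\overline\Omega): v_h|_K \text{ is a polynomial of degree}\le 1\ \forall K\in\mathcal T_h\}$ with nodal (Lagrange) basis $\{\varphi_{\boldsymbol a}\}_{\boldsymbol a\in\mathcal N_h}$; $Q_h=X_h$, $\boldsymbol U_h=(X_h)^M$. $i_{Q_h}:C^0(\overline\Omega)\to Q_h$ is nodal interpolation, $i_{Q_h}(f)=\sum_{\boldsymbol a}f(\boldsymbol a)\varphi_{\boldsymbol a}$. $(\cdot,\cdot)$ and $\|\cdot\|$ are the $L^2(\Omega)$ inner product and norm (for scalars, vectors, matrices). The lumped product is $(\boldsymbol v,\boldsymbol w)_h=\int_\Omega i_{Q_h}(\boldsymbol v\cdot\boldsymbol w)=\sum_{\boldsymbol a\in\mathcal N_h}\boldsymbol v(\boldsymbol a)\cdot\boldsymbol w(\boldsymbol a)\int_\Omega\varphi_{\boldsymbol a}$. $\gamma>0$ and $\alpha\ge0$ are real constants; if $M=2$ then $\alpha=0$ (the cross-product term is absent). For $q_h\in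 Q_h$, $$\|q_h\|_{(H^1(\Omega)\cap L^\infty(\Omega))'}=\sup_{q\in H^1(\Omega)\cap L^\infty(\Omega)\setminus\{0\}}\frac{(q_h,q)}{\|\nabla q\|+\|q\|_{L^\infty(\Omega)}},$$ and $\|q_h\|_{L^2(0,T;X')}=\big(\int_0^T\|q_h(t)\|_{X'}^2dt\big)^{1/2}$. *)

theory Defs
  imports "HOL-Analysis.Analysis" "HOL-Probability.Essential_Supremum"
begin

section \<open>Smooth functions\<close>

text \<open>The class \<open>C\<^sup>k(S)\<close>, with derivatives taken within \<open>S\<close> (one-sided at the end point of a
  half-line). It is used only for \<open>S = UNIV\<close> and \<open>S = {0..}\<close>, where these derivatives are unique.\<close>

fun Ck_on :: "nat \<Rightarrow> 'a::euclidean_space set \<Rightarrow> ('a \<Rightarrow> 'b::real_normed_vector) \<Rightarrow> bool" where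
  "Ck_on 0 S f \<longleftrightarrow> continuous_on S f"
| "Ck_on (Suc k) S f \<longleftrightarrow>
     f differentiable_on S \<and>
     (\<forall>b\<in>Basis. Ck_on k S (\<lambda>x. frechet_derivative f (at x within S) b))"

definition smooth_on :: "'a::euclidean_space set \<Rightarrow> ('a \<Rightarrow> 'b::real_normed_vector) \<Rightarrow> bool" where
  "smooth_on S f \<longleftrightarrow> (\<forall>k. Ck_on k S f)"

definition test_function :: "'a::euclidean_space set \<Rightarrow> ('a \<Rightarrow> real) \<Rightarrow> bool" where
  "test_function \<Omega> \<phi> \<longleftrightarrow>
     smooth_on UNIV \<phi> \<and> (\<exists>K. compact K \<and> K \<subseteq> \<Omega> \<and> (\<forall>x. x \<notin> K \<longrightarrow> \<phi> x = 0))"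


section \<open>Lebesgue and Sobolev spaces\<close>

text \<open>Elements of function spaces on \<open>\<Omega>\<close> are total functions whose values outside \<open>\<Omega>\<close>
  (outside the closure of \<open>\<Omega>\<close> for continuous ones) are irrelevant.\<close>

definition L2 :: "'a::euclidean_space set \<Rightarrow> ('a \<Rightarrow> 'b::euclidean_space) set" where
  "L2 \<Omega> = {f. f \<in> borel_measurable (lebesgue_on \<Omega>) \<and>
                 integrable (lebesgue_on \<Omega>) (\<lambda>x. (norm (f x))\<^sup>2)}"

definition L2_inner ::
  "'a::euclidean_space set \<Rightarrow> ('a \<Rightarrow> 'b::euclidean_space) \<Rightarrow> ('a \<Rightarrow> 'b) \<Rightarrow> real" where
  "L2_inner \<Omega> f g = (LINT x|lebesgue_on \<Omega>. f x \<bullet> g x)"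

definition L2_norm :: "'a::euclidean_space set \<Rightarrow> ('a \<Rightarrow> 'b::euclidean_space) \<Rightarrow> real" where
  "L2_norm \<Omega> f = sqrt (L2_inner \<Omega> f f)"

definition Linf :: "'a::euclidean_space set \<Rightarrow> ('a \<Rightarrow> real) set" where
  "Linf \<Omega> = {f. f \<in> borel_measurable (lebesgue_on \<Omega>) \<and>
                   esssup (lebesgue_on \<Omega>) (\<lambda>x. ereal \<bar>f x\<bar>) < \<infinity>}"

definition Linf_norm :: "'a::euclidean_space set \<Rightarrow> ('a \<Rightarrow> real) \<Rightarrow> real" where
  "Linf_norm \<Omega> f = real_of_ereal (esssup (lebesgue_on \<Omega>) (\<lambda>x. ereal \<bar>f x\<bar>))"

definition has_weak_grad ::
  "(real^'n) set \<Rightarrow> (real^'n \<Rightarrow> real) \<Rightarrow> (real^'n \<Rightarrow> real^'n) \<Rightarrow> bool" where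
  "has_weak_grad \<Omega> f G \<longleftrightarrow>
     (\<forall>\<phi>. test_function \<Omega> \<phi> \<longrightarrow>
        (\<forall>i. (LINT x|lebesgue_on \<Omega>. f x * frechet_derivative \<phi> (at x) (axis i 1)) =
             - (LINT x|lebesgue_on \<Omega>. G x $ i * \<phi> x)))"

definition H1 :: "(real^'n) set \<Rightarrow> (real^'n \<Rightarrow> real) set" where
  "H1 \<Omega> = {f \<in> L2 \<Omega>. \<exists>G\<in>L2 \<Omega>. has_weak_grad \<Omega> f G}"

text \<open>The weak gradient is determined only up to a null set, hence the choice operator.\<close>

definition grad :: "(real^'n) set \<Rightarrow> (real^'n \<Rightarrow> real) \<Rightarrow> real^'n \<Rightarrow> real^'n" where
  "grad \<Omega> f = (SOME G. G \<in> L2 \<Omega> \<and> has_weak_grad \<Omega> f G)"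

definition H1_vec :: "(real^'n) set \<Rightarrow> (real^'n \<Rightarrow> real^'m) set" where
  "H1_vec \<Omega> = {u. \<forall>i. (\<lambda>x. u x $ i) \<in> H1 \<Omega>}"

text \<open>The inner product of \<open>real^'n^'m\<close> is the Frobenius product, as required for \<open>(\<nabla>u, \<nabla>v)\<close>.\<close>

definition grad_vec :: "(real^'n) set \<Rightarrow> (real^'n \<Rightarrow> real^'m) \<Rightarrow> real^'n \<Rightarrow> real^'n^'m" where
  "grad_vec \<Omega> u x = (\<chi> i. grad \<Omega> (\<lambda>y. u y $ i) x)"

text \<open>The norm of the dual of \<open>H\<^sup>1(\<Omega>) \<inter> L\<^sup>\<infinity>(\<Omega>)\<close>. The condition \<open>Linf_norm \<Omega> q \<noteq> 0\<close> says that \<open>q\<close>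
  is not the zero class. For integrable \<open>p\<close> the quotients are bounded by the \<open>L\<^sup>1\<close> norm of \<open>p\<close>,
  so the supremum is a genuine one.\<close>

definition H1Linf_dual_norm :: "(real^'n) set \<Rightarrow> (real^'n \<Rightarrow> real) \<Rightarrow> real" where
  "H1Linf_dual_norm \<Omega> p =
     (SUP q\<in>{q \<in> H1 \<Omega> \<inter> Linf \<Omega>. Linf_norm \<Omega> q \<noteq> 0}.
        L2_inner \<Omega> p q / (L2_norm \<Omega> (grad \<Omega> q) + Linf_norm \<Omega> q))"

text \<open>The norm of \<open>L\<^sup>2(0,T;X')\<close> as a function of \<open>N t = \<parallel>q(t)\<parallel>\<^bsub>X'\<^esub>\<close>. In the application \<open>N\<close> is
  continuous, being a norm composed with a smooth curve in a finite-dimensional space.\<close>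

definition L2_time_norm :: "real \<Rightarrow> (real \<Rightarrow> real) \<Rightarrow> real" where
  "L2_time_norm T N = sqrt (LINT t|lebesgue_on {0..T}. (N t)\<^sup>2)"


section \<open>Polyhedral Lipschitz domains\<close>

text \<open>Locally the domain lies below the graph of a Lipschitz function over a hyperplane
  orthogonal to some unit vector \<open>e\<close>.\<close>

definition lipschitz_boundary :: "'a::euclidean_space set \<Rightarrow> bool" where
  "lipschitz_boundary \<Omega> \<longleftrightarrow>
     (\<forall>x\<in>frontier \<Omega>. \<exists>r>0. \<exists>e g L. norm e = 1 \<and> L-lipschitz_on {v. v \<bullet> e = 0} g \<and>
        \<Omega> \<inter> ball x r = {y \<in> ball x r. y \<bullet> e < g (y - (y \<bullet> e) *\<^sub>R e)})"

definition polyhedral_boundary :: "'a::euclidean_space set \<Rightarrow> bool" where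
  "polyhedral_boundary \<Omega> \<longleftrightarrow>
     (\<exists>\<F>. finite \<F> \<and> (\<forall>F\<in>\<F>. polytope F) \<and> frontier \<Omega> = \<Union>\<F>)"

definition polyhedral_lipschitz_domain :: "'a::euclidean_space set \<Rightarrow> bool" where
  "polyhedral_lipschitz_domain \<Omega> \<longleftrightarrow>
     open \<Omega> \<and> connected \<Omega> \<and> \<Omega> \<noteq> {} \<and> bounded \<Omega> \<and>
     polyhedral_boundary \<Omega> \<and> lipschitz_boundary \<Omega>"


section \<open>Meshes\<close>

text \<open>Conformity (two elements meet in a common face) is part of \<^const>\<open>triangulation\<close>.\<close>

definition conforming_mesh :: "(real^'n) set \<Rightarrow> (real^'n) set set \<Rightarrow> bool" where
  "conforming_mesh \<Omega> \<T> \<longleftrightarrow>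
     triangulation \<T> \<and> (\<forall>K\<in>\<T>. int CARD('n) simplex K) \<and> \<Union>\<T> = closure \<Omega>"

definition nodes :: "'a::euclidean_space set set \<Rightarrow> 'a set" where
  "nodes \<T> = {a. \<exists>K\<in>\<T>. a extreme_point_of K}"

definition mesh_size :: "'a::euclidean_space set set \<Rightarrow> real" where
  "mesh_size \<T> = Max (diameter ` \<T>)"

definition inball_diameter :: "'a::euclidean_space set \<Rightarrow> real" where
  "inball_diameter K = Sup {2 * r | c r. 0 \<le> r \<and> cball c r \<subseteq> K}"

definition shape_regular :: "real \<Rightarrow> 'a::euclidean_space set set \<Rightarrow> bool" where
  "shape_regular \<sigma> \<T> \<longleftrightarrow> (\<forall>K\<in>\<T>. diameter K \<le> \<sigma> * inball_diameter K)"

definition quasi_uniform :: "real \<Rightarrow> 'a::euclidean_space set set \<Rightarrow> bool" where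
  "quasi_uniform \<tau> \<T> \<longleftrightarrow> (\<forall>K\<in>\<T>. mesh_size \<T> \<le> \<tau> * diameter K)"

text \<open>A shape-regular, quasi-uniform family \<open>\<T> h\<close> with regularity constants \<open>\<sigma>\<close>, \<open>\<tau>\<close>, indexed by
  its set \<open>H\<close> of mesh sizes. (Since \<open>\<Omega>\<close> is bounded, not every \<open>h > 0\<close> can be a mesh size.)\<close>

definition mesh_family ::
  "(real^'n) set \<Rightarrow> real \<Rightarrow> real \<Rightarrow> real set \<Rightarrow> (real \<Rightarrow> (real^'n) set set) \<Rightarrow> bool" where
  "mesh_family \<Omega> \<sigma> \<tau> H \<T> \<longleftrightarrow>
     (\<forall>h\<in>H. h > 0 \<and> conforming_mesh \<Omega> (\<T> h) \<and> mesh_size (\<T> h) = h \<and>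
        shape_regular \<sigma> (\<T> h) \<and> quasi_uniform \<tau> (\<T> h))"


section \<open>Finite element spaces\<close>

text \<open>Here \<open>\<Union>\<T>\<close> is the closure of \<open>\<Omega>\<close>. The same space serves as \<open>X\<^sub>h\<close> and \<open>Q\<^sub>h\<close>.\<close>

definition P1 :: "'a::euclidean_space set set \<Rightarrow> ('a \<Rightarrow> real) set" where
  "P1 \<T> = {v. continuous_on (\<Union>\<T>) v \<and> (\<forall>K\<in>\<T>. \<exists>c g. \<forall>x\<in>K. v x = c + g \<bullet> x)}"

definition P1_vec :: "'a::euclidean_space set set \<Rightarrow> ('a \<Rightarrow> real^'m) set" where
  "P1_vec \<T> = {v. \<forall>i. (\<lambda>x. v x $ i) \<in> P1 \<T>}"

text \<open>The Lagrange basis function of a node; it is unique on \<open>\<Union>\<T>\<close>.\<close>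

definition hat :: "'a::euclidean_space set set \<Rightarrow> 'a \<Rightarrow> 'a \<Rightarrow> real" where
  "hat \<T> a = (SOME \<phi>. \<phi> \<in> P1 \<T> \<and> (\<forall>b\<in>nodes \<T>. \<phi> b = (if b = a then 1 else 0)))"

definition nodal_interp :: "'a::euclidean_space set set \<Rightarrow> ('a \<Rightarrow> real) \<Rightarrow> 'a \<Rightarrow> real" where
  "nodal_interp \<T> f x = (\<Sum>a\<in>nodes \<T>. f a * hat \<T> a x)"

definition lumped_inner ::
  "'a::euclidean_space set \<Rightarrow> 'a set set \<Rightarrow> ('a \<Rightarrow> real^'m) \<Rightarrow> ('a \<Rightarrow> real^'m) \<Rightarrow> real" where
  "lumped_inner \<Omega> \<T> v w = (LINT x|lebesgue_on \<Omega>. nodal_interp \<T> (\<lambda>y. v y \<bullet> w y) x)"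


section \<open>The cross product\<close>

text \<open>The cross product in coordinates over an ordered index type, through the alternating symbol.
  With three indices it is the usual one (see \<open>vcross_eq_cross3\<close> below for \<open>real^3\<close>); with two
  indices it vanishes.\<close>

definition levi_civita :: "'n::linorder \<Rightarrow> 'n \<Rightarrow> 'n \<Rightarrow> real" where
  "levi_civita i j k =
     (let s = (\<lambda>a b. if a < b then 1 else if b < a then - 1 else 0) in s i j * s j k * s i k)"

definition vcross :: "real^'n::{finite,linorder} \<Rightarrow> real^'n::{finite,linorder}
    \<Rightarrow> real^'n::{finite,linorder}" where
  "vcross a b = (\<chi> i. \<Sum>j\<in>UNIV. \<Sum>k\<in>UNIV. levi_civita i j k * a $ j * b $ k)"

lemma vcross_eq_cross3: "vcross (a :: real^3) b = cross3 a b"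
proof -
  have "(3::3) < 1" "(1::3) < 2" "(3::3) < 2"
    by (simp_all add: less_bit0_def less_bit1_def bit1.Rep_1 bit1.Rep_numeral)
  moreover from this have "\<not> (1::3) < 3" "\<not> (2::3) < 1" "\<not> (2::3) < 3"
    by (simp_all add: not_less less_imp_le)
  ultimately show ?thesis
    by (simp add: vcross_def cross3_def vec_eq_iff forall_3 sum_3 levi_civita_def Let_def)
qed


section \<open>The semidiscrete problem\<close>

text \<open>Curves in the finite-dimensional spaces are smooth iff all their point evaluations are.\<close>

definition smooth_curve ::
  "'a::euclidean_space set set \<Rightarrow> ('a \<Rightarrow> 'b::real_normed_vector) set
    \<Rightarrow> (real \<Rightarrow> 'a \<Rightarrow> 'b) \<Rightarrow> bool" where
  "smooth_curve \<T> V w \<longleftrightarrow>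
     (\<forall>t\<ge>0. w t \<in> V) \<and> (\<forall>x\<in>\<Union>\<T>. smooth_on {0..} (\<lambda>t. w t x))"

definition dt :: "(real \<Rightarrow> 'a \<Rightarrow> 'b::real_normed_vector) \<Rightarrow> real \<Rightarrow> 'a \<Rightarrow> 'b" where
  "dt w t x = vector_derivative (\<lambda>s. w s x) (at t within {0..})"

definition solves_semidiscrete ::
  "(real^'n::{finite,linorder}) set \<Rightarrow> (real^'n::{finite,linorder}) set set \<Rightarrow> real \<Rightarrow> real
    \<Rightarrow> (real \<Rightarrow> real^'n::{finite,linorder} \<Rightarrow> real^'n::{finite,linorder})
    \<Rightarrow> (real \<Rightarrow> real^'n::{finite,linorder} \<Rightarrow> real) \<Rightarrow> bool" where
  "solves_semidiscrete \<Omega> \<T> \<gamma> \<alpha> u q \<longleftrightarrow>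
     (\<forall>t\<ge>0. \<forall>v\<in>P1_vec \<T>. \<forall>p\<in>P1 \<T>.
        lumped_inner \<Omega> \<T> (dt u t) v
        + \<gamma> * L2_inner \<Omega> (grad_vec \<Omega> (u t)) (grad_vec \<Omega> v)
        + \<gamma> * L2_inner \<Omega> (q t) (nodal_interp \<T> (\<lambda>x. u t x \<bullet> v x))
        + \<alpha> * lumped_inner \<Omega> \<T> (\<lambda>x. vcross (u t x) (dt u t x)) v = 0
      \<and> L2_inner \<Omega> (nodal_interp \<T> (\<lambda>x. u t x \<bullet> u t x)) p = L2_inner \<Omega> (\<lambda>_. 1) p)"

end

theory Submission
  imports Defs
begin

text \<open>The constraint forces \<open>\<bar>u\<^sub>h(a)\<bar> = 1\<close> at the nodes, so \<open>u\<^sub>h \<bullet> \<partial>\<^sub>t u\<^sub>h\<close> vanishes there and testing with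
  \<open>\<partial>\<^sub>t u\<^sub>h\<close> shows that \<open>\<parallel>\<nabla>u\<^sub>h\<parallel>\<close> does not increase. Testing with the interpolant of \<open>p u\<^sub>h\<close> removes both lumped terms
  and gives \<open>(q\<^sub>h, p) = - (\<nabla>u\<^sub>h, \<nabla>i(p u\<^sub>h))\<close> for every discrete \<open>p\<close>. For \<open>p = q\<^sub>h\<close> an inverse inequality yields
  \<open>\<parallel>q\<^sub>h\<parallel> \<le> C h\<^sup>-\<^sup>1 \<parallel>\<nabla>u\<^sub>h\<parallel>\<close>. For a test function \<open>f\<close> in \<open>H\<^sup>1 \<inter> L\<^sup>\<infinity>\<close> one splits \<open>f = p + (f - p)\<close> with a
  quasi-interpolant \<open>p\<close>: the first part is bounded by \<open>C \<parallel>\<nabla>u\<^sub>h\<parallel> (\<parallel>\<nabla>u\<^sub>h\<parallel> \<parallel>f\<parallel>\<^sub>\<infinity> + \<parallel>\<nabla>f\<parallel>)\<close>, and in the second the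
  factor \<open>h\<^sup>-\<^sup>1\<close> is absorbed by \<open>\<parallel>f - p\<parallel> \<le> C h \<parallel>\<nabla>f\<parallel>\<close>. Hence the stability of the \<open>L\<^sup>2\<close> projection in
  \<open>H\<^sup>1\<close> and \<open>L\<^sup>\<infinity>\<close> is not needed, and the bound holds at every single time.\<close>

section \<open>Smooth functions and cut-offs\<close>

text \<open>The dual norm tests with functions of H^1 and L^\<infinity>, which in dimension 2 or 3
  have no nodal values. Their discrete substitute \<open>p\<close> must be bounded at the nodes by
  the sup norm with a constant free of h, because the product rule for \<open>p u\<close> leaves
  \<open>p\<close> undifferentiated in one term. Averages have this property. The obstacle is a node
  on the boundary, whose surrounding ball is cut by \<Omega> in an uncontrolled shape; the Lipschitz
  charts give a direction in which the ball can be moved inside over a distance proportional to h,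
  and the move costs only a translation estimate. This works for h below a threshold
  \<open>h0\<close>; on coarser meshes 1/h is at most 1/\<open>h0\<close> and Cauchy-Schwarz
  suffices. A second obstacle is that \<open>grad\<close> is a choice: weak gradients must be shown
  unique and the elementwise gradient must be identified as one before anything discrete can be
  computed. The density of test functions serves both this uniqueness and the translation
  estimate.\<close>

lemma Ck_on_UNIV_SucI:
  assumes "\<And>x. (f has_derivative f' x) (at x)"
    and "\<And>b. b \<in> Basis \<Longrightarrow> Ck_on k UNIV (\<lambda>x. f' x b)"
  shows "Ck_on (Suc k) UNIV f"
proof -
  have "frechet_derivative f (at x) = f' x" for x
    using assms(1) by (metis frechet_derivative_at)
  then show ?thesis
    using assms by (auto simp: differentiable_on_def differentiable_def)
qed

lemma Ck_on_UNIV_SucD: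
  assumes "Ck_on (Suc k) UNIV f"
  shows "(f has_derivative frechet_derivative f (at x)) (at x)"
    and "b \<in> Basis \<Longrightarrow> Ck_on k UNIV (\<lambda>x. frechet_derivative f (at x) b)"
  using assms by (auto simp: differentiable_on_def frechet_derivative_works)

text \<open>The recursion of \<open>Ck_on\<close> asks for continuity only at the bottom level, so
  monotonicity rests on differentiability implying continuity. The product rule uses it: each of its
  terms keeps one factor undifferentiated, which has to be placed one class lower.\<close>

lemma Ck_on_UNIV_antimono: "Ck_on (Suc k) UNIV f \<Longrightarrow> Ck_on k UNIV f"
proof (induction k arbitrary: f)
  case 0
  then show ?case by (auto intro: differentiable_imp_continuous_on)
next
  case (Suc k)
  show ?case
    by (rule Ck_on_UNIV_SucI[OF Ck_on_UNIV_SucD(1)[OF Suc.prems]])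
      (rule Suc.IH[OF Ck_on_UNIV_SucD(2)[OF Suc.prems]])
qed

lemma Ck_on_UNIV_const: "Ck_on k UNIV (\<lambda>x. c)"
proof (induction k arbitrary: c)
  case 0 show ?case by simp
next
  case (Suc k)
  show ?case by (rule Ck_on_UNIV_SucI[where f' = "\<lambda>x h. 0"]) (auto intro: Suc.IH)
qed

lemma Ck_on_UNIV_add:
  "Ck_on k UNIV f \<Longrightarrow> Ck_on k UNIV g \<Longrightarrow> Ck_on k UNIV (\<lambda>x. f x + g x)"
proof (induction k arbitrary: f g)
  case 0 then show ?case by (simp add: continuous_on_add)
next
  case (Suc k)
  show ?case
    by (rule Ck_on_UNIV_SucI[OF has_derivative_add[OF Ck_on_UNIV_SucD(1)[OF Suc.prems(1)] Ck_on_UNIV_SucD(1)[OF Suc.prems(2)]]])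
      (intro Suc.IH Ck_on_UNIV_SucD(2)[OF Suc.prems(1)] Ck_on_UNIV_SucD(2)[OF Suc.prems(2)])
qed

lemma Ck_on_UNIV_mult:
  fixes f g :: "'a::euclidean_space \<Rightarrow> real"
  shows "Ck_on k UNIV f \<Longrightarrow> Ck_on k UNIV g \<Longrightarrow> Ck_on k UNIV (\<lambda>x. f x * g x)"
proof (induction k arbitrary: f g)
  case 0 then show ?case by (simp add: continuous_on_mult)
next
  case (Suc k)
  show ?case
    by (rule Ck_on_UNIV_SucI[OF has_derivative_mult[OF Ck_on_UNIV_SucD(1)[OF Suc.prems(1)] Ck_on_UNIV_SucD(1)[OF Suc.prems(2)]]])
      (intro Ck_on_UNIV_add Suc.IH Ck_on_UNIV_antimono[OF Suc.prems(1)] Ck_on_UNIV_antimono[OF Suc.prems(2)]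
         Ck_on_UNIV_SucD(2)[OF Suc.prems(1)] Ck_on_UNIV_SucD(2)[OF Suc.prems(2)])
qed

lemma Ck_on_UNIV_translate:
  assumes "Ck_on k UNIV f" shows "Ck_on k UNIV (\<lambda>x. f (x - w))"
  using assms
proof (induction k arbitrary: f)
  case 0
  then have "continuous_on UNIV f" by simp
  then show ?case by (auto intro!: continuous_intros elim: continuous_on_compose2)
next
  case (Suc k)
  have "((\<lambda>x. f (x - w)) has_derivative frechet_derivative f (at (x - w))) (at x)" for x
  proof -
    have "((\<lambda>x. x - w) has_derivative (\<lambda>h. h)) (at x)"
      by (auto intro!: derivative_eq_intros)
    from has_derivative_compose[OF this Ck_on_UNIV_SucD(1)[OF Suc.prems]] show ?thesis by simp
  qed
  then show ?case
    by (rule Ck_on_UNIV_SucI) (rule Suc.IH[OF Ck_on_UNIV_SucD(2)[OF Suc.prems]])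
qed

lemma smooth_on_UNIV_const: "smooth_on UNIV (\<lambda>x. c)"
  by (simp add: smooth_on_def Ck_on_UNIV_const)

lemma smooth_on_UNIV_add:
  "smooth_on UNIV f \<Longrightarrow> smooth_on UNIV g \<Longrightarrow> smooth_on UNIV (\<lambda>x. f x + g x)"
  by (simp add: smooth_on_def Ck_on_UNIV_add)

lemma smooth_on_UNIV_mult:
  fixes f g :: "'a::euclidean_space \<Rightarrow> real"
  shows "smooth_on UNIV f \<Longrightarrow> smooth_on UNIV g \<Longrightarrow> smooth_on UNIV (\<lambda>x. f x * g x)"
  by (simp add: smooth_on_def Ck_on_UNIV_mult)

lemma smooth_on_UNIV_diff:
  fixes f g :: "'a::euclidean_space \<Rightarrow> real"
  assumes "smooth_on UNIV f" "smooth_on UNIV g" shows "smooth_on UNIV (\<lambda>x. f x - g x)"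
  using smooth_on_UNIV_add[OF assms(1) smooth_on_UNIV_mult[OF smooth_on_UNIV_const[of "-1"] assms(2)]]
  by simp

lemma smooth_on_UNIV_prod:
  fixes f :: "'i \<Rightarrow> 'a::euclidean_space \<Rightarrow> real"
  assumes "\<And>i. i \<in> I \<Longrightarrow> smooth_on UNIV (f i)" shows "smooth_on UNIV (\<lambda>x. \<Prod>i\<in>I. f i x)"
  using assms by (induction I rule: infinite_finite_induct)
    (auto intro: smooth_on_UNIV_const smooth_on_UNIV_mult)

lemma smooth_on_UNIV_bounded_linear:
  assumes "bounded_linear f" shows "smooth_on UNIV f"
  unfolding smooth_on_def
proof
  fix k show "Ck_on k UNIV f"
  proof (cases k)
    case 0 then show ?thesis using assms linear_continuous_on by auto
  next
    case (Suc j)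
    show ?thesis unfolding Suc
      by (rule Ck_on_UNIV_SucI[OF bounded_linear_imp_has_derivative[OF assms]]) (rule Ck_on_UNIV_const)
  qed
qed

lemma smooth_on_UNIV_polynomial_function:
  assumes "real_polynomial_function p" shows "smooth_on UNIV p"
  using assms by induction
    (auto intro: smooth_on_UNIV_bounded_linear smooth_on_UNIV_const smooth_on_UNIV_add smooth_on_UNIV_mult)

lemma smooth_on_UNIV_continuous: "smooth_on UNIV f \<Longrightarrow> continuous_on UNIV f"
  unfolding smooth_on_def by (metis Ck_on.simps(1))

lemma smooth_on_UNIV_has_derivative:
  "smooth_on UNIV f \<Longrightarrow> (f has_derivative frechet_derivative f (at x)) (at x)"
  unfolding smooth_on_def by (metis Ck_on_UNIV_SucD(1))

lemma smooth_on_UNIV_continuous_derivative: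
  assumes "smooth_on UNIV f" shows "continuous_on UNIV (\<lambda>x. frechet_derivative f (at x) v)"
proof -
  have c: "b \<in> Basis \<Longrightarrow> continuous_on UNIV (\<lambda>x. frechet_derivative f (at x) b)" for b
    using assms unfolding smooth_on_def by (metis Ck_on_UNIV_SucD(2) Ck_on.simps(1))
  have "frechet_derivative f (at x) v = (\<Sum>b\<in>Basis. (v \<bullet> b) *\<^sub>R frechet_derivative f (at x) b)" for x
  proof -
    interpret linear "frechet_derivative f (at x)"
      using smooth_on_UNIV_has_derivative[OF assms, of x] has_derivative_linear by blast
    show ?thesis by (subst euclidean_representation[of v, symmetric]) (simp only: sum scale)
  qed
  then show ?thesis by (auto intro!: continuous_intros c)
qed

lemma smooth_on_UNIV_translate: "smooth_on UNIV f \<Longrightarrow> smooth_on UNIV (\<lambda>x. f (x - w))"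
  by (simp add: smooth_on_def Ck_on_UNIV_translate)

section \<open>Smooth cut-off functions exhausting an open set\<close>

definition flat :: "nat \<Rightarrow> real \<Rightarrow> real" where
  "flat k t = (if t > 0 then exp (- 1 / t) / t ^ k else 0)"

text \<open>Keep only the term of index k + 2 of the exponential series at 1/t. The index is two
  above k so that a factor t^2 remains, which makes the difference quotient at 0 tend to 0.\<close>

lemma flat_le:
  assumes "t > 0" shows "flat k t \<le> fact (k + 2) * t\<^sup>2"
proof -
  define F :: real where "F = fact (k + 2)"
  have F: "F > 0" by (simp add: F_def)
  have "(\<Sum>n\<in>{k+2}. (1/t) ^ n /\<^sub>R fact n) \<le> (\<Sum>n. (1/t) ^ n /\<^sub>R fact n)"
    by (rule sum_le_suminf[OF summable_exp_generic]) (use assms in auto)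
  then have "(1/t) ^ (k+2) / F \<le> exp (1/t)"
    unfolding exp_def F_def by (simp only: sum.insert sum.empty finite.emptyI real_scaleR_def divide_inverse mult.commute)
      simp
  then have "exp (-1/t) * ((1/t) ^ (k+2) / F) \<le> exp (-1/t) * exp (1/t)"
    by (intro mult_left_mono) auto
  also have "\<dots> = 1" by (simp add: exp_minus)
  finally have "exp (-1/t) / t^(k+2) \<le> F" using F assms by (simp add: power_divide field_simps)
  moreover have "flat k t = exp (-1/t) / t^(k+2) * t\<^sup>2"
    using assms by (simp add: flat_def power_add power2_eq_square)
  ultimately show ?thesis unfolding F_def[symmetric] by (metis mult_right_mono zero_le_power2)
qed

lemma flat_nonneg: "flat k t \<ge> 0"
  by (simp add: flat_def)

text \<open>The parameter k makes the family closed under differentiation: the derivative of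
  exp(-1/t)/t^k combines the members k + 2 and k + 1. Smoothness of all members then follows by one
  induction with k arbitrary, and no polynomial coefficients have to be tracked.\<close>

lemma flat_has_derivative:
  "(flat k has_field_derivative (flat (k+2) t - k * flat (k+1) t)) (at t)"
proof -
  consider "t > 0" | "t < 0" | "t = 0" by linarith
  then show ?thesis
  proof cases
    case 1
    have "((\<lambda>t. exp (- 1 / t) / t ^ k) has_field_derivative (flat (k+2) t - k * flat (k+1) t)) (at t)"
    proof (cases k)
      case 0
      then show ?thesis using 1
        by (auto intro!: derivative_eq_intros simp: flat_def field_simps power2_eq_square)
    next
      case (Suc j)
      have "((\<lambda>t. exp (- 1 / t) / t ^ Suc j) has_field_derivative
          (exp (- 1 / t) * (1 / t\<^sup>2) * t ^ Suc j - exp (- 1 / t) * (real (Suc j) * t ^ j)) / (t ^ Suc j * t ^ Suc j)) (at t)"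
        using 1 by (auto intro!: derivative_eq_intros simp: power2_eq_square simp del: power_Suc)
      moreover have "(exp (- 1 / t) * (1 / t\<^sup>2) * t ^ Suc j - exp (- 1 / t) * (real (Suc j) * t ^ j)) / (t ^ Suc j * t ^ Suc j)
        = flat (Suc j + 2) t - Suc j * flat (Suc j + 1) t"
        using 1 by (simp add: flat_def divide_simps power2_eq_square) (cases j; simp add: algebra_simps)
      ultimately show ?thesis unfolding Suc by simp
    qed
    then show ?thesis
      by (rule has_field_derivative_transform_within_open[where S="{0<..}"]) (use 1 in \<open>auto simp: flat_def\<close>)
  next
    case 2
    have "((\<lambda>t. 0) has_field_derivative 0) (at t)" by auto
    then have "(flat k has_field_derivative 0) (at t)"
      by (rule has_field_derivative_transform_within_open[where S="{..<0}"]) (use 2 in \<open>auto simp: flat_def\<close>)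
    then show ?thesis using 2 by (simp add: flat_def)
  next
    case 3
    have "((\<lambda>h. (flat k (0 + h) - flat k 0) / h) \<longlongrightarrow> 0) (at 0)"
    proof (rule Lim_null_comparison)
      show "\<forall>\<^sub>F h in at 0. norm ((flat k (0 + h) - flat k 0) / h) \<le> fact (k+2) * \<bar>h\<bar>"
      proof (rule always_eventually, rule allI)
        fix h :: real
        show "norm ((flat k (0 + h) - flat k 0) / h) \<le> fact (k+2) * \<bar>h\<bar>"
        proof (cases "h > 0")
          case True
          have "flat k h / h \<le> fact (k + 2) * h\<^sup>2 / h"
            using True by (intro divide_right_mono flat_le) auto
          also have "\<dots> = fact (k + 2) * h" using True by (simp add: power2_eq_square)
          finally show ?thesis using True flat_nonneg[of k h] by (simp add: flat_def[of k 0])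
        next
          case False
          then have "norm ((flat k (0 + h) - flat k 0) / h) = 0" by (simp add: flat_def)
          also have "0 \<le> fact (k + 2) * \<bar>h\<bar>" by (intro mult_nonneg_nonneg) auto
          finally show ?thesis .
        qed
      qed
      show "((\<lambda>h. fact (k+2) * \<bar>h::real\<bar>) \<longlongrightarrow> 0) (at 0)"
        by (auto intro!: tendsto_eq_intros)
    qed
    then show ?thesis using 3 by (simp add: DERIV_def flat_def)
  qed
qed

lemma Ck_on_flat: "Ck_on n UNIV (\<lambda>x::'a::euclidean_space. flat k (x \<bullet> v + c))"
proof (induction n arbitrary: k)
  case 0
  have "continuous_on UNIV (flat k)"
    using flat_has_derivative DERIV_isCont by (blast intro: continuous_at_imp_continuous_on)
  then show ?case
    by (auto intro!: continuous_intros elim: continuous_on_compose2)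
next
  case (Suc n)
  show ?case
  proof (rule Ck_on_UNIV_SucI)
    fix x :: 'a
    show "((\<lambda>x. flat k (x \<bullet> v + c)) has_derivative
       (\<lambda>h. (flat (k+2) (x \<bullet> v + c) + (- real k) * flat (k+1) (x \<bullet> v + c)) * (h \<bullet> v))) (at x)"
    proof -
      have "((\<lambda>x. x \<bullet> v + c) has_derivative (\<lambda>h. h \<bullet> v)) (at x)"
        by (auto intro!: derivative_eq_intros)
      from has_derivative_compose[where g = "flat k", OF this flat_has_derivative[unfolded has_field_derivative_def]]
      show ?thesis by simp
    qed
  qed (intro Ck_on_UNIV_mult Ck_on_UNIV_add Ck_on_UNIV_const Suc.IH)
qed

text \<open>The factor m sharpens the profile: for s > 0 the value \<open>flat 0 (m * s)\<close> is
  exp(-1/(m s)) and tends to 1 as m grows. The bumps thus converge pointwise to the indicator of the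
  open box while vanishing outside it for every m.\<close>

definition bump :: "nat \<Rightarrow> 'a::euclidean_space \<Rightarrow> 'a \<Rightarrow> 'a \<Rightarrow> real" where
  "bump m a b x = (\<Prod>i\<in>Basis. flat 0 (m * ((x - a) \<bullet> i)) * flat 0 (m * ((b - x) \<bullet> i)))"

lemma smooth_on_bump: "smooth_on UNIV (bump m a b)"
proof -
  have 1: "smooth_on UNIV (\<lambda>x. flat 0 (m * ((x - a) \<bullet> i)))" for i
    using Ck_on_flat[of _ 0 "real m *\<^sub>R i" "- (m * (a \<bullet> i))"]
    by (simp add: algebra_simps inner_diff_left smooth_on_def)
  have 2: "smooth_on UNIV (\<lambda>x. flat 0 (m * ((b - x) \<bullet> i)))" for i
    using Ck_on_flat[of _ 0 "- real m *\<^sub>R i" "m * (b \<bullet> i)"]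
    by (simp add: algebra_simps inner_diff_left smooth_on_def)
  show ?thesis unfolding bump_def
    by (intro smooth_on_UNIV_prod smooth_on_UNIV_mult 1 2)
qed

lemma bump_range: "0 \<le> bump m a b x" "bump m a b x \<le> 1"
proof -
  have "flat 0 t \<le> 1" for t by (simp add: flat_def)
  then have "0 \<le> bump m a b x \<and> bump m a b x \<le> 1"
    unfolding bump_def
    by (auto intro!: prod_nonneg prod_le_1 mult_nonneg_nonneg mult_le_one flat_nonneg)
  then show "0 \<le> bump m a b x" "bump m a b x \<le> 1" by auto
qed

lemma bump_outside: assumes "x \<notin> box a b" shows "bump m a b x = 0"
proof -
  obtain i where "i \<in> Basis" "\<not> (a \<bullet> i < x \<bullet> i \<and> x \<bullet> i < b \<bullet> i)"
    using assms by (auto simp: mem_box)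
  then have "(x - a) \<bullet> i \<le> 0 \<or> (b - x) \<bullet> i \<le> 0" by (auto simp: inner_diff_left)
  then have "flat 0 (m * ((x - a) \<bullet> i)) * flat 0 (m * ((b - x) \<bullet> i)) = 0"
    by (auto simp: flat_def zero_less_mult_iff)
  then show ?thesis unfolding bump_def using \<open>i \<in> Basis\<close> by (auto intro: prod_zero)
qed

lemma bump_tendsto: assumes "x \<in> box a b" shows "(\<lambda>m. bump m a b x) \<longlonglongrightarrow> 1"
proof -
  have *: "(\<lambda>m. flat 0 (real m * t)) \<longlonglongrightarrow> 1" if "t > 0" for t
  proof -
    have "(\<lambda>m. exp (- 1 / t * (1 / real m))) \<longlonglongrightarrow> exp (-1 / t * 0)"
      by (intro tendsto_intros lim_1_over_n)
    then have "(\<lambda>m. exp (- 1 / t * (1 / real m))) \<longlonglongrightarrow> 1" by simp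
    moreover have "\<forall>\<^sub>F m in sequentially. exp (- 1 / t * (1 / real m)) = flat 0 (real m * t)"
      using eventually_gt_at_top[of 0] by eventually_elim (use that in \<open>simp add: flat_def mult.commute\<close>)
    ultimately show ?thesis by (rule Lim_transform_eventually)
  qed
  have "(\<lambda>m. bump m a b x) \<longlonglongrightarrow> (\<Prod>i\<in>(Basis::'a set). 1 * 1)"
    unfolding bump_def
    by (intro tendsto_prod tendsto_mult *) (use assms in \<open>auto simp: mem_box inner_diff_left\<close>)
  then show ?thesis by simp
qed

text \<open>Countably many open boxes with closures inside the set cover it. One minus the product
  of the complements of the first m bumps stays in [0, 1], has its support in finitely many closed
  boxes, and tends to 1 at a point because a box containing that point eventually enters the
  product.\<close>

lemma ex_cutoffs:
  fixes A :: "'a::euclidean_space set"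
  assumes "open A"
  obtains \<zeta> :: "nat \<Rightarrow> 'a \<Rightarrow> real" where "\<And>m. test_function A (\<zeta> m)"
    "\<And>m x. 0 \<le> \<zeta> m x" "\<And>m x. \<zeta> m x \<le> 1" "\<And>x. x \<in> A \<Longrightarrow> (\<lambda>m. \<zeta> m x) \<longlonglongrightarrow> 1"
proof -
  have "\<exists>a b. x \<in> box a b \<and> cbox a b \<subseteq> A" if "x \<in> A" for x
    using open_contains_cbox[OF assms that] by metis
  define \<B> where "\<B> = {box a b | a b::'a. cbox a b \<subseteq> A}"
  have "\<And>S. S \<in> \<B> \<Longrightarrow> open S" by (auto simp: \<B>_def open_box)
  then obtain \<C> where C: "\<C> \<subseteq> \<B>" "countable \<C>" "\<Union>\<C> = \<Union>\<B>" by (metis Lindelof)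
  have UA: "\<Union>\<C> = A" unfolding C(3) \<B>_def
    using \<open>\<And>x. x \<in> A \<Longrightarrow> \<exists>a b. x \<in> box a b \<and> cbox a b \<subseteq> A\<close> box_subset_cbox by fast
  \<comment> \<open>The added empty box makes the family nonempty, so that
    \<open>from_nat_into\<close> enumerates it even when A is empty.\<close>
  have "\<forall>S\<in>insert {} \<C>. \<exists>ab. S = box (fst ab) (snd ab) \<and> cbox (fst ab) (snd ab) \<subseteq> A"
  proof
    fix S assume "S \<in> insert {} \<C>"
    moreover have "{} = box (One::'a) 0" "cbox (One::'a) 0 = {}"
      unfolding box_eq_empty eq_commute[of "{}"] using SOME_Basis by force+
    moreover have "S = {} \<or> (\<exists>a b. S = box a b \<and> cbox a b \<subseteq> A)"
      using C(1) \<open>S \<in> insert {} \<C>\<close> unfolding \<B>_def by blast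
    ultimately show "\<exists>ab. S = box (fst ab) (snd ab) \<and> cbox (fst ab) (snd ab) \<subseteq> A"
      by (metis empty_subsetI fst_conv snd_conv)
  qed
  then obtain ab where ab: "\<And>S. S \<in> insert {} \<C> \<Longrightarrow> S = box (fst (ab S)) (snd (ab S)) \<and> cbox (fst (ab S)) (snd (ab S)) \<subseteq> A"
    by metis
  define f where "f = from_nat_into (insert {} \<C>)"
  have rf: "range f = insert {} \<C>" unfolding f_def using C(2) by (intro range_from_nat_into) auto
  define p r where "p j = fst (ab (f j))" and "r j = snd (ab (f j))" for j
  have pr: "f j = box (p j) (r j)" "cbox (p j) (r j) \<subseteq> A" for j
    using ab[of "f j"] rf unfolding p_def r_def by auto
  define \<zeta> where "\<zeta> m x = 1 - (\<Prod>j<m. 1 - bump m (p j) (r j) x)" for m and x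
  have P: "0 \<le> (\<Prod>j<m. 1 - bump m (p j) (r j) x)" "(\<Prod>j<m. 1 - bump m (p j) (r j) x) \<le> 1" for m x
    by (auto intro!: prod_nonneg prod_le_1 simp: bump_range)
  show thesis
  proof
    fix m
    have "smooth_on UNIV (\<zeta> m)" unfolding \<zeta>_def
      by (intro smooth_on_UNIV_diff smooth_on_UNIV_const smooth_on_UNIV_prod smooth_on_bump)
    moreover have "compact (\<Union>j<m. cbox (p j) (r j))" by auto
    moreover have "(\<Union>j<m. cbox (p j) (r j)) \<subseteq> A" using pr by auto
    moreover have "\<zeta> m x = 0" if "x \<notin> (\<Union>j<m. cbox (p j) (r j))" for x
    proof -
      have "bump m (p j) (r j) x = 0" if "j < m" for j
        using \<open>x \<notin> _\<close> that box_subset_cbox by (intro bump_outside) blast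
      then show ?thesis by (simp add: \<zeta>_def)
    qed
    ultimately show "test_function A (\<zeta> m)" unfolding test_function_def by blast
  next
    fix x assume "x \<in> A"
    then obtain j where j: "x \<in> f j" using UA rf
      by (metis UnionE insertCI rangeE)
    have "(\<lambda>m. 1 - bump m (p j) (r j) x) \<longlonglongrightarrow> 1 - 1"
      by (intro tendsto_intros bump_tendsto) (use j pr in simp)
    then have "(\<lambda>m. 1 - bump m (p j) (r j) x) \<longlonglongrightarrow> 0" by simp
    moreover have "\<forall>\<^sub>F m in sequentially. norm (\<Prod>j<m. 1 - bump m (p j) (r j) x) \<le> 1 - bump m (p j) (r j) x"
      using eventually_gt_at_top[of j]
    proof eventually_elim
      case (elim m)
      have "(\<Prod>j<m. 1 - bump m (p j) (r j) x) = (1 - bump m (p j) (r j) x) * (\<Prod>j\<in>{..<m} - {j}. 1 - bump m (p j) (r j) x)"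
        using elim by (intro prod.remove) auto
      also have "\<dots> \<le> (1 - bump m (p j) (r j) x) * 1"
        by (intro mult_left_mono prod_le_1) (auto simp: bump_range)
      finally show ?case using P by simp
    qed
    ultimately have "(\<lambda>m. \<Prod>j<m. 1 - bump m (p j) (r j) x) \<longlonglongrightarrow> 0"
      by (rule Lim_null_comparison[rotated])
    then have "(\<lambda>m. \<zeta> m x) \<longlonglongrightarrow> 1 - 0" unfolding \<zeta>_def by (intro tendsto_intros)
    then show "(\<lambda>m. \<zeta> m x) \<longlonglongrightarrow> 1" by simp
  qed (use P in \<open>auto simp: \<zeta>_def\<close>)
qed

section \<open>Density of test functions in \<open>L\<^sup>2\<close>\<close>

lemma finite_measure_lebesgue_on_bounded:
  assumes "bounded A" "A \<in> sets lebesgue" shows "finite_measure (lebesgue_on A)"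
proof -
  have "A \<in> lmeasurable" using assms bounded_set_imp_lmeasurable by blast
  from fmeasurableD2[OF this] show ?thesis
    by (intro finite_measureI) (simp add: emeasure_restrict_space assms)
qed

lemma integrable_mult_if_squares:
  fixes f g :: "'a \<Rightarrow> real"
  assumes [measurable]: "f \<in> borel_measurable M" "g \<in> borel_measurable M"
    and "integrable M (\<lambda>x. (f x)\<^sup>2)" "integrable M (\<lambda>x. (g x)\<^sup>2)"
  shows "integrable M (\<lambda>x. f x * g x)"
proof (rule Bochner_Integration.integrable_bound)
  show "integrable M (\<lambda>x. (f x)\<^sup>2 + (g x)\<^sup>2)" using assms by auto
  have "\<bar>f x * g x\<bar> \<le> (f x)\<^sup>2 + (g x)\<^sup>2" for x
    using sum_squares_bound[of "\<bar>f x\<bar>" "\<bar>g x\<bar>"] mult_nonneg_nonneg[of "\<bar>f x\<bar>" "\<bar>g x\<bar>"]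
    unfolding abs_mult power2_abs by linarith
  then show "AE x in M. norm (f x * g x) \<le> norm ((f x)\<^sup>2 + (g x)\<^sup>2)"
    by (intro AE_I2) (simp add: order_trans[OF _ abs_ge_self])
qed measurable

lemma integrable_diff_square:
  fixes f g :: "'a \<Rightarrow> real"
  assumes "f \<in> borel_measurable M" "g \<in> borel_measurable M"
    and "integrable M (\<lambda>x. (f x)\<^sup>2)" "integrable M (\<lambda>x. (g x)\<^sup>2)"
  shows "integrable M (\<lambda>x. (f x - g x)\<^sup>2)"
proof -
  have "integrable M (\<lambda>x. (f x)\<^sup>2 - 2 * (f x * g x) + (g x)\<^sup>2)"
    using assms by (intro Bochner_Integration.integrable_add Bochner_Integration.integrable_diff integrable_mult_right integrable_mult_if_squares)
  then show ?thesis by (simp add: power2_diff algebra_simps)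
qed

lemma (in finite_measure) integrable_if_square:
  fixes f :: "'a \<Rightarrow> real"
  assumes "f \<in> borel_measurable M" "integrable M (\<lambda>x. (f x)\<^sup>2)"
  shows "integrable M f"
  using integrable_mult_if_squares[OF assms(1) _ assms(2), of "\<lambda>_. 1"] by simp

text \<open>The measure is finite, so |f| c and c^2 are integrable majorants and dominated
  convergence applies to both sides. Every enlargement of the class of functions tested against f is
  an instance of this limit.\<close>

lemma square_integral_bound_limit:
  fixes f h :: "'a \<Rightarrow> real"
  assumes [measurable]: "f \<in> borel_measurable M" "h \<in> borel_measurable M" "\<And>n. g n \<in> borel_measurable M"
    and "finite_measure M" "integrable M (\<lambda>x. (f x)\<^sup>2)"
    and bd: "\<And>n. AE x in M. \<bar>g n x\<bar> \<le> c"
    and lim: "AE x in M. (\<lambda>n. g n x) \<longlonglongrightarrow> h x"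
    and le: "\<And>n::nat. (LINT x|M. f x * g n x) \<le> B * sqrt (LINT x|M. (g n x)\<^sup>2)"
  shows "(LINT x|M. f x * h x) \<le> B * sqrt (LINT x|M. (h x)\<^sup>2)"
proof -
  interpret finite_measure M by fact
  have f: "integrable M f" by (rule integrable_if_square) fact+
  have "(\<lambda>n. LINT x|M. f x * g n x) \<longlonglongrightarrow> (LINT x|M. f x * h x)"
  proof (rule integral_dominated_convergence[where w = "\<lambda>x. \<bar>f x\<bar> * c"])
    show "integrable M (\<lambda>x. \<bar>f x\<bar> * c)" using f by simp
    show "AE x in M. (\<lambda>n. f x * g n x) \<longlonglongrightarrow> f x * h x"
      using lim by eventually_elim (intro tendsto_intros)
    show "AE x in M. norm (f x * g n x) \<le> \<bar>f x\<bar> * c" for n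
      using bd[of n] by eventually_elim (simp add: abs_mult mult_left_mono)
  qed measurable
  moreover have "(\<lambda>n. LINT x|M. (g n x)\<^sup>2) \<longlonglongrightarrow> (LINT x|M. (h x)\<^sup>2)"
  proof (rule integral_dominated_convergence[where w = "\<lambda>x. c\<^sup>2"])
    show "AE x in M. (\<lambda>n. (g n x)\<^sup>2) \<longlonglongrightarrow> (h x)\<^sup>2"
      using lim by eventually_elim (intro tendsto_intros)
    show "AE x in M. norm ((g n x)\<^sup>2) \<le> c\<^sup>2" for n
      using bd[of n] by eventually_elim (simp add: abs_le_square_iff[symmetric])
  qed auto
  then have "(\<lambda>n. B * sqrt (LINT x|M. (g n x)\<^sup>2)) \<longlonglongrightarrow> B * sqrt (LINT x|M. (h x)\<^sup>2)"
    by (intro tendsto_intros)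
  ultimately show ?thesis by (rule LIMSEQ_le) (use le in auto)
qed

text \<open>Test functions are dense in \<open>L\<^sup>2(A)\<close>, in the dual form in which it is needed: cut-offs times
  polynomials, polynomials, continuous functions and truncations of \<open>f\<close> are tested in turn.\<close>

lemma square_integral_le_if_test_functions:
  fixes f :: "'a::euclidean_space \<Rightarrow> real"
  assumes A: "open A" "bounded A"
    and f: "f \<in> borel_measurable (lebesgue_on A)" "integrable (lebesgue_on A) (\<lambda>x. (f x)\<^sup>2)"
    and le: "\<And>\<eta>. test_function A \<eta> \<Longrightarrow>
      (LINT x|lebesgue_on A. f x * \<eta> x) \<le> B * sqrt (LINT x|lebesgue_on A. (\<eta> x)\<^sup>2)"
  shows "(LINT x|lebesgue_on A. (f x)\<^sup>2) \<le> B\<^sup>2"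
proof -
  note [measurable] = f(1)
  have As: "A \<in> sets lebesgue" using A(1) by auto
  then have sA: "space (lebesgue_on A) = A" by simp
  have fin: "finite_measure (lebesgue_on A)"
    using finite_measure_lebesgue_on_bounded[OF A(2) As] .
  interpret finite_measure "lebesgue_on A" by fact
  have cont: "g \<in> borel_measurable (lebesgue_on A)" if "continuous_on UNIV g" for g :: "'a \<Rightarrow> real"
    using that As continuous_imp_measurable_on_sets_lebesgue continuous_on_subset by blast
  have bdd: "\<exists>c. \<forall>x\<in>A. \<bar>g x\<bar> \<le> c" if "continuous_on UNIV g" for g :: "'a \<Rightarrow> real"
  proof -
    have "compact (closure A)" using A(2) by simp
    then have "compact (g ` closure A)" using that compact_continuous_image continuous_on_subset by blast
    then have "bounded (g ` closure A)" by (rule compact_imp_bounded)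
    then show ?thesis unfolding bounded_iff using closure_subset by fastforce
  qed
  obtain \<zeta> :: "nat \<Rightarrow> 'a \<Rightarrow> real" where z: "\<And>m. test_function A (\<zeta> m)"
    "\<And>m x. 0 \<le> \<zeta> m x" "\<And>m x. \<zeta> m x \<le> 1" "\<And>x. x \<in> A \<Longrightarrow> (\<lambda>m. \<zeta> m x) \<longlonglongrightarrow> 1"
    using ex_cutoffs[OF A(1)] by blast
  have poly: "(LINT x|lebesgue_on A. f x * p x) \<le> B * sqrt (LINT x|lebesgue_on A. (p x)\<^sup>2)"
    if p: "real_polynomial_function p" for p
  proof -
    have sp: "smooth_on UNIV p" using smooth_on_UNIV_polynomial_function[OF p] .
    obtain c where c: "\<And>x. x \<in> A \<Longrightarrow> \<bar>p x\<bar> \<le> c"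
      using bdd[OF smooth_on_UNIV_continuous[OF sp]] by blast
    have t: "test_function A (\<lambda>x. \<zeta> m x * p x)" for m
      using z(1)[of m] sp smooth_on_UNIV_mult unfolding test_function_def by (metis mult_zero_left)
    show ?thesis
    proof (rule square_integral_bound_limit[OF f(1) _ _ fin f(2) _ _ le[OF t], where c = c])
      show "p \<in> borel_measurable (lebesgue_on A)"
        using cont[OF smooth_on_UNIV_continuous[OF sp]] .
      show "(\<lambda>x. \<zeta> n x * p x) \<in> borel_measurable (lebesgue_on A)" for n
        using t[of n] smooth_on_UNIV_continuous cont unfolding test_function_def by blast
      show "AE x in lebesgue_on A. \<bar>\<zeta> n x * p x\<bar> \<le> c" for n
      proof (rule AE_I2)
        fix x assume "x \<in> space (lebesgue_on A)"
        then have "\<bar>\<zeta> n x\<bar> * \<bar>p x\<bar> \<le> 1 * c"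
          using z(2,3)[of n x] c[of x] sA by (intro mult_mono) auto
        then show "\<bar>\<zeta> n x * p x\<bar> \<le> c" by (simp add: abs_mult)
      qed
      show "AE x in lebesgue_on A. (\<lambda>n. \<zeta> n x * p x) \<longlonglongrightarrow> p x"
        using tendsto_mult_right[OF z(4)] by (intro AE_I2) (simp add: sA)
    qed
  qed
  have conts: "(LINT x|lebesgue_on A. f x * g x) \<le> B * sqrt (LINT x|lebesgue_on A. (g x)\<^sup>2)"
    if g: "continuous_on UNIV g" for g :: "'a \<Rightarrow> real"
  proof -
    have "\<exists>p. real_polynomial_function p \<and> (\<forall>x\<in>closure A. \<bar>g x - p x\<bar> < 1 / (real n + 1))" for n
      using Stone_Weierstrass_real_polynomial_function[of "closure A" g "1 / (real n + 1)"]
        A(2) continuous_on_subset[OF g] by (metis add.commute compact_closure of_nat_0_le_iff add_strict_increasing zero_less_divide_1_iff zero_less_one subset_UNIV)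
    then obtain p where p: "\<And>n. real_polynomial_function (p n)"
      "\<And>n x. x \<in> A \<Longrightarrow> \<bar>g x - p n x\<bar> < 1 / (real n + 1)"
      using closure_subset by (metis in_mono)
    obtain c where c: "\<And>x. x \<in> A \<Longrightarrow> \<bar>g x\<bar> \<le> c" using bdd[OF g] by blast
    show ?thesis
    proof (rule square_integral_bound_limit[OF f(1) cont[OF g] _ fin f(2) _ _ poly[OF p(1)], where c = "c + 1"])
      show "p n \<in> borel_measurable (lebesgue_on A)" for n
        by (rule cont[OF smooth_on_UNIV_continuous[OF smooth_on_UNIV_polynomial_function[OF p(1)]]])
      show "AE x in lebesgue_on A. \<bar>p n x\<bar> \<le> c + 1" for n
      proof (rule AE_I2)
        fix x assume "x \<in> space (lebesgue_on A)"
        then have "x \<in> A" using sA by simp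
        moreover have "1 / (real n + 1) \<le> 1" by simp
        ultimately show "\<bar>p n x\<bar> \<le> c + 1" using p(2)[of x n] c[of x] by linarith
      qed
      show "AE x in lebesgue_on A. (\<lambda>n. p n x) \<longlonglongrightarrow> g x"
      proof (rule AE_I2)
        fix x assume "x \<in> space (lebesgue_on A)"
        then have "\<forall>\<^sub>F n in sequentially. norm (p n x - g x) \<le> 1 / (real n + 1)"
          using p(2)[of x] sA by (auto simp: abs_minus_commute intro!: always_eventually less_imp_le)
        moreover have "(\<lambda>n. 1 / (real n + 1)) \<longlonglongrightarrow> 0"
          using LIMSEQ_inverse_real_of_nat by (simp add: inverse_eq_divide add.commute)
        ultimately have "(\<lambda>n. p n x - g x) \<longlonglongrightarrow> 0" by (rule Lim_null_comparison)
        then show "(\<lambda>n. p n x) \<longlonglongrightarrow> g x" by (simp add: LIM_zero_iff)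
      qed
    qed
  qed
  define cl where "cl n t = max (- real n) (min (real n) t)" for n and t :: real
  have cl_cont: "continuous_on UNIV (\<lambda>x. cl n (g x))" if "continuous_on UNIV g" for n and g :: "'a \<Rightarrow> real"
    using that unfolding cl_def by (intro continuous_intros)
  have cl_lim: "(\<lambda>k. cl n (g k)) \<longlonglongrightarrow> cl n l" if "g \<longlonglongrightarrow> l" for n g l
    using that unfolding cl_def by (intro tendsto_intros)
  have cl_bd: "\<bar>cl n t\<bar> \<le> real n" for n t by (auto simp: cl_def)
  have cl_sq: "(cl n t)\<^sup>2 \<le> t * cl n t" "(cl n t)\<^sup>2 \<le> t\<^sup>2" for n t
  proof -
    have *: "\<bar>cl n t\<bar> \<le> \<bar>t\<bar> \<and> cl n t * t \<ge> 0" by (auto simp: cl_def max_def min_def zero_le_mult_iff mult_le_0_iff)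
    then show "(cl n t)\<^sup>2 \<le> t\<^sup>2" by (simp add: abs_le_square_iff[symmetric])
    have "(cl n t)\<^sup>2 = \<bar>cl n t\<bar> * \<bar>cl n t\<bar>" by (simp add: power2_eq_square)
    also have "\<dots> \<le> \<bar>t\<bar> * \<bar>cl n t\<bar>" using * by (intro mult_right_mono) auto
    also have "\<dots> = t * cl n t" using * by (metis abs_mult abs_of_nonneg mult.commute)
    finally show "(cl n t)\<^sup>2 \<le> t * cl n t" .
  qed
  \<comment> \<open>\<open>measurable_on\<close> supplies continuous functions converging to f off a
    null set. They need not be uniformly bounded, so they are truncated at the same level as f
    before the limit lemma is applied.\<close>
  have "f measurable_on A" using f(1) As measurable_on_iff_borel_measurable by blast
  then obtain N g where N: "negligible N" and g: "\<And>n. continuous_on UNIV (g n)"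
    "\<And>x. x \<notin> N \<Longrightarrow> (\<lambda>n. g n x) \<longlonglongrightarrow> (if x \<in> A then f x else 0)"
    unfolding measurable_on_def by blast
  have [measurable]: "(\<lambda>x. cl n (f x)) \<in> borel_measurable (lebesgue_on A)" for n
    unfolding cl_def by measurable
  have trunc: "(LINT x|lebesgue_on A. f x * cl n (f x)) \<le> B * sqrt (LINT x|lebesgue_on A. (cl n (f x))\<^sup>2)" for n
  proof (rule square_integral_bound_limit[OF f(1) _ _ fin f(2) _ _ conts[OF cl_cont[OF g(1)]], where c = n])
    show "(\<lambda>x. cl n (g k x)) \<in> borel_measurable (lebesgue_on A)" for k
      by (rule cont[OF cl_cont[OF g(1)]])
    have "AE x in lebesgue. x \<notin> N"
      using N by (simp add: AE_not_in negligible_iff_null_sets)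
    then have "AE x in lebesgue_on A. x \<notin> N"
      by (subst AE_restrict_space_iff) (auto simp: As)
    then show "AE x in lebesgue_on A. (\<lambda>k. cl n (g k x)) \<longlonglongrightarrow> cl n (f x)"
      using AE_space by eventually_elim (use cl_lim g(2) sA in fastforce)
  qed (use cl_bd in auto)
  \<comment> \<open>The truncation satisfies (cl f)^2 \<le> f cl f, so testing with it gives S \<le>
    B sqrt S for its square integral S. Dividing by sqrt S leaves a bound uniform in the truncation
    level.\<close>
  have bound: "(LINT x|lebesgue_on A. (cl n (f x))\<^sup>2) \<le> B\<^sup>2" for n
  proof -
    let ?S = "LINT x|lebesgue_on A. (cl n (f x))\<^sup>2"
    have i: "integrable (lebesgue_on A) (\<lambda>x. (cl n (f x))\<^sup>2)"
      by (rule Bochner_Integration.integrable_bound[OF f(2)]) (auto simp: cl_sq)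
    have "?S \<le> (LINT x|lebesgue_on A. f x * cl n (f x))"
      by (intro integral_mono i integrable_mult_if_squares f cl_sq) auto
    also have "\<dots> \<le> B * sqrt ?S" by (rule trunc)
    finally have 1: "?S \<le> B * sqrt ?S" .
    have S0: "?S \<ge> 0" by simp
    show ?thesis
    proof (cases "?S = 0")
      case False
      then have "?S > 0" using S0 by linarith
      then have s: "sqrt ?S > 0" by (rule real_sqrt_gt_zero)
      have "sqrt ?S * sqrt ?S \<le> B * sqrt ?S" using 1 S0 by simp
      then have "sqrt ?S \<le> B" using s mult_le_cancel_right_pos by blast
      then show ?thesis using s S0 by (metis less_imp_le real_le_lsqrt real_sqrt_le_iff real_sqrt_pow2 power_mono real_sqrt_ge_zero)
    qed simp
  qed
  have "(\<lambda>n. LINT x|lebesgue_on A. (cl n (f x))\<^sup>2) \<longlonglongrightarrow> (LINT x|lebesgue_on A. (f x)\<^sup>2)"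
  proof (rule integral_dominated_convergence[OF _ _ f(2)])
    show "AE x in lebesgue_on A. (\<lambda>n. (cl n (f x))\<^sup>2) \<longlonglongrightarrow> (f x)\<^sup>2"
    proof (rule AE_I2)
      fix x
      obtain k where k: "\<bar>f x\<bar> \<le> real k" using real_arch_simple by blast
      have "\<forall>\<^sub>F n in sequentially. (f x)\<^sup>2 = (cl n (f x))\<^sup>2"
        using eventually_ge_at_top[of k]
      proof eventually_elim
        case (elim n)
        then have "\<bar>f x\<bar> \<le> real n" using k by linarith
        then show ?case by (simp add: cl_def)
      qed
      then show "(\<lambda>n. (cl n (f x))\<^sup>2) \<longlonglongrightarrow> (f x)\<^sup>2"
        by (rule Lim_transform_eventually[OF tendsto_const])
    qed
  qed (auto simp: cl_sq)
  then show ?thesis by (rule LIMSEQ_le_const2) (use bound in auto)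
qed

text \<open>The density bound with B = 0; it is applied to differences of weak gradients.\<close>

lemma AE_zero_if_test_functions:
  fixes f :: "'a::euclidean_space \<Rightarrow> real"
  assumes A: "open A" "bounded A"
    and f: "f \<in> borel_measurable (lebesgue_on A)" "integrable (lebesgue_on A) (\<lambda>x. (f x)\<^sup>2)"
    and zero: "\<And>\<eta>. test_function A \<eta> \<Longrightarrow> (LINT x|lebesgue_on A. f x * \<eta> x) = 0"
  shows "AE x in lebesgue_on A. f x = 0"
proof -
  have "(LINT x|lebesgue_on A. (f x)\<^sup>2) \<le> 0\<^sup>2"
    by (rule square_integral_le_if_test_functions[OF A f]) (simp add: zero)
  then have "(LINT x|lebesgue_on A. (f x)\<^sup>2) = 0"
    by (simp add: order_antisym)
  then show ?thesis
    using integral_nonneg_eq_0_iff_AE[OF f(2)] by simp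
qed

section \<open>Translation estimate for weak gradients\<close>

lemma integral_cauchy_schwarz:
  fixes f g :: "'a \<Rightarrow> real"
  assumes "f \<in> borel_measurable M" "g \<in> borel_measurable M"
    and f2: "integrable M (\<lambda>x. (f x)\<^sup>2)" and g2: "integrable M (\<lambda>x. (g x)\<^sup>2)"
  shows "\<bar>LINT x|M. f x * g x\<bar> \<le> sqrt (LINT x|M. (f x)\<^sup>2) * sqrt (LINT x|M. (g x)\<^sup>2)"
proof -
  define a b c where "a = (LINT x|M. (f x)\<^sup>2)" and "b = (LINT x|M. (g x)\<^sup>2)" and "c = (LINT x|M. f x * g x)"
  have fg: "integrable M (\<lambda>x. f x * g x)" by (rule integrable_mult_if_squares) fact+
  have ab: "a \<ge> 0" "b \<ge> 0" by (simp_all add: a_def b_def)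
  have "c\<^sup>2 \<le> a * b"
  proof (cases "b = 0")
    case True
    then have "AE x in M. (g x)\<^sup>2 = 0"
      unfolding b_def by (subst (asm) integral_nonneg_eq_0_iff_AE[OF g2]) auto
    then have "c = (LINT x|M. 0)"
      unfolding c_def using assms by (intro integral_cong_AE) (auto elim!: eventually_mono)
    then show ?thesis using ab by simp
  next
    case False
    define t where "t = c / b"
    have "0 \<le> (LINT x|M. (f x - t * g x)\<^sup>2)" by simp
    also have "\<dots> = (LINT x|M. (f x)\<^sup>2 - 2 * t * (f x * g x) + t\<^sup>2 * (g x)\<^sup>2)"
      by (simp add: power2_diff power_mult_distrib algebra_simps)
    also have "\<dots> = a - 2 * t * c + t\<^sup>2 * b"
      using f2 g2 fg by (simp add: a_def b_def c_def)
    also have "\<dots> = a - c\<^sup>2 / b" using False by (simp add: t_def power2_eq_square field_simps)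
    finally show ?thesis using ab False by (simp add: field_simps)
  qed
  then have "\<bar>c\<bar> \<le> sqrt (a * b)" by (metis real_sqrt_abs real_sqrt_le_mono)
  then show ?thesis by (simp add: a_def b_def c_def real_sqrt_mult)
qed

text \<open>The definitions integrate against the completed measure, while translation invariance
  and Tonelli's theorem are applied on \<open>lborel\<close>. For Borel integrands and sets the two
  integrals agree.\<close>

lemma
  fixes f :: "'a::euclidean_space \<Rightarrow> 'b::{banach, second_countable_topology}"
  assumes "f \<in> borel_measurable borel" "A \<in> sets borel"
  shows integral_lebesgue_on_borel: "(LINT x|lebesgue_on A. f x) = (LINT x:A|lborel. f x)"
    and integrable_lebesgue_on_borel: "integrable (lebesgue_on A) f \<longleftrightarrow> set_integrable lborel A f"
proof -
  have [measurable]: "A \<in> sets lborel" "f \<in> borel_measurable lborel" using assms by auto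
  show "(LINT x|lebesgue_on A. f x) = (LINT x:A|lborel. f x)"
    unfolding set_lebesgue_integral_def
    by (subst integral_restrict_space) (auto intro: integral_completion simp: assms)
  show "integrable (lebesgue_on A) f \<longleftrightarrow> set_integrable lborel A f"
    unfolding set_integrable_def
    by (subst integrable_restrict_space) (simp_all add: assms integrable_completion)
qed

lemma
  fixes f :: "'a::euclidean_space \<Rightarrow> 'b::{banach, second_countable_topology}"
  assumes [measurable]: "f \<in> borel_measurable borel"
  shows lborel_integral_translate: "(LINT x|lborel. f (x + c)) = (LINT x|lborel. f x)"
    and lborel_integrable_translate: "integrable lborel (\<lambda>x. f (x + c)) \<longleftrightarrow> integrable lborel f"
proof -
  have "(LINT x|distr lborel borel ((+) c). f x) = (LINT x|lborel. f (c + x))"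
    by (rule integral_distr) auto
  then show "(LINT x|lborel. f (x + c)) = (LINT x|lborel. f x)"
    by (simp add: lborel_distr_plus add.commute)
  have "integrable (distr lborel borel ((+) c)) f \<longleftrightarrow> integrable lborel (\<lambda>x. f (c + x))"
    by (rule integrable_distr_eq) auto
  then show "integrable lborel (\<lambda>x. f (x + c)) \<longleftrightarrow> integrable lborel f"
    by (simp add: lborel_distr_plus add.commute)
qed

lemma continuous_compact_support_bound:
  fixes f g :: "'a::euclidean_space \<Rightarrow> real"
  assumes "continuous_on UNIV g" "compact K" "\<And>x. x \<notin> K \<Longrightarrow> g x = 0"
  obtains c where "\<And>x. \<bar>g x\<bar> \<le> c" "c \<ge> 0"
proof -
  have "bounded (g ` K)"
    using assms(1,2) by (intro compact_imp_bounded compact_continuous_image) (auto intro: continuous_on_subset)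
  then obtain c where "\<And>x. x \<in> K \<Longrightarrow> \<bar>g x\<bar> \<le> c" by (auto simp: bounded_iff)
  then have "\<bar>g x\<bar> \<le> \<bar>c\<bar>" for x using assms(3)[of x] by (cases "x \<in> K") force+
  then show thesis using that[of "\<bar>c\<bar>"] by auto
qed

lemma frechet_derivative_outside_support:
  fixes \<eta> :: "'a::euclidean_space \<Rightarrow> real"
  assumes "compact K" "\<And>x. x \<notin> K \<Longrightarrow> \<eta> x = 0" "x \<notin> K"
  shows "frechet_derivative \<eta> (at x) v = 0"
proof -
  have "open (- K)" using assms(1) by (simp add: compact_imp_closed open_Compl)
  then have "(\<eta> has_derivative (\<lambda>_. 0)) (at x)"
    by (rule has_derivative_transform_within_open[where f = "\<lambda>_. 0", OF has_derivative_const])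
      (use assms in auto)
  then have "frechet_derivative \<eta> (at x) = (\<lambda>_. 0)" by (metis frechet_derivative_at)
  then show ?thesis by simp
qed

lemma test_function_bounds:
  fixes \<eta> :: "'a::euclidean_space \<Rightarrow> real"
  assumes "test_function A \<eta>"
  obtains c where "\<And>x. \<bar>\<eta> x\<bar> \<le> c" "\<And>x. \<bar>frechet_derivative \<eta> (at x) v\<bar> \<le> c" "c \<ge> 0"
proof -
  obtain K where K: "compact K" "\<And>x. x \<notin> K \<Longrightarrow> \<eta> x = 0" and sm: "smooth_on UNIV \<eta>"
    using assms unfolding test_function_def by blast
  note D = frechet_derivative_outside_support[OF K]
  obtain c1 where c1: "\<And>x. \<bar>\<eta> x\<bar> \<le> c1" "c1 \<ge> 0"
    using continuous_compact_support_bound[OF smooth_on_UNIV_continuous[OF sm] K] by blast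
  obtain c2 where c2: "\<And>x. \<bar>frechet_derivative \<eta> (at x) v\<bar> \<le> c2" "c2 \<ge> 0"
    using continuous_compact_support_bound[OF smooth_on_UNIV_continuous_derivative[OF sm] K(1) D] by blast
  have "\<bar>\<eta> x\<bar> \<le> c1 + c2" "\<bar>frechet_derivative \<eta> (at x) v\<bar> \<le> c1 + c2" for x
    using c1(1)[of x] c1(2) c2(1)[of x] c2(2) by linarith+
  then show thesis using that[of "c1 + c2"] c1(2) c2(2) by auto
qed

lemma test_function_square_integrable_lborel:
  assumes "test_function A \<eta>" shows "integrable lborel (\<lambda>x. (\<eta> x)\<^sup>2)"
proof -
  obtain K where K: "compact K" "\<And>x. x \<notin> K \<Longrightarrow> \<eta> x = 0" and sm: "smooth_on UNIV \<eta>"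
    using assms unfolding test_function_def by blast
  have "integrable lborel (\<lambda>x. indicator K x *\<^sub>R (\<eta> x)\<^sup>2)"
    using smooth_on_UNIV_continuous[OF sm]
    by (intro borel_integrable_compact K(1) continuous_intros) (auto intro: continuous_on_subset)
  moreover have "(\<lambda>x. indicator K x *\<^sub>R (\<eta> x)\<^sup>2) = (\<lambda>x. (\<eta> x)\<^sup>2)"
    using K(2) by (auto split: split_indicator)
  ultimately show ?thesis by simp
qed

lemma smooth_on_line_has_derivative:
  fixes \<eta> :: "'a::euclidean_space \<Rightarrow> real"
  assumes "smooth_on UNIV \<eta>"
  shows "((\<lambda>s. \<eta> (x - s *\<^sub>R v)) has_real_derivative - frechet_derivative \<eta> (at (x - s *\<^sub>R v)) v) (at s)"
proof -
  have "((\<lambda>s. x - s *\<^sub>R v) has_derivative (\<lambda>h. - (h *\<^sub>R v))) (at s)"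
    by (auto intro!: derivative_eq_intros)
  from has_derivative_compose[OF this smooth_on_UNIV_has_derivative[OF assms]]
  have "((\<lambda>s. \<eta> (x - s *\<^sub>R v)) has_derivative (\<lambda>h. frechet_derivative \<eta> (at (x - s *\<^sub>R v)) (- (h *\<^sub>R v)))) (at s)"
    by simp
  moreover have "(\<lambda>h. frechet_derivative \<eta> (at (x - s *\<^sub>R v)) (- (h *\<^sub>R v))) = (*) (- frechet_derivative \<eta> (at (x - s *\<^sub>R v)) v)"
  proof
    fix h
    interpret linear "frechet_derivative \<eta> (at (x - s *\<^sub>R v))"
      using smooth_on_UNIV_has_derivative[OF assms] has_derivative_linear by blast
    show "frechet_derivative \<eta> (at (x - s *\<^sub>R v)) (- (h *\<^sub>R v)) = - frechet_derivative \<eta> (at (x - s *\<^sub>R v)) v * h"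
      by (simp add: neg scale)
  qed
  ultimately show ?thesis unfolding has_field_derivative_def by (simp only:)
qed

text \<open>q is merely integrable, so the shift has to act on the test function. The mean value
  bound keeps the difference quotients of \<eta> below c, and |q| c dominates.\<close>

lemma integral_shifted_test_function_has_derivative:
  fixes \<eta> q :: "'a::euclidean_space \<Rightarrow> real"
  assumes \<eta>: "test_function A \<eta>" and q: "integrable lborel q"
  shows "((\<lambda>s. LINT x|lborel. q x * \<eta> (x - s *\<^sub>R v)) has_real_derivative
     - (LINT x|lborel. q x * frechet_derivative \<eta> (at (x - s *\<^sub>R v)) v)) (at s)"
proof -
  have sm: "smooth_on UNIV \<eta>" using \<eta> by (simp add: test_function_def)
  obtain c where c: "\<And>x. \<bar>\<eta> x\<bar> \<le> c" "\<And>x. \<bar>frechet_derivative \<eta> (at x) v\<bar> \<le> c" "c \<ge> 0"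
    using test_function_bounds[OF \<eta>] by blast
  have qm [measurable]: "q \<in> borel_measurable borel" using borel_measurable_integrable[OF q] by simp
  have [measurable]: "(\<lambda>x. \<eta> (x - w)) \<in> borel_measurable borel" for w
    using smooth_on_UNIV_continuous[OF smooth_on_UNIV_translate[OF sm]] borel_measurable_continuous_onI by blast
  have "continuous_on UNIV (\<lambda>x. frechet_derivative \<eta> (at (x - w)) v)" for w
    using smooth_on_UNIV_continuous_derivative[OF sm]
    by (rule continuous_on_compose2[where f = "\<lambda>x. x - w"]) (auto intro!: continuous_intros)
  then have [measurable]: "(\<lambda>x. frechet_derivative \<eta> (at (x - w)) v) \<in> borel_measurable borel" for w
    using borel_measurable_continuous_onI by blast
  have i: "integrable lborel (\<lambda>x. q x * \<eta> (x - w))" for w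
  proof (rule Bochner_Integration.integrable_bound[where f = "\<lambda>x. c * q x"])
    show "AE x in lborel. norm (q x * \<eta> (x - w)) \<le> norm (c * q x)"
      using c by (intro AE_I2) (simp add: abs_mult mult.commute[of c] mult_left_mono)
  qed (use q in auto)
  have lip: "\<bar>\<eta> (x - (s + h) *\<^sub>R v) - \<eta> (x - s *\<^sub>R v)\<bar> \<le> c * \<bar>h\<bar>" for x h
  proof -
    have "norm (\<eta> (x - (s + h) *\<^sub>R v) - \<eta> (x - s *\<^sub>R v)) \<le> c * norm ((s + h) - s)"
      by (rule field_differentiable_bound[where S = UNIV, OF _ DERIV_subset[OF smooth_on_line_has_derivative[OF sm]]])
        (use c in auto)
    then show ?thesis by simp
  qed
  show ?thesis
    unfolding DERIV_def tendsto_at_iff_sequentially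
  proof (intro allI impI)
    fix X :: "nat \<Rightarrow> real" assume X: "\<forall>i. X i \<in> UNIV - {0}" "X \<longlonglongrightarrow> 0"
    have lim: "(\<lambda>n. LINT x|lborel. q x * ((\<eta> (x - (s + X n) *\<^sub>R v) - \<eta> (x - s *\<^sub>R v)) / X n))
      \<longlonglongrightarrow> (LINT x|lborel. q x * (- frechet_derivative \<eta> (at (x - s *\<^sub>R v)) v))"
    proof (rule integral_dominated_convergence[where w = "\<lambda>x. \<bar>q x\<bar> * c"])
      show "AE x in lborel. norm (q x * ((\<eta> (x - (s + X n) *\<^sub>R v) - \<eta> (x - s *\<^sub>R v)) / X n)) \<le> \<bar>q x\<bar> * c" for n
      proof (rule AE_I2)
        fix x
        have "\<bar>(\<eta> (x - (s + X n) *\<^sub>R v) - \<eta> (x - s *\<^sub>R v)) / X n\<bar> \<le> c"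
          using lip[of x "X n"] X(1) by (simp add: divide_simps)
        then show "norm (q x * ((\<eta> (x - (s + X n) *\<^sub>R v) - \<eta> (x - s *\<^sub>R v)) / X n)) \<le> \<bar>q x\<bar> * c"
          unfolding real_norm_def abs_mult by (intro mult_left_mono) auto
      qed
      show "AE x in lborel. (\<lambda>n. q x * ((\<eta> (x - (s + X n) *\<^sub>R v) - \<eta> (x - s *\<^sub>R v)) / X n))
          \<longlonglongrightarrow> q x * (- frechet_derivative \<eta> (at (x - s *\<^sub>R v)) v)"
      proof (intro AE_I2 tendsto_mult tendsto_const)
        fix x
        show "(\<lambda>n. (\<eta> (x - (s + X n) *\<^sub>R v) - \<eta> (x - s *\<^sub>R v)) / X n) \<longlonglongrightarrow> - frechet_derivative \<eta> (at (x - s *\<^sub>R v)) v"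
          using smooth_on_line_has_derivative[OF sm, of x v s] X
          unfolding DERIV_def tendsto_at_iff_sequentially by (auto simp: o_def)
      qed
      show "integrable lborel (\<lambda>x. \<bar>q x\<bar> * c)" using q by auto
    qed measurable
    have eq: "(LINT x|lborel. q x * ((\<eta> (x - (s + X n) *\<^sub>R v) - \<eta> (x - s *\<^sub>R v)) / X n))
      = ((LINT x|lborel. q x * \<eta> (x - (s + X n) *\<^sub>R v)) - (LINT x|lborel. q x * \<eta> (x - s *\<^sub>R v))) / X n" for n
    proof -
      have "(LINT x|lborel. q x * ((\<eta> (x - (s + X n) *\<^sub>R v) - \<eta> (x - s *\<^sub>R v)) / X n))
        = (LINT x|lborel. (q x * \<eta> (x - (s + X n) *\<^sub>R v) - q x * \<eta> (x - s *\<^sub>R v)) / X n)"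
        by (simp only: right_diff_distrib times_divide_eq_right)
      then show ?thesis by (simp only: integral_divide_zero Bochner_Integration.integral_diff[OF i i])
    qed
    from lim[unfolded eq] show "((\<lambda>h. ((LINT x|lborel. q x * \<eta> (x - (s + h) *\<^sub>R v)) - (LINT x|lborel. q x * \<eta> (x - s *\<^sub>R v))) / h) \<circ> X)
        \<longlonglongrightarrow> - (LINT x|lborel. q x * frechet_derivative \<eta> (at (x - s *\<^sub>R v)) v)"
      by (simp add: o_def)
  qed
qed

text \<open>Both functions are Borel measurable and square integrable on all of space, so that translations
  and Tonelli's theorem apply to them directly.\<close>

definition weak_grad_pair :: "(real^'n) set \<Rightarrow> (real^'n \<Rightarrow> real) \<Rightarrow> (real^'n \<Rightarrow> real^'n) \<Rightarrow> bool" where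
  "weak_grad_pair \<Omega> q G \<longleftrightarrow>
     q \<in> borel_measurable borel \<and> G \<in> borel_measurable borel \<and>
     integrable lborel q \<and> integrable lborel (\<lambda>x. (q x)\<^sup>2) \<and> integrable lborel (\<lambda>x. (norm (G x))\<^sup>2) \<and>
     (\<forall>\<phi>. test_function \<Omega> \<phi> \<longrightarrow> (\<forall>i. (LINT x|lborel. q x * frechet_derivative \<phi> (at x) (axis i 1)) =
             - (LINT x|lborel. G x $ i * \<phi> x)))"

lemma frechet_derivative_axis_sum:
  fixes \<phi> :: "real^'n \<Rightarrow> real"
  assumes "smooth_on UNIV \<phi>"
  shows "frechet_derivative \<phi> (at x) v = (\<Sum>i\<in>UNIV. v $ i * frechet_derivative \<phi> (at x) (axis i 1))"
proof -
  interpret linear "frechet_derivative \<phi> (at x)"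
    using smooth_on_UNIV_has_derivative[OF assms] has_derivative_linear by blast
  have "v = (\<Sum>i\<in>UNIV. v $ i *\<^sub>R axis i 1)"
    using basis_expansion[of v] by (simp add: scalar_mult_eq_scaleR)
  then have "frechet_derivative \<phi> (at x) v = frechet_derivative \<phi> (at x) (\<Sum>i\<in>UNIV. v $ i *\<^sub>R axis i 1)" by simp
  then show ?thesis by (simp only: sum scale real_scaleR_def)
qed

lemma frechet_derivative_translate:
  assumes "smooth_on UNIV \<eta>"
  shows "frechet_derivative (\<lambda>x. \<eta> (x - w)) (at x) = frechet_derivative \<eta> (at (x - w))"
proof -
  have "((\<lambda>x. x - w) has_derivative (\<lambda>h. h)) (at x)" by (auto intro!: derivative_eq_intros)
  from has_derivative_compose[OF this smooth_on_UNIV_has_derivative[OF assms]]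
  show ?thesis by (metis frechet_derivative_at)
qed

lemma integrable_mult_bounded:
  fixes q g :: "'a \<Rightarrow> real"
  assumes q: "integrable M q" and [measurable]: "g \<in> borel_measurable M" and c: "\<And>x. \<bar>g x\<bar> \<le> c"
  shows "integrable M (\<lambda>x. q x * g x)"
proof (rule Bochner_Integration.integrable_bound[where f = "\<lambda>x. c * q x"])
  show "AE x in M. norm (q x * g x) \<le> norm (c * q x)"
    using c order_trans[OF abs_ge_zero c] by (intro AE_I2) (simp add: abs_mult mult.commute[of c] mult_left_mono)
  show "(\<lambda>x. q x * g x) \<in> borel_measurable M" using borel_measurable_integrable[OF q] by measurable
qed (use q in auto)

text \<open>Translations run in an arbitrary direction, while the weak gradient is tested along the
  axes; the expansion of v in coordinates bridges the two.\<close>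

lemma weak_grad_pair_directional:
  fixes \<phi> :: "real^'n \<Rightarrow> real"
  assumes wg: "weak_grad_pair \<Omega> q G" and \<phi>: "test_function \<Omega> \<phi>"
  shows "(LINT x|lborel. q x * frechet_derivative \<phi> (at x) v) = - (LINT x|lborel. (G x \<bullet> v) * \<phi> x)"
proof -
  have sm: "smooth_on UNIV \<phi>" using \<phi> by (simp add: test_function_def)
  have G: "G \<in> borel_measurable borel" and q: "integrable lborel q" and G2: "integrable lborel (\<lambda>x. (norm (G x))\<^sup>2)"
    using wg by (auto simp: weak_grad_pair_def)
  note [measurable] = G
  have [measurable]: "(\<lambda>x. G x $ i) \<in> borel_measurable borel" for i
    unfolding cart_eq_inner_axis by measurable
  have phm [measurable]: "\<phi> \<in> borel_measurable borel"
    using smooth_on_UNIV_continuous[OF sm] borel_measurable_continuous_onI by blast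
  have i1: "integrable lborel (\<lambda>x. q x * frechet_derivative \<phi> (at x) w)" for w
  proof -
    obtain c where "\<And>x. \<bar>frechet_derivative \<phi> (at x) w\<bar> \<le> c" using test_function_bounds[OF \<phi>] by metis
    moreover have "(\<lambda>x. frechet_derivative \<phi> (at x) w) \<in> borel_measurable lborel"
      using smooth_on_UNIV_continuous_derivative[OF sm] borel_measurable_continuous_onI by auto
    ultimately show ?thesis using integrable_mult_bounded[OF q] by blast
  qed
  have i2: "integrable lborel (\<lambda>x. G x $ i * \<phi> x)" for i
  proof (rule integrable_mult_if_squares)
    show "integrable lborel (\<lambda>x. (G x $ i)\<^sup>2)"
      by (rule Bochner_Integration.integrable_bound[OF G2])
        (auto simp: power_mono component_le_norm_cart abs_le_square_iff[symmetric])
    show "integrable lborel (\<lambda>x. (\<phi> x)\<^sup>2)" by (rule test_function_square_integrable_lborel[OF \<phi>])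
  qed (use G in measurable)
  have "(LINT x|lborel. q x * frechet_derivative \<phi> (at x) v)
      = (LINT x|lborel. (\<Sum>i\<in>UNIV. v $ i * (q x * frechet_derivative \<phi> (at x) (axis i 1))))"
    by (simp add: frechet_derivative_axis_sum[OF sm, of _ v] sum_distrib_left mult.left_commute)
  also have "\<dots> = (\<Sum>i\<in>UNIV. v $ i * (LINT x|lborel. q x * frechet_derivative \<phi> (at x) (axis i 1)))"
    using i1 by (simp add: Bochner_Integration.integral_sum)
  also have "\<dots> = - (\<Sum>i\<in>UNIV. v $ i * (LINT x|lborel. G x $ i * \<phi> x))"
    using wg \<phi> by (simp add: weak_grad_pair_def sum_negf)
  also have "(\<Sum>i\<in>UNIV. v $ i * (LINT x|lborel. G x $ i * \<phi> x)) = (LINT x|lborel. (\<Sum>i\<in>UNIV. v $ i * (G x $ i * \<phi> x)))"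
    using i2 by (simp add: Bochner_Integration.integral_sum)
  also have "\<dots> = (LINT x|lborel. (G x \<bullet> v) * \<phi> x)"
    by (simp add: inner_vec_def sum_distrib_right sum_distrib_left mult_ac)
  finally show ?thesis .
qed

text \<open>For a test function \<open>\<eta>\<close> on \<open>A\<close> the map \<open>s \<mapsto> \<integral> q(x) \<eta>(x - s v) dx\<close> has derivative
  \<open>\<integral> (G \<bullet> v)(x) \<eta>(x - s v) dx\<close>, so that no regularization of \<open>q\<close> is needed.\<close>

lemma weak_grad_pair_translation:
  fixes v :: "real^'n"
  assumes wg: "weak_grad_pair \<Omega> q G"
    and A: "open A" "bounded A" and W: "open W" "W \<subseteq> \<Omega>"
    and AW: "\<And>x s. x \<in> A \<Longrightarrow> 0 \<le> s \<Longrightarrow> s \<le> 1 \<Longrightarrow> x + s *\<^sub>R v \<in> W"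
  shows "(LINT x:A|lborel. (q (x + v) - q x)\<^sup>2) \<le> (norm v)\<^sup>2 * (LINT x:W|lborel. (norm (G x))\<^sup>2)"
proof -
  have q: "q \<in> borel_measurable borel" "integrable lborel q" "integrable lborel (\<lambda>x. (q x)\<^sup>2)"
    and G: "G \<in> borel_measurable borel" "integrable lborel (\<lambda>x. (norm (G x))\<^sup>2)"
    using wg by (auto simp: weak_grad_pair_def)
  note [measurable] = q(1) G(1)
  have [measurable]: "A \<in> sets borel" "W \<in> sets borel" using A W by auto
  define E where "E = (LINT x:W|lborel. (norm (G x))\<^sup>2)"
  have E0: "E \<ge> 0" unfolding E_def set_lebesgue_integral_def by (rule integral_nonneg_AE) simp
  define f where "f x = q (x + v) - q x" for x
  have fm [measurable]: "f \<in> borel_measurable borel" unfolding f_def by measurable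
  have qv: "integrable lborel (\<lambda>x. q (x + v))" "integrable lborel (\<lambda>x. (q (x + v))\<^sup>2)"
    using lborel_integrable_translate[of q v] lborel_integrable_translate[of "\<lambda>x. (q x)\<^sup>2" v] q by auto
  have f2: "integrable lborel (\<lambda>x. (f x)\<^sup>2)"
    unfolding f_def by (rule integrable_diff_square) (use q qv in simp_all)
  \<comment> \<open>Duality with B = norm v * sqrt E: only integrals against test functions occur,
    and there the shift can be moved from q to the test function.\<close>
  have "(LINT x|lebesgue_on A. (f x)\<^sup>2) \<le> (norm v * sqrt E)\<^sup>2"
  proof (rule square_integral_le_if_test_functions[OF A])
    show "f \<in> borel_measurable (lebesgue_on A)"
      by (intro measurable_restrict_space1 measurable_completion) simp
    show "integrable (lebesgue_on A) (\<lambda>x. (f x)\<^sup>2)"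
      by (subst integrable_lebesgue_on_borel) (use integrable_mult_indicator[OF _ f2, of A] in \<open>auto simp: set_integrable_def\<close>)
    fix \<eta> assume \<eta>: "test_function A \<eta>"
    then obtain K where K: "compact K" "K \<subseteq> A" "\<And>x. x \<notin> K \<Longrightarrow> \<eta> x = 0" and sm: "smooth_on UNIV \<eta>"
      unfolding test_function_def by blast
    have em: "(\<lambda>x. \<eta> (x - w)) \<in> borel_measurable borel" for w
      using smooth_on_UNIV_continuous[OF smooth_on_UNIV_translate[OF sm]] borel_measurable_continuous_onI by blast
    have [measurable]: "\<eta> \<in> borel_measurable borel" using em[of 0] by simp
    note [measurable] = em
    obtain c where c: "\<And>x. \<bar>\<eta> x\<bar> \<le> c" "c \<ge> 0" using test_function_bounds[OF \<eta>] by metis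
    note e2 = test_function_square_integrable_lborel[OF \<eta>]
    define N where "N = (LINT x|lborel. (\<eta> x)\<^sup>2)"
    have N: "(LINT x|lborel. (\<eta> (x - w))\<^sup>2) = N" "integrable lborel (\<lambda>x. (\<eta> (x - w))\<^sup>2)" for w
      using lborel_integral_translate[of "\<lambda>x. (\<eta> x)\<^sup>2" "-w"] lborel_integrable_translate[of "\<lambda>x. (\<eta> x)\<^sup>2" "-w"] e2
      by (auto simp: N_def)
    define F where "F s = (LINT x|lborel. q x * \<eta> (x - s *\<^sub>R v))" for s
    define F' where "F' s = - (LINT x|lborel. q x * frechet_derivative \<eta> (at (x - s *\<^sub>R v)) v)" for s
    have "\<And>s. (F has_real_derivative F' s) (at s)"
      unfolding F_def F'_def by (rule integral_shifted_test_function_has_derivative[OF \<eta> q(2)])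
    then obtain s where s: "0 < s" "s < 1" "F 1 - F 0 = F' s"
      using MVT2[of 0 1 F F'] by auto
    \<comment> \<open>The mean value theorem freezes one shifted test function. Its support lies on
      the segments, hence in W; it is therefore admissible for the weak gradient and sees G only on
      W, which makes the energy on the right local.\<close>
    define \<phi> where "\<phi> x = \<eta> (x - s *\<^sub>R v)" for x
    have supp: "\<phi> x = 0" if "x \<notin> W" for x
    proof -
      have "x - s *\<^sub>R v \<notin> K" using AW[of "x - s *\<^sub>R v" s] K(2) s that by auto
      then show ?thesis using K(3) \<phi>_def by auto
    qed
    have \<phi>: "test_function \<Omega> \<phi>"
      unfolding test_function_def
    proof (intro conjI exI)
      show "smooth_on UNIV \<phi>" unfolding \<phi>_def by (rule smooth_on_UNIV_translate[OF sm])
      show "compact ((+) (s *\<^sub>R v) ` K)" using K(1) by (rule compact_translation)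
      show "(+) (s *\<^sub>R v) ` K \<subseteq> \<Omega>" using AW[of _ s] K(2) s W(2) by (force simp: add.commute)
      show "\<forall>x. x \<notin> (+) (s *\<^sub>R v) ` K \<longrightarrow> \<phi> x = 0"
      proof (intro allI impI)
        fix x assume "x \<notin> (+) (s *\<^sub>R v) ` K"
        then have "x - s *\<^sub>R v \<notin> K" by (metis add.commute diff_add_cancel image_eqI)
        then show "\<phi> x = 0" using K(3) \<phi>_def by auto
      qed
    qed
    have "F' s = (LINT x|lborel. (G x \<bullet> v) * \<phi> x)"
      using weak_grad_pair_directional[OF wg \<phi>, of v]
      unfolding F'_def \<phi>_def by (simp add: frechet_derivative_translate[OF sm])
    also have "\<dots> = (LINT x|lborel. (indicator W x * (G x \<bullet> v)) * \<phi> x)"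
      by (intro Bochner_Integration.integral_cong) (auto simp: supp split: split_indicator)
    finally have F's: "F' s = \<dots>" .
    have Gv: "(indicator W x * (G x \<bullet> v))\<^sup>2 \<le> (norm v)\<^sup>2 * (indicator W x * (norm (G x))\<^sup>2)" for x
    proof -
      have "\<bar>G x \<bullet> v\<bar>\<^sup>2 \<le> (norm (G x) * norm v)\<^sup>2" by (intro power_mono Cauchy_Schwarz_ineq2) auto
      then show ?thesis by (auto simp: power_mult_distrib mult.commute split: split_indicator)
    qed
    have GW: "integrable lborel (\<lambda>x. indicator W x * (norm (G x))\<^sup>2)"
      using integrable_mult_indicator[OF _ G(2), of W] by simp
    have iGv: "integrable lborel (\<lambda>x. (indicator W x * (G x \<bullet> v))\<^sup>2)"
      by (rule Bochner_Integration.integrable_bound[where f = "\<lambda>x. (norm v)\<^sup>2 * (indicator W x * (norm (G x))\<^sup>2)"])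
        (use GW Gv in \<open>auto simp: abs_mult\<close>)
    have "\<bar>F' s\<bar> \<le> sqrt (LINT x|lborel. (indicator W x * (G x \<bullet> v))\<^sup>2) * sqrt (LINT x|lborel. (\<phi> x)\<^sup>2)"
      unfolding F's by (rule integral_cauchy_schwarz[OF _ _ iGv]) (use N in \<open>auto simp: \<phi>_def\<close>)
    also have "(LINT x|lborel. (\<phi> x)\<^sup>2) = N" using N by (simp add: \<phi>_def)
    also have "(LINT x|lborel. (indicator W x * (G x \<bullet> v))\<^sup>2) \<le> (LINT x|lborel. (norm v)\<^sup>2 * (indicator W x * (norm (G x))\<^sup>2))"
      by (intro integral_mono iGv Gv) (use GW in auto)
    also have "\<dots> = (norm v)\<^sup>2 * E" unfolding E_def set_lebesgue_integral_def by simp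
    finally have F'le: "\<bar>F' s\<bar> \<le> norm v * sqrt E * sqrt N"
      by (simp add: real_sqrt_mult mult_right_mono N_def)
    have i0: "integrable lborel (\<lambda>x. q x * \<eta> (x - w))" for w
      by (rule integrable_mult_bounded[OF q(2)]) (use c in auto)
    have i1: "integrable lborel (\<lambda>x. q (x + v) * \<eta> x)"
      by (rule integrable_mult_bounded[OF qv(1)]) (use c in auto)
    have "(LINT x|lebesgue_on A. f x * \<eta> x) = (LINT x:A|lborel. f x * \<eta> x)"
      by (rule integral_lebesgue_on_borel) auto
    also have "\<dots> = (LINT x|lborel. q (x + v) * \<eta> x - q x * \<eta> (x - 0))"
      unfolding set_lebesgue_integral_def
      by (intro Bochner_Integration.integral_cong) (use K in \<open>auto simp: f_def algebra_simps split: split_indicator\<close>)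
    also have "\<dots> = (LINT x|lborel. q (x + v) * \<eta> x) - (LINT x|lborel. q x * \<eta> (x - 0))"
      by (rule Bochner_Integration.integral_diff[OF i1 i0])
    also have "(LINT x|lborel. q (x + v) * \<eta> x) = (LINT x|lborel. q x * \<eta> (x - v))"
      using lborel_integral_translate[of "\<lambda>x. q x * \<eta> (x - v)" v] by simp
    also have "\<dots> - (LINT x|lborel. q x * \<eta> (x - 0)) = F 1 - F 0" by (simp add: F_def)
    also have "\<dots> \<le> norm v * sqrt E * sqrt N" using s(3) F'le by simp
    also have "N = (LINT x|lebesgue_on A. (\<eta> x)\<^sup>2)"
    proof -
      have "(LINT x|lebesgue_on A. (\<eta> x)\<^sup>2) = (LINT x:A|lborel. (\<eta> x)\<^sup>2)"
        by (rule integral_lebesgue_on_borel) auto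
      also have "\<dots> = N" unfolding N_def set_lebesgue_integral_def
        by (intro Bochner_Integration.integral_cong) (use K in \<open>auto split: split_indicator\<close>)
      finally show ?thesis ..
    qed
    finally show "(LINT x|lebesgue_on A. f x * \<eta> x) \<le> norm v * sqrt E * sqrt (LINT x|lebesgue_on A. (\<eta> x)\<^sup>2)" .
  qed
  also have "(LINT x|lebesgue_on A. (f x)\<^sup>2) = (LINT x:A|lborel. (f x)\<^sup>2)"
    by (rule integral_lebesgue_on_borel) auto
  finally show ?thesis using E0 by (simp add: f_def E_def power_mult_distrib)
qed

section \<open>Poincare inequalities on balls and on shifted sets\<close>

lemma set_integrable_bounded_const:
  fixes c :: real
  assumes "bounded A" "A \<in> sets borel" shows "set_integrable lborel A (\<lambda>_. c)"
  using emeasure_bounded_finite[OF assms(1)] assms(2)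
  unfolding set_integrable_def by (simp add: integrable_real_indicator)

lemma nn_integral_lborel_translate:
  fixes f :: "'a::euclidean_space \<Rightarrow> ennreal"
  assumes [measurable]: "f \<in> borel_measurable borel"
  shows "(\<integral>\<^sup>+x. f (x + c) \<partial>lborel) = (\<integral>\<^sup>+x. f x \<partial>lborel)"
proof -
  have "(\<integral>\<^sup>+x. f x \<partial>distr lborel borel ((+) c)) = (\<integral>\<^sup>+x. f (c + x) \<partial>lborel)"
    by (rule nn_integral_distr) auto
  then show ?thesis by (simp add: lborel_distr_plus add.commute)
qed

definition set_avg :: "'a::euclidean_space set \<Rightarrow> ('a \<Rightarrow> real) \<Rightarrow> real" where
  "set_avg B q = (LINT x:B|lborel. q x) / measure lborel B"

text \<open>The variance of \<open>q\<close> over the ball is \<open>1 / (2|B|)\<close> times the double integral of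
  \<open>(q x - q y)\<^sup>2\<close>; the substitution \<open>y = x + v\<close> reduces it to the translation estimate.\<close>

lemma poincare_ball:
  fixes c :: "real^'n"
  assumes wg: "weak_grad_pair \<Omega> q G" and B: "ball c r \<subseteq> \<Omega>" and r: "r > 0"
  shows "(LINT x:ball c r|lborel. (q x - set_avg (ball c r) q)\<^sup>2)
     \<le> 2 ^ (CARD('n) + 1) * r\<^sup>2 * (LINT x:ball c r|lborel. (norm (G x))\<^sup>2)"
proof -
  have q: "q \<in> borel_measurable borel" "integrable lborel q" "integrable lborel (\<lambda>x. (q x)\<^sup>2)"
    and G: "G \<in> borel_measurable borel" "integrable lborel (\<lambda>x. (norm (G x))\<^sup>2)"
    using wg by (auto simp: weak_grad_pair_def)
  note [measurable] = q(1) G(1)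
  let ?B = "ball c r"
  have [measurable]: "?B \<in> sets borel" by simp
  define E where "E = (LINT x:?B|lborel. (norm (G x))\<^sup>2)"
  have E0: "E \<ge> 0" unfolding E_def set_lebesgue_integral_def by (rule integral_nonneg_AE) simp
  define V where "V = measure lborel ?B"
  define I1 where "I1 = (LINT x:?B|lborel. q x)"
  define I2 where "I2 = (LINT x:?B|lborel. (q x)\<^sup>2)"
  have V: "V = unit_ball_vol (CARD('n)) * r ^ CARD('n)"
    unfolding V_def using content_ball[of r c] r by simp
  then have Vpos: "V > 0" using r by (simp add: unit_ball_vol_pos)
  have s1: "set_integrable lborel ?B q" "set_integrable lborel ?B (\<lambda>x. (q x)\<^sup>2)"
    unfolding set_integrable_def using q by (intro integrable_mult_indicator; simp)+
  have sc: "set_integrable lborel ?B (\<lambda>x. k)" for k :: real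
    by (rule set_integrable_bounded_const) auto
  have cV: "(LINT x:?B|lborel. k) = k * V" for k
    unfolding V_def set_lebesgue_integral_def using emeasure_bounded_finite[of ?B] by simp
  have inner_int: "set_integrable lborel ?B (\<lambda>y. (q y - k)\<^sup>2)"
    and inner_eq: "(LINT y:?B|lborel. (q y - k)\<^sup>2) = I2 - 2 * k * I1 + k\<^sup>2 * V" for k
  proof -
    have eq: "(\<lambda>y. (q y - k)\<^sup>2) = (\<lambda>y. (q y)\<^sup>2 - 2 * k * q y + k\<^sup>2)"
      by (auto simp: power2_diff algebra_simps)
    show "set_integrable lborel ?B (\<lambda>y. (q y - k)\<^sup>2)"
      unfolding eq by (intro set_integral_add set_integral_diff set_integrable_mult_right s1 sc)
    show "(LINT y:?B|lborel. (q y - k)\<^sup>2) = I2 - 2 * k * I1 + k\<^sup>2 * V"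
      unfolding eq using s1 sc
      by (simp add: set_integral_add set_integral_diff set_integrable_mult_right cV I1_def I2_def)
  qed
  define h where "h x y = (indicator ?B x * indicator ?B y * (q y - q x)\<^sup>2 :: real)" for x y
  have [measurable]: "(\<lambda>x. h x y) \<in> borel_measurable borel" "(\<lambda>y. h x y) \<in> borel_measurable borel" for x y
    unfolding h_def by measurable
  have h0: "h x y \<ge> 0" for x y unfolding h_def by simp
  \<comment> \<open>The double integral is formed in the extended nonnegative reals, where the order
    of integration can be exchanged without prior integrability.\<close>
  define X where "X = (\<integral>\<^sup>+x. \<integral>\<^sup>+y. ennreal (h x y) \<partial>lborel \<partial>lborel)"
  have inner_nn: "(\<integral>\<^sup>+y. ennreal (h x y) \<partial>lborel) = ennreal (indicator ?B x * (I2 - 2 * q x * I1 + (q x)\<^sup>2 * V))" for x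
  proof -
    have 1: "h x y = indicator ?B x * (indicator ?B y *\<^sub>R (q y - q x)\<^sup>2)" for y by (simp add: h_def)
    have "integrable lborel (h x)" unfolding 1
      using inner_int[of "q x"] unfolding set_integrable_def by (rule integrable_mult_right)
    then have "(\<integral>\<^sup>+y. ennreal (h x y) \<partial>lborel) = ennreal (LINT y|lborel. h x y)"
      by (intro nn_integral_eq_integral) (auto simp: h0)
    also have "(LINT y|lborel. h x y) = indicator ?B x * (LINT y:?B|lborel. (q y - q x)\<^sup>2)"
      unfolding 1 set_lebesgue_integral_def by simp
    finally show ?thesis using inner_eq by simp
  qed
  have "X = ennreal (2 * V * I2 - 2 * I1\<^sup>2)"
  proof -
    have 1: "indicator ?B x * (I2 - 2 * q x * I1 + (q x)\<^sup>2 * V)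
      = indicator ?B x *\<^sub>R (I2 - 2 * I1 * q x + V * (q x)\<^sup>2)" for x by (simp add: algebra_simps)
    have i: "set_integrable lborel ?B (\<lambda>x. I2 - 2 * I1 * q x + V * (q x)\<^sup>2)"
      by (intro set_integral_add set_integral_diff set_integrable_mult_right s1 sc)
    have "X = ennreal (LINT x|lborel. indicator ?B x *\<^sub>R (I2 - 2 * I1 * q x + V * (q x)\<^sup>2))"
      unfolding X_def inner_nn unfolding 1
    proof (rule nn_integral_eq_integral)
      show "AE x in lborel. 0 \<le> indicat_real ?B x *\<^sub>R (I2 - 2 * I1 * q x + V * (q x)\<^sup>2)"
      proof (rule AE_I2)
        fix x
        have "0 \<le> (LINT y:?B|lborel. (q y - q x)\<^sup>2)"
          unfolding set_lebesgue_integral_def by (rule integral_nonneg_AE) simp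
        then show "0 \<le> indicat_real ?B x *\<^sub>R (I2 - 2 * I1 * q x + V * (q x)\<^sup>2)"
          unfolding inner_eq by (simp add: algebra_simps split: split_indicator)
      qed
    qed (use i in \<open>simp add: set_integrable_def\<close>)
    also have "(LINT x|lborel. indicator ?B x *\<^sub>R (I2 - 2 * I1 * q x + V * (q x)\<^sup>2)) = 
        (LINT x:?B|lborel. I2 - 2 * I1 * q x + V * (q x)\<^sup>2)" by (simp add: set_lebesgue_integral_def)
    also have "\<dots> = I2 * V - 2 * I1 * I1 + V * I2" using s1 sc
      by (simp add: set_integral_add set_integral_diff set_integrable_mult_right cV I1_def I2_def)
    finally show ?thesis by (simp add: power2_eq_square algebra_simps)
  qed
  moreover have "X \<le> ennreal (4 * r\<^sup>2 * E * (2 ^ CARD('n) * V))"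
  proof -
    have [measurable]: "(\<lambda>(x, v). h x (x + v)) \<in> borel_measurable (borel \<Otimes>\<^sub>M borel)"
      unfolding h_def by measurable
    have "X = (\<integral>\<^sup>+x. \<integral>\<^sup>+v. ennreal (h x (v + x)) \<partial>lborel \<partial>lborel)"
      unfolding X_def by (intro nn_integral_cong nn_integral_lborel_translate[symmetric]) measurable
    also have "\<dots> = (\<integral>\<^sup>+x. \<integral>\<^sup>+v. ennreal (h x (x + v)) \<partial>lborel \<partial>lborel)" by (simp add: add.commute)
    also have "\<dots> = (\<integral>\<^sup>+v. \<integral>\<^sup>+x. ennreal (h x (x + v)) \<partial>lborel \<partial>lborel)"
      by (rule lborel_pair.Fubini'[symmetric]) simp
    \<comment> \<open>Two points of the ball differ by less than 2 r, so only shifts in a ball of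
      volume 2^n V contribute, each at most 4 r^2 E because segments between points of a ball stay
      in it. Division by 2 V then gives the constant 2^(n+1) r^2.\<close>
    also have "\<dots> \<le> (\<integral>\<^sup>+v. ennreal (4 * r\<^sup>2 * E) * indicator (cball (0 :: real^'n) (2 * r)) v \<partial>lborel)"
    proof (rule nn_integral_mono)
      fix v :: "real^'n"
      show "(\<integral>\<^sup>+x. ennreal (h x (x + v)) \<partial>lborel) \<le> ennreal (4 * r\<^sup>2 * E) * indicator (cball (0 :: real^'n) (2 * r)) v"
      proof (cases "v \<in> cball 0 (2 * r)")
        case True
        define A where "A = ?B \<inter> {x. x + v \<in> ?B}"
        have oA: "open A"
        proof -
          have "{x. x + v \<in> ?B} = (\<lambda>x. x + v) -` ?B" by auto
          then show ?thesis unfolding A_def by (auto intro!: open_Int open_vimage continuous_intros)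
        qed
        have bA: "bounded A" unfolding A_def by (meson bounded_ball bounded_subset inf_le1)
        have seg: "x + s *\<^sub>R v \<in> ?B" if "x \<in> A" "0 \<le> s" "s \<le> 1" for x s
        proof -
          have "x + s *\<^sub>R v = (1 - s) *\<^sub>R x + s *\<^sub>R (x + v)" by (simp add: algebra_simps)
          moreover have "x \<in> ?B" "x + v \<in> ?B" using that by (auto simp: A_def)
          ultimately show ?thesis using that convexD[OF convex_ball, of x c r "x + v" "1 - s" s] by auto
        qed
        have hA: "h x (x + v) = indicator A x *\<^sub>R (q (x + v) - q x)\<^sup>2" for x
          by (auto simp: h_def A_def split: split_indicator)
        have "integrable lborel (\<lambda>x. (q (x + v) - q x)\<^sup>2)"
          using lborel_integrable_translate[of "\<lambda>x. (q x)\<^sup>2" v] q by (intro integrable_diff_square) auto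
        then have iA: "integrable lborel (\<lambda>x. h x (x + v))"
          unfolding hA using oA by (intro integrable_mult_indicator) auto
        have "(\<integral>\<^sup>+x. ennreal (h x (x + v)) \<partial>lborel) = ennreal (LINT x|lborel. h x (x + v))"
          by (rule nn_integral_eq_integral[OF iA]) (simp add: h0)
        also have "(LINT x|lborel. h x (x + v)) = (LINT x:A|lborel. (q (x + v) - q x)\<^sup>2)"
          unfolding hA set_lebesgue_integral_def by simp
        also have "\<dots> \<le> (norm v)\<^sup>2 * E"
          unfolding E_def by (rule weak_grad_pair_translation[OF wg oA bA open_ball B seg])
        also have "\<dots> \<le> 4 * r\<^sup>2 * E"
        proof (intro mult_right_mono E0)
          have "(norm v)\<^sup>2 \<le> (2 * r)\<^sup>2" using True by (intro power_mono) auto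
          then show "(norm v)\<^sup>2 \<le> 4 * r\<^sup>2" by (simp add: power_mult_distrib)
        qed
        finally show ?thesis using True by (simp add: ennreal_leI)
      next
        case False
        have "h x (x + v) = 0" for x
        proof -
          have "\<not> (x \<in> ?B \<and> x + v \<in> ?B)"
          proof
            assume "x \<in> ?B \<and> x + v \<in> ?B"
            then have "dist x (x + v) < r + r" by (metis dist_commute dist_triangle_lt mem_ball add_strict_mono dist_triangle2 order_le_less_trans)
            then show False using False by (simp add: dist_norm)
          qed
          then show ?thesis by (auto simp: h_def)
        qed
        then show ?thesis by simp
      qed
    qed
    also have "\<dots> = ennreal (4 * r\<^sup>2 * E) * emeasure lborel (cball 0 (2 * r) :: (real^'n) set)"
      by (simp add: nn_integral_cmult_indicator)
    also have "emeasure lborel (cball 0 (2 * r) :: (real^'n) set) = ennreal (2 ^ CARD('n) * V)"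
      using r by (simp add: emeasure_cball V power_mult_distrib mult_ac)
    finally show ?thesis using E0 Vpos by (simp add: ennreal_mult[symmetric])
  qed
  ultimately have le: "2 * V * I2 - 2 * I1\<^sup>2 \<le> 4 * r\<^sup>2 * E * (2 ^ CARD('n) * V)"
    using E0 Vpos by (simp add: ennreal_le_iff)
  have "(LINT x:?B|lborel. (q x - set_avg ?B q)\<^sup>2) = I2 - 2 * (I1 / V) * I1 + (I1 / V)\<^sup>2 * V"
    unfolding inner_eq set_avg_def I1_def V_def ..
  also have "\<dots> = (2 * V * I2 - 2 * I1\<^sup>2) / (2 * V)"
    using Vpos by (simp add: power2_eq_square field_simps)
  also have "\<dots> \<le> 4 * r\<^sup>2 * E * (2 ^ CARD('n) * V) / (2 * V)"
    using le Vpos by (intro divide_right_mono) auto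
  also have "\<dots> = 2 ^ (CARD('n) + 1) * r\<^sup>2 * E" using Vpos by simp
  finally show ?thesis by (simp add: E_def)
qed

text \<open>The ball may be disjoint from K. The value at x is compared with that at x - w by the
  translation estimate, and the latter with the mean over the ball by the Poincare inequality there;
  (a + b)^2 \<le> 2 a^2 + 2 b^2 doubles both constants. The two energies are enlarged to the common
  region N.\<close>

lemma poincare_shifted_ball:
  fixes w :: "real^'n"
  assumes wg: "weak_grad_pair \<Omega> q G" and K: "open K" "bounded K"
    and N: "open N" "N \<subseteq> \<Omega>" and B: "ball c r \<subseteq> N" "r > 0"
    and seg: "\<And>x s. x \<in> K \<Longrightarrow> 0 \<le> s \<Longrightarrow> s \<le> 1 \<Longrightarrow> x - s *\<^sub>R w \<in> N"
    and KB: "\<And>x. x \<in> K \<Longrightarrow> x - w \<in> ball c r"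
  shows "(LINT x:K|lborel. (q x - set_avg (ball c r) q)\<^sup>2)
     \<le> (2 * (norm w)\<^sup>2 + 2 ^ (CARD('n) + 2) * r\<^sup>2) * (LINT x:N|lborel. (norm (G x))\<^sup>2)"
proof -
  have q: "q \<in> borel_measurable borel" "integrable lborel q" "integrable lborel (\<lambda>x. (q x)\<^sup>2)"
    and G: "G \<in> borel_measurable borel" "integrable lborel (\<lambda>x. (norm (G x))\<^sup>2)"
    using wg by (auto simp: weak_grad_pair_def)
  note [measurable] = q(1) G(1)
  let ?B = "ball c r"
  have [measurable]: "K \<in> sets borel" "N \<in> sets borel" "?B \<in> sets borel" using K N by auto
  define m where "m = set_avg ?B q"
  define E where "E S = (LINT x:S|lborel. (norm (G x))\<^sup>2)" for S
  have iB: "integrable lborel (\<lambda>x. indicator ?B x * (q x - m)\<^sup>2)"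
  proof -
    have "(\<lambda>x. (m * indicator ?B x)\<^sup>2) = (\<lambda>x. m\<^sup>2 * indicator ?B x)"
      by (auto split: split_indicator)
    moreover have "integrable lborel (\<lambda>x. m\<^sup>2 * indicator ?B x)"
      using emeasure_bounded_finite[of ?B] by (intro integrable_mult_right integrable_real_indicator) auto
    ultimately have "integrable lborel (\<lambda>x. (q x - m * indicator ?B x)\<^sup>2)"
      using q by (intro integrable_diff_square) auto
    then have "integrable lborel (\<lambda>x. indicator ?B x *\<^sub>R (q x - m * indicator ?B x)\<^sup>2)"
      by (intro integrable_mult_indicator) auto
    moreover have "indicator ?B x *\<^sub>R (q x - m * indicator ?B x)\<^sup>2 = indicator ?B x * (q x - m)\<^sup>2" for x
      by (auto split: split_indicator)
    ultimately show ?thesis by (simp only:)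
  qed
  have qw: "integrable lborel (\<lambda>x. (q (x + - w))\<^sup>2)"
    using lborel_integrable_translate[of "\<lambda>x. (q x)\<^sup>2" "-w"] q by auto
  have "integrable lborel (\<lambda>x. (q (x + - w) - q x)\<^sup>2)"
    by (rule integrable_diff_square) (use q qw in simp_all)
  then have i1: "integrable lborel (\<lambda>x. indicator K x * (q (x + - w) - q x)\<^sup>2)"
    using integrable_mult_indicator[of K lborel "\<lambda>x. (q (x + - w) - q x)\<^sup>2"] by simp
  have i2: "integrable lborel (\<lambda>x. indicator ?B (x + - w) * (q (x + - w) - m)\<^sup>2)"
    using iB lborel_integrable_translate[of "\<lambda>x. indicator ?B x * (q x - m)\<^sup>2" "-w"] by simp
  have pt: "indicator K x * (q x - m)\<^sup>2 \<le> 2 * (indicator K x * (q (x + - w) - q x)\<^sup>2)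
      + 2 * (indicator ?B (x + - w) * (q (x + - w) - m)\<^sup>2)" for x
  proof -
    have "(q x - m)\<^sup>2 \<le> 2 * (q (x + - w) - q x)\<^sup>2 + 2 * (q (x + - w) - m)\<^sup>2"
    proof -
      have "0 \<le> ((q (x + - w) - q x) + (q (x + - w) - m))\<^sup>2" by simp
      then show ?thesis by (simp add: power2_eq_square algebra_simps)
    qed
    then show ?thesis using KB[of x] by (auto split: split_indicator)
  qed
  have iK: "integrable lborel (\<lambda>x. indicator K x * (q x - m)\<^sup>2)"
  proof (rule Bochner_Integration.integrable_bound)
    show "integrable lborel (\<lambda>x. 2 * (indicator K x * (q (x + - w) - q x)\<^sup>2)
      + 2 * (indicator ?B (x + - w) * (q (x + - w) - m)\<^sup>2))"
      by (intro Bochner_Integration.integrable_add integrable_mult_right i1 i2)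
    show "AE x in lborel. norm (indicator K x * (q x - m)\<^sup>2) \<le> norm (2 * (indicator K x * (q (x + - w) - q x)\<^sup>2)
      + 2 * (indicator ?B (x + - w) * (q (x + - w) - m)\<^sup>2))"
    proof (rule AE_I2)
      fix x
      have "norm (indicator K x * (q x - m)\<^sup>2) = indicator K x * (q x - m)\<^sup>2" by (simp add: abs_mult)
      also note pt[of x]
      finally show "norm (indicator K x * (q x - m)\<^sup>2) \<le> norm (2 * (indicator K x * (q (x + - w) - q x)\<^sup>2)
        + 2 * (indicator ?B (x + - w) * (q (x + - w) - m)\<^sup>2))"
        unfolding real_norm_def by (rule order_trans[OF _ abs_ge_self])
    qed
  qed simp
  have "(LINT x:K|lborel. (q x - m)\<^sup>2) = (LINT x|lborel. indicator K x * (q x - m)\<^sup>2)"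
    by (simp add: set_lebesgue_integral_def)
  also have "\<dots> \<le> (LINT x|lborel. 2 * (indicator K x * (q (x + - w) - q x)\<^sup>2)
      + 2 * (indicator ?B (x + - w) * (q (x + - w) - m)\<^sup>2))"
    by (rule integral_mono[OF iK _ pt]) (intro Bochner_Integration.integrable_add integrable_mult_right i1 i2)
  also have "\<dots> = 2 * (LINT x|lborel. indicator K x * (q (x + - w) - q x)\<^sup>2)
      + 2 * (LINT x|lborel. indicator ?B (x + - w) * (q (x + - w) - m)\<^sup>2)"
    using i1 i2 by simp
  also have "(LINT x|lborel. indicator ?B (x + - w) * (q (x + - w) - m)\<^sup>2) = (LINT x|lborel. indicator ?B x * (q x - m)\<^sup>2)"
    by (rule lborel_integral_translate) measurable
  finally have 1: "(LINT x:K|lborel. (q x - m)\<^sup>2) \<le> 2 * (LINT x|lborel. indicator K x * (q (x + - w) - q x)\<^sup>2)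
      + 2 * (LINT x|lborel. indicator ?B x * (q x - m)\<^sup>2)" .
  have "E ?B \<le> E N"
  proof -
    have iE: "integrable lborel (\<lambda>x. indicator S x *\<^sub>R (norm (G x))\<^sup>2)" if "S \<in> sets borel" for S
      using integrable_mult_indicator[of S lborel "\<lambda>x. (norm (G x))\<^sup>2"] G that by simp
    show ?thesis unfolding E_def set_lebesgue_integral_def
      by (intro integral_mono iE) (use B in \<open>auto split: split_indicator\<close>)
  qed
  then have "2 ^ (CARD('n) + 1) * r\<^sup>2 * E ?B \<le> 2 ^ (CARD('n) + 1) * r\<^sup>2 * E N"
    by (intro mult_left_mono) auto
  moreover have "(LINT x|lborel. indicator ?B x * (q x - m)\<^sup>2) \<le> 2 ^ (CARD('n) + 1) * r\<^sup>2 * E ?B"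
    using poincare_ball[OF wg subset_trans[OF B(1) N(2)] B(2)] by (simp add: m_def E_def set_lebesgue_integral_def)
  moreover have "(LINT x|lborel. indicator K x * (q (x + - w) - q x)\<^sup>2) \<le> (norm w)\<^sup>2 * E N"
    using weak_grad_pair_translation[OF wg K N, of "- w"] seg by (simp add: E_def set_lebesgue_integral_def)
  ultimately have "(LINT x:K|lborel. (q x - m)\<^sup>2) \<le> 2 * ((norm w)\<^sup>2 * E N) + 2 * (2 ^ (CARD('n) + 1) * r\<^sup>2 * E N)"
    using 1 by linarith
  then show ?thesis unfolding m_def[symmetric] E_def[symmetric] by (simp add: algebra_simps)
qed

section \<open>Lipschitz domains\<close>

lemma orthogonal_part_shift:
  fixes e :: "'a::euclidean_space"
  assumes "norm e = 1"
  shows "(x - t *\<^sub>R e) - ((x - t *\<^sub>R e) \<bullet> e) *\<^sub>R e = x - (x \<bullet> e) *\<^sub>R e"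
    and "(x - t *\<^sub>R e) \<bullet> e = x \<bullet> e - t"
  using assms by (simp_all add: inner_diff_left norm_eq_1 algebra_simps)

lemma norm_orthogonal_part_le:
  fixes e :: "'a::euclidean_space"
  assumes "norm e = 1"
  shows "norm (v - (v \<bullet> e) *\<^sub>R e) \<le> norm v"
proof -
  have "e \<bullet> e = 1" using assms by (simp add: norm_eq_1)
  then have "(norm (v - (v \<bullet> e) *\<^sub>R e))\<^sup>2 = (norm v)\<^sup>2 - (v \<bullet> e)\<^sup>2"
    unfolding power2_norm_eq_inner
    by (simp add: inner_diff_left inner_diff_right inner_commute[of e v] power2_eq_square)
  then have "(norm (v - (v \<bullet> e) *\<^sub>R e))\<^sup>2 \<le> (norm v)\<^sup>2" by simp
  then show ?thesis by (rule power2_le_imp_le) simp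
qed

lemma lipschitz_graph_le:
  fixes e :: "'a::euclidean_space"
  assumes e: "norm e = 1" and L: "L-lipschitz_on {v. v \<bullet> e = 0} g"
  shows "g (x - (x \<bullet> e) *\<^sub>R e) \<le> g (y - (y \<bullet> e) *\<^sub>R e) + L * norm ((x - y) - ((x - y) \<bullet> e) *\<^sub>R e)"
proof -
  have mem: "v - (v \<bullet> e) *\<^sub>R e \<in> {v. v \<bullet> e = 0}" for v
    using e by (simp add: inner_diff_left norm_eq_1)
  have "dist (g (x - (x \<bullet> e) *\<^sub>R e)) (g (y - (y \<bullet> e) *\<^sub>R e)) \<le> L * dist (x - (x \<bullet> e) *\<^sub>R e) (y - (y \<bullet> e) *\<^sub>R e)"
    by (rule lipschitz_onD[OF L mem mem])
  moreover have "dist (x - (x \<bullet> e) *\<^sub>R e) (y - (y \<bullet> e) *\<^sub>R e) = norm ((x - y) - ((x - y) \<bullet> e) *\<^sub>R e)"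
    by (simp add: dist_norm inner_diff_left algebra_simps)
  ultimately show ?thesis by (simp add: dist_real_def)
qed

text \<open>A Lipschitz domain lies on one side of its boundary, which excludes slits and punctures.
  The equality later puts the interior of every mesh element inside \<Omega> itself and not merely
  inside its closure.\<close>

lemma interior_closure_lipschitz:
  fixes \<Omega> :: "'a::euclidean_space set"
  assumes "open \<Omega>" "lipschitz_boundary \<Omega>"
  shows "interior (closure \<Omega>) = \<Omega>"
proof
  show "\<Omega> \<subseteq> interior (closure \<Omega>)"
    using interior_maximal[OF closure_subset assms(1)] .
  show "interior (closure \<Omega>) \<subseteq> \<Omega>"
  proof (rule ccontr)
    assume "\<not> interior (closure \<Omega>) \<subseteq> \<Omega>"
    then obtain x where x: "x \<in> interior (closure \<Omega>)" "x \<notin> \<Omega>" by blast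
    then have "x \<in> frontier \<Omega>"
      using assms(1) interior_subset by (auto simp: frontier_def interior_open)
    then obtain r e g L where r: "r > 0" and e: "norm e = 1" and L: "L-lipschitz_on {v. v \<bullet> e = 0} g"
      and chart: "\<Omega> \<inter> ball x r = {y \<in> ball x r. y \<bullet> e < g (y - (y \<bullet> e) *\<^sub>R e)}"
      using assms(2) unfolding lipschitz_boundary_def by blast
    have L0: "L \<ge> 0" using L lipschitz_on_nonneg by blast
    have xe: "x \<bullet> e \<ge> g (x - (x \<bullet> e) *\<^sub>R e)" using chart x(2) r by fastforce
    obtain d where d: "d > 0" "ball x d \<subseteq> closure \<Omega>" using x(1) by (auto simp: mem_interior)
    define t where "t = min d r / 2"
    have t: "0 < t" "t < d" "t < r" "2 * t \<le> r" using d r by (auto simp: t_def min_def)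
    have "x + t *\<^sub>R e \<in> closure \<Omega>" using d(2) t e by (auto simp: dist_norm subset_eq)
    \<comment> \<open>The point x + t e lies above the graph by at least t. Within distance \<delta>
      of it the graph rises by at most L \<delta> and the height drops by less than \<delta>; since
      (L + 1) \<delta> = t, no point of \<Omega> can be that close.\<close>
    define \<delta> where "\<delta> = t / (L + 1)"
    have \<delta>: "\<delta> > 0" "\<delta> \<le> t" "(L + 1) * \<delta> = t" using t L0 by (auto simp: \<delta>_def divide_simps)
    obtain y where y: "y \<in> \<Omega>" "dist y (x + t *\<^sub>R e) < \<delta>"
      using \<open>x + t *\<^sub>R e \<in> closure \<Omega>\<close> \<delta>(1) closure_approachable by blast
    have "dist x y \<le> dist x (x + t *\<^sub>R e) + dist (x + t *\<^sub>R e) y" by (rule dist_triangle)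
    also have "\<dots> < t + \<delta>" using y(2) t e by (simp add: dist_norm norm_minus_commute)
    finally have "y \<in> ball x r" using t \<delta> by simp
    then have 1: "y \<bullet> e < g (y - (y \<bullet> e) *\<^sub>R e)" using chart y(1) by blast
    define z where "z = y - (x + t *\<^sub>R e)"
    have z: "norm z < \<delta>" using y(2) by (simp add: z_def dist_norm)
    have "g (y - (y \<bullet> e) *\<^sub>R e) \<le> g (x - (x \<bullet> e) *\<^sub>R e) + L * norm ((y - x) - ((y - x) \<bullet> e) *\<^sub>R e)"
      by (rule lipschitz_graph_le[OF e L])
    also have "(y - x) - ((y - x) \<bullet> e) *\<^sub>R e = z - (z \<bullet> e) *\<^sub>R e"
      using orthogonal_part_shift(1)[OF e, of "y - x" t] by (simp add: z_def algebra_simps)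
    also have "L * norm (z - (z \<bullet> e) *\<^sub>R e) \<le> L * \<delta>"
      using norm_orthogonal_part_le[OF e, of z] z L0 by (intro mult_left_mono) auto
    finally have 2: "g (y - (y \<bullet> e) *\<^sub>R e) \<le> g (x - (x \<bullet> e) *\<^sub>R e) + L * \<delta>" by simp
    have "y \<bullet> e = x \<bullet> e + t + z \<bullet> e" using e by (simp add: z_def inner_diff_left inner_add_left norm_eq_1)
    moreover have "\<bar>z \<bullet> e\<bar> \<le> norm z" using Cauchy_Schwarz_ineq2[of z e] e by simp
    ultimately show False using 1 2 xe z \<delta>(3) by (simp add: algebra_simps)
  qed
qed

text \<open>Away from the boundary w = 0 serves. Near it w is a multiple of the chart direction:
  moving against that direction stays below the graph, and a drop proportional to h outweighs what
  the slope can gain over a distance 2 h. Compactness of the frontier leaves finitely many charts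
  and makes both constants uniform.\<close>

lemma lipschitz_push:
  fixes \<Omega> :: "'a::euclidean_space set"
  assumes "open \<Omega>" "bounded \<Omega>" "lipschitz_boundary \<Omega>"
  obtains h0 \<kappa> where "h0 > 0" "\<kappa> \<ge> 0"
    "\<And>a h. a \<in> closure \<Omega> \<Longrightarrow> 0 < h \<Longrightarrow> h < h0 \<Longrightarrow>
       \<exists>w. norm w \<le> \<kappa> * h \<and> ball (a - w) (2 * h) \<subseteq> \<Omega> \<and>
         (\<forall>x\<in>\<Omega> \<inter> ball a (2 * h). \<forall>s. 0 \<le> s \<and> s \<le> 1 \<longrightarrow> x - s *\<^sub>R w \<in> \<Omega>)"
proof -
  define P where "P z r e g L \<longleftrightarrow> r > 0 \<and> norm e = 1 \<and> L-lipschitz_on {v. v \<bullet> e = 0} g \<and>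
        \<Omega> \<inter> ball z r = {y \<in> ball z r. y \<bullet> e < g (y - (y \<bullet> e) *\<^sub>R e)}" for z r e g L
  have "\<forall>z\<in>frontier \<Omega>. \<exists>r e g L. P z r e g L"
    using assms(3) unfolding lipschitz_boundary_def P_def by blast
  then obtain r e g L where "\<forall>z\<in>frontier \<Omega>. P z (r z) (e z) (g z) (L z)"
    by metis
  then have ch: "\<And>z. z \<in> frontier \<Omega> \<Longrightarrow> r z > 0 \<and> norm (e z) = 1 \<and> (L z)-lipschitz_on {v. v \<bullet> e z = 0} (g z) \<and>
        \<Omega> \<inter> ball z (r z) = {y \<in> ball z (r z). y \<bullet> e z < g z (y - (y \<bullet> e z) *\<^sub>R e z)}"
    unfolding P_def by blast
  have "frontier \<Omega> \<subseteq> (\<Union>z\<in>frontier \<Omega>. ball z (r z / 2))" using ch by force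
  then obtain F where F: "F \<subseteq> frontier \<Omega>" "finite F" "frontier \<Omega> \<subseteq> (\<Union>z\<in>F. ball z (r z / 2))"
    by (rule compactE_image[OF compact_frontier_bounded[OF assms(2)] open_ball])
  \<comment> \<open>The part 2 L pays for the change of the graph over a lateral distance 2 h, the
    part 2 for the vertical extent of the ball of radius 2 h. The inserted 0 gives the maximum a
    value for empty F.\<close>
  define \<kappa> where "\<kappa> = Max (insert 0 ((\<lambda>z. 2 * L z + 2) ` F))"
  have \<kappa>: "\<kappa> \<ge> 0" "\<And>z. z \<in> F \<Longrightarrow> 2 * L z + 2 \<le> \<kappa>" unfolding \<kappa>_def using F(2) by auto
  \<comment> \<open>Some boundary point within 2 h of a lies within r/2 of a chart centre, and all
    points used later are within (\<kappa> + 4) h of a. The threshold makes (\<kappa> + 6) h + r/2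
    less than r, so these points remain in the chart.\<close>
  define h0 where "h0 = Min (insert 1 ((\<lambda>z. r z / (2 * (\<kappa> + 6))) ` F))"
  have h0: "h0 > 0" "\<And>z. z \<in> F \<Longrightarrow> h0 \<le> r z / (2 * (\<kappa> + 6))"
    unfolding h0_def using F(1,2) ch \<kappa>(1) by (auto simp: Min_gr_iff intro!: divide_pos_pos)
  show thesis
  proof (rule that[OF h0(1) \<kappa>(1)])
    fix a :: 'a and h :: real assume a: "a \<in> closure \<Omega>" and h: "0 < h" "h < h0"
    show "\<exists>w. norm w \<le> \<kappa> * h \<and> ball (a - w) (2 * h) \<subseteq> \<Omega> \<and>
         (\<forall>x\<in>\<Omega> \<inter> ball a (2 * h). \<forall>s. 0 \<le> s \<and> s \<le> 1 \<longrightarrow> x - s *\<^sub>R w \<in> \<Omega>)"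
    proof (cases "ball a (2 * h) \<inter> frontier \<Omega> = {}")
      case True
      moreover have ab: "a \<in> ball a (2 * h)" using h by simp
      ultimately have "a \<notin> frontier \<Omega>" by blast
      then have "a \<in> \<Omega>" using a assms(1) by (simp add: frontier_def interior_open)
      then have "ball a (2 * h) \<inter> \<Omega> \<noteq> {}" using ab by blast
      then have "ball a (2 * h) \<subseteq> \<Omega>"
        using True connected_Int_frontier[OF connected_ball, of a "2 * h" \<Omega>] by blast
      then show ?thesis using \<kappa>(1) h by (intro exI[of _ 0]) auto
    next
      case False
      then obtain z0 where z0: "z0 \<in> frontier \<Omega>" "dist a z0 < 2 * h" by auto
      then obtain z where z: "z \<in> F" "dist z z0 < r z / 2" using F(3) by auto
      have e: "norm (e z) = 1" and L: "(L z)-lipschitz_on {v. v \<bullet> e z = 0} (g z)" and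
        chart: "\<Omega> \<inter> ball z (r z) = {y \<in> ball z (r z). y \<bullet> e z < g z (y - (y \<bullet> e z) *\<^sub>R e z)}"
        using ch z(1) F(1) by auto
      have L0: "L z \<ge> 0" using L lipschitz_on_nonneg by blast
      have "h * (2 * (\<kappa> + 6)) < r z"
      proof -
        have "h < r z / (2 * (\<kappa> + 6))" using h h0(2)[OF z(1)] by linarith
        then show ?thesis using \<kappa>(1) by (subst (asm) pos_less_divide_eq) auto
      qed
      then have hr: "\<kappa> * h + 6 * h + r z / 2 < r z" by (simp add: algebra_simps)
      have near: "y \<in> ball z (r z)" if "dist a y \<le> \<kappa> * h + 4 * h" for y
      proof -
        have "dist z y \<le> dist z z0 + dist z0 a + dist a y"
          by (meson add_mono dist_triangle order_refl order_trans)
        then show ?thesis using z0(2) z(2) that hr by (simp add: dist_commute)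
      qed
      define w where "w = (\<kappa> * h) *\<^sub>R e z"
      have nw: "norm w = \<kappa> * h" using e \<kappa>(1) h by (simp add: w_def)
      have "ball (a - w) (2 * h) \<subseteq> \<Omega>"
      proof
        fix y assume y: "y \<in> ball (a - w) (2 * h)"
        define \<omega> where "\<omega> = y - (a - w)"
        have \<omega>: "norm \<omega> < 2 * h" using y by (simp add: \<omega>_def dist_norm norm_minus_commute)
        \<comment> \<open>a may lie on the boundary, where it is not strictly below the graph. It is
          replaced by a point x of \<Omega> so close that y is still less than 2 h away from x -
          w.\<close>
        then obtain x where x: "x \<in> \<Omega>" "dist x a < 2 * h - norm \<omega>"
          using a closure_approachable by (metis diff_gt_0_iff_gt)
        define \<omega>' where "\<omega>' = y - (x - w)"
        have "\<omega>' = \<omega> + (a - x)" by (simp add: \<omega>_def \<omega>'_def)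
        then have \<omega>': "norm \<omega>' < 2 * h"
          using norm_triangle_ineq[of \<omega> "a - x"] x(2) by (simp add: dist_norm norm_minus_commute)
        have "dist x a < 2 * h" using x(2) norm_ge_zero[of \<omega>] by linarith
        then have xb: "x \<in> ball z (r z)"
          using \<kappa>(1) h by (intro near) (simp add: dist_commute, smt (verit) mult_nonneg_nonneg)
        have xe: "x \<bullet> e z < g z (x - (x \<bullet> e z) *\<^sub>R e z)" using chart x(1) xb by blast
        have "dist a y \<le> norm w + norm \<omega>"
        proof -
          have "a - y = w + - \<omega>" by (simp add: \<omega>_def)
          then show ?thesis using norm_triangle_ineq[of w "- \<omega>"] by (simp only: dist_norm norm_minus_cancel)
        qed
        then have yb: "y \<in> ball z (r z)" using nw \<omega> h by (intro near) simp
        have "g z (x - (x \<bullet> e z) *\<^sub>R e z) \<le> g z (y - (y \<bullet> e z) *\<^sub>R e z) + L z * norm ((x - y) - ((x - y) \<bullet> e z) *\<^sub>R e z)"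
          by (rule lipschitz_graph_le[OF e L])
        also have "(x - y) - ((x - y) \<bullet> e z) *\<^sub>R e z = - \<omega>' - (- \<omega>' \<bullet> e z) *\<^sub>R e z"
          using orthogonal_part_shift(1)[OF e, of "x - y" "\<kappa> * h"] by (simp add: \<omega>'_def w_def algebra_simps)
        also have "L z * norm \<dots> \<le> L z * (2 * h)"
          using norm_orthogonal_part_le[OF e, of "- \<omega>'"] \<omega>' L0 by (intro mult_left_mono) auto
        finally have 1: "g z (x - (x \<bullet> e z) *\<^sub>R e z) \<le> g z (y - (y \<bullet> e z) *\<^sub>R e z) + L z * (2 * h)" by simp
        have "y = \<omega>' + x - (\<kappa> * h) *\<^sub>R e z" by (simp add: \<omega>'_def w_def)
        then have "y \<bullet> e z = (\<omega>' + x) \<bullet> e z - \<kappa> * h" using orthogonal_part_shift(2)[OF e] by simp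
        moreover have "\<bar>\<omega>' \<bullet> e z\<bar> \<le> norm \<omega>'" using Cauchy_Schwarz_ineq2[of \<omega>' "e z"] e by simp
        moreover have "(2 * L z + 2) * h \<le> \<kappa> * h" using \<kappa>(2)[OF z(1)] h by (intro mult_right_mono) auto
        ultimately have "y \<bullet> e z < g z (y - (y \<bullet> e z) *\<^sub>R e z)"
          using 1 xe \<omega>' by (simp add: inner_add_left algebra_simps)
        then show "y \<in> \<Omega>" using chart yb by blast
      qed
      moreover have "x - s *\<^sub>R w \<in> \<Omega>" if x: "x \<in> \<Omega>" "dist a x < 2 * h" and s: "0 \<le> s" "s \<le> 1" for x s
      proof -
        have sk: "0 \<le> s * (\<kappa> * h)" "s * (\<kappa> * h) \<le> \<kappa> * h" using s \<kappa>(1) h by (auto simp: mult_left_le_one_le)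
        have "0 \<le> \<kappa> * h" using \<kappa>(1) h by simp
        then have xb: "x \<in> ball z (r z)" using x(2) h by (intro near) linarith
        have "dist a (x - s *\<^sub>R w) \<le> dist a x + dist x (x - s *\<^sub>R w)" by (rule dist_triangle)
        also have "dist x (x - s *\<^sub>R w) = s * (\<kappa> * h)" using nw s by (simp add: dist_norm)
        finally have yb: "x - s *\<^sub>R w \<in> ball z (r z)" using sk x(2) h by (intro near) linarith
        have xe: "x \<bullet> e z < g z (x - (x \<bullet> e z) *\<^sub>R e z)" using chart x(1) xb by blast
        have sw: "s *\<^sub>R w = (s * (\<kappa> * h)) *\<^sub>R e z" by (simp add: w_def)
        have "(x - s *\<^sub>R w) \<bullet> e z < g z ((x - s *\<^sub>R w) - ((x - s *\<^sub>R w) \<bullet> e z) *\<^sub>R e z)"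
          unfolding sw orthogonal_part_shift(1)[OF e]
          using orthogonal_part_shift(2)[OF e, of x "s * (\<kappa> * h)"] sk(1) xe by linarith
        then show ?thesis using chart yb by blast
      qed
      ultimately show ?thesis using nw by (intro exI[of _ w]) auto
    qed
  qed
qed

section \<open>Piecewise affine functions on a mesh\<close>

text \<open>Affine independence is linear independence of the differences to one vertex. A linear
  functional can be prescribed on these differences, and its representing vector is g.\<close>

lemma affine_interpolation:
  fixes C :: "'a::euclidean_space set" and f :: "'a \<Rightarrow> real"
  assumes "\<not> affine_dependent C"
  shows "\<exists>c g. \<forall>a\<in>C. c + g \<bullet> a = f a"
proof (cases "C = {}")
  case False
  then obtain a0 where a0: "a0 \<in> C" by blast
  let ?B = "(\<lambda>x. - a0 + x) ` (C - {a0})"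
  have "independent ?B" using assms affine_dependent_iff_dependent2[OF a0] by simp
  then obtain l :: "'a \<Rightarrow> real" where l: "linear l" "\<And>x. x \<in> ?B \<Longrightarrow> l x = f (a0 + x) - f a0"
    using linear_independent_extend[of ?B "\<lambda>x. f (a0 + x) - f a0"] by blast
  define g where "g = (\<Sum>b\<in>Basis. l b *\<^sub>R b)"
  have lg: "l x = g \<bullet> x" for x
  proof -
    have "l x = l (\<Sum>b\<in>Basis. (x \<bullet> b) *\<^sub>R b)" by (simp add: euclidean_representation)
    also have "\<dots> = (\<Sum>b\<in>Basis. (x \<bullet> b) * l b)"
      using l(1) by (simp add: linear_sum linear_scale)
    also have "\<dots> = g \<bullet> x" by (simp add: g_def inner_sum_left inner_commute[of x] mult.commute)
    finally show ?thesis .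
  qed
  have "(f a0 - g \<bullet> a0) + g \<bullet> a = f a" if "a \<in> C" for a
  proof (cases "a = a0")
    case False
    then have "- a0 + a \<in> ?B" using that by blast
    then have "g \<bullet> (- a0 + a) = f a - f a0" using l(2) lg by fastforce
    then show ?thesis by (simp add: inner_diff_right)
  qed simp
  then show ?thesis by blast
qed simp

lemma affine_eq_if_eq_on_ball:
  fixes g g' :: "'a::euclidean_space"
  assumes "r > 0" "\<And>x. x \<in> cball z r \<Longrightarrow> c + g \<bullet> x = c' + g' \<bullet> x"
  shows "g = g'"
proof (rule ccontr)
  assume "g \<noteq> g'"
  define d where "d = g - g'"
  have d: "norm d > 0" using \<open>g \<noteq> g'\<close> by (simp add: d_def)
  have "z + (r / norm d) *\<^sub>R d \<in> cball z r" "z \<in> cball z r" using d assms(1) by (auto simp: dist_norm)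
  then have "c + g \<bullet> (z + (r / norm d) *\<^sub>R d) = c' + g' \<bullet> (z + (r / norm d) *\<^sub>R d)" "c + g \<bullet> z = c' + g' \<bullet> z"
    using assms(2) by blast+
  then have "(r / norm d) * (d \<bullet> d) = 0" by (simp add: d_def algebra_simps inner_add_right inner_diff_left)
  then show False using d assms(1) by simp
qed

definition verts :: "'a::euclidean_space set \<Rightarrow> 'a set" where
  "verts K = {a. a extreme_point_of K}"

text \<open>A choice, but a determined one for functions affine on a mesh element: the element
  contains a ball, and an affine function on a ball fixes its gradient.\<close>

definition elgrad :: "('a::euclidean_space \<Rightarrow> real) \<Rightarrow> 'a set \<Rightarrow> 'a" where
  "elgrad v K = (SOME g. \<exists>c. \<forall>x\<in>K. v x = c + g \<bullet> x)"

text \<open>The constant \<open>c\<close> controls both shape regularity and quasi-uniformity.\<close>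

locale fe_mesh =
  fixes \<Omega> :: "(real^'n) set" and \<T> :: "(real^'n) set set" and h c :: real
  assumes open_domain: "open \<Omega>" and bounded_domain: "bounded \<Omega>"
    and interior_closure_domain: "interior (closure \<Omega>) = \<Omega>"
    and mesh: "conforming_mesh \<Omega> \<T>"
    and h_pos: "h > 0" and c_pos: "c > 0"
    and diameter_le: "K \<in> \<T> \<Longrightarrow> diameter K \<le> h"
    and ex_inball: "K \<in> \<T> \<Longrightarrow> \<exists>z. cball z (c * h) \<subseteq> K"
begin

lemma finite_mesh: "finite \<T>"
  and Union_mesh: "\<Union>\<T> = closure \<Omega>"
  and face_Int: "K \<in> \<T> \<Longrightarrow> K' \<in> \<T> \<Longrightarrow> (K \<inter> K') face_of K"
  using mesh by (auto simp: conforming_mesh_def triangulation_def)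

lemma simplex_element: "K \<in> \<T> \<Longrightarrow> int CARD('n) simplex K"
  using mesh by (auto simp: conforming_mesh_def)

lemma ch_pos: "c * h > 0"
  using h_pos c_pos by simp

lemma convex_element: "K \<in> \<T> \<Longrightarrow> convex K"
  and compact_element: "K \<in> \<T> \<Longrightarrow> compact K"
  using simplex_element convex_simplex compact_simplex by blast+

lemma verts_element:
  assumes "K \<in> \<T>"
  shows "K = convex hull (verts K)" "finite (verts K)" "\<not> affine_dependent (verts K)"
    "card (verts K) = CARD('n) + 1"
proof -
  obtain C where C: "finite C" "\<not> affine_dependent C" "int (card C) = int CARD('n) + 1" "K = convex hull C"
    using simplex_element[OF assms] unfolding simplex by blast
  have "verts K = C"
    unfolding verts_def C(4) using extreme_point_of_convex_hull_affine_independent[OF C(2)] by auto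
  then show "K = convex hull (verts K)" "finite (verts K)" "\<not> affine_dependent (verts K)"
    "card (verts K) = CARD('n) + 1"
    using C by auto
qed

lemma verts_subset: "K \<in> \<T> \<Longrightarrow> verts K \<subseteq> K"
  by (auto simp: verts_def extreme_point_of_def)

lemma verts_nonempty: "K \<in> \<T> \<Longrightarrow> verts K \<noteq> {}"
  using verts_element(4) by fastforce

lemma nodes_eq: "nodes \<T> = (\<Union>K\<in>\<T>. verts K)"
  by (auto simp: nodes_def verts_def)

lemma finite_nodes: "finite (nodes \<T>)"
  unfolding nodes_eq using finite_mesh verts_element(2) by blast

lemma nodes_subset: "nodes \<T> \<subseteq> closure \<Omega>"
  unfolding nodes_eq Union_mesh[symmetric] using verts_subset by blast

lemma verts_nodes: "K \<in> \<T> \<Longrightarrow> a \<in> verts K \<Longrightarrow> a \<in> nodes \<T>"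
  unfolding nodes_eq by blast

lemma dist_element_le: "K \<in> \<T> \<Longrightarrow> x \<in> K \<Longrightarrow> y \<in> K \<Longrightarrow> dist x y \<le> h"
  using diameter_bounded_bound[of K x y] compact_element[of K] diameter_le[of K]
  by (meson compact_imp_bounded order_trans)

lemma interior_element_subset: assumes "K \<in> \<T>" shows "interior K \<subseteq> \<Omega>"
proof -
  have "K \<subseteq> closure \<Omega>" using assms Union_mesh by blast
  then show ?thesis using interior_mono interior_closure_domain by blast
qed

text \<open>Two distinct elements meet in a common face, which is proper for at least one of them,
  and a proper face of a convex set misses its interior.\<close>

lemma interior_disjoint:
  assumes "K \<in> \<T>" "K' \<in> \<T>" "K \<noteq> K'" shows "interior K \<inter> interior K' = {}"
proof -
  have f: "(K \<inter> K') face_of K" "(K \<inter> K') face_of K'"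
    using face_Int assms by (metis inf_commute)+
  have "K \<inter> K' \<noteq> K \<or> K \<inter> K' \<noteq> K'" using assms(3) by blast
  then have "K \<inter> K' \<inter> interior K = {} \<or> K \<inter> K' \<inter> interior K' = {}"
    using face_of_disjoint_interior[OF f(1)] face_of_disjoint_interior[OF f(2)] by blast
  then show ?thesis using interior_subset by blast
qed

text \<open>Phrased with indicators so that integrals over \<Omega> split by linearity. The
  exceptional set consists of the frontiers of finitely many convex sets, each negligible.\<close>

lemma domain_AE_interiors:
  "AE x in lebesgue. indicator \<Omega> x = (\<Sum>K\<in>\<T>. indicator (interior K) x :: real)"
proof -
  have "negligible (\<Union>(frontier ` \<T>))"
    using finite_mesh negligible_convex_frontier[OF convex_element]
    by (intro negligible_Union) auto
  then have "AE x in lebesgue. x \<notin> \<Union>(frontier ` \<T>)"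
    by (intro AE_not_in) (simp add: negligible_iff_null_sets)
  then show ?thesis
  proof eventually_elim
    case (elim x)
    show ?case
    proof (cases "x \<in> \<Omega>")
      case True
      then obtain K where K: "K \<in> \<T>" "x \<in> K" using Union_mesh closure_subset by blast
      then have xK: "x \<in> interior K" using elim closure_subset unfolding frontier_def by blast
      have "(\<Sum>K\<in>\<T>. indicator (interior K) x :: real) = indicator (interior K) x + (\<Sum>K\<in>\<T>-{K}. indicator (interior K) x)"
        by (rule sum.remove[OF finite_mesh K(1)])
      also have "(\<Sum>K\<in>\<T>-{K}. indicator (interior K) x :: real) = 0"
      proof (intro sum.neutral ballI)
        fix K' assume "K' \<in> \<T> - {K}"
        then have "interior K \<inter> interior K' = {}" using interior_disjoint[OF K(1)] by blast
        then show "indicator (interior K') x = (0::real)" using xK by (auto simp: indicator_def)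
      qed
      finally show ?thesis using True xK by simp
    next
      case False
      then have "(\<Sum>K\<in>\<T>. indicator (interior K) x :: real) = 0"
      proof (intro sum.neutral ballI)
        fix K assume "K \<in> \<T>"
        then have "x \<notin> interior K" using False interior_element_subset by blast
        then show "indicator (interior K) x = (0::real)" by simp
      qed
      then show ?thesis using False by simp
    qed
  qed
qed

lemma integral_split_elements:
  fixes f :: "real^'n \<Rightarrow> real"
  assumes "integrable (lebesgue_on \<Omega>) f"
  shows "(LINT x|lebesgue_on \<Omega>. f x) = (\<Sum>K\<in>\<T>. LINT x|lebesgue_on (interior K). f x)"
    and "K \<in> \<T> \<Longrightarrow> integrable (lebesgue_on (interior K)) f"
proof -
  have f: "integrable lebesgue (\<lambda>x. indicator \<Omega> x *\<^sub>R f x)"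
    using assms open_domain by (subst (asm) integrable_restrict_space) auto
  have eqK: "indicator (interior K) x *\<^sub>R f x = indicator (interior K) x *\<^sub>R (indicator \<Omega> x *\<^sub>R f x)" if "K \<in> \<T>" for K x
    using interior_element_subset[OF that] by (auto split: split_indicator)
  have i: "integrable lebesgue (\<lambda>x. indicator (interior K) x *\<^sub>R f x)" if "K \<in> \<T>" for K
    unfolding eqK[OF that] by (rule integrable_mult_indicator[OF _ f]) auto
  then show "integrable (lebesgue_on (interior K)) f" if "K \<in> \<T>" for K
    using that by (subst integrable_restrict_space) auto
  have "(LINT x|lebesgue_on \<Omega>. f x) = (LINT x|lebesgue. indicator \<Omega> x *\<^sub>R f x)"
    using open_domain by (subst integral_restrict_space) auto
  also have "\<dots> = (LINT x|lebesgue. (\<Sum>K\<in>\<T>. indicator (interior K) x *\<^sub>R f x))"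
  proof (rule integral_cong_AE)
    show "AE x in lebesgue. indicator \<Omega> x *\<^sub>R f x = (\<Sum>K\<in>\<T>. indicator (interior K) x *\<^sub>R f x)"
      using domain_AE_interiors by eventually_elim (simp add: sum_distrib_right)
    show "(\<lambda>x. \<Sum>K\<in>\<T>. indicator (interior K) x *\<^sub>R f x) \<in> borel_measurable lebesgue"
      using i by (intro borel_measurable_sum) blast
  qed (use f in blast)
  also have "\<dots> = (\<Sum>K\<in>\<T>. LINT x|lebesgue. indicator (interior K) x *\<^sub>R f x)"
    by (rule Bochner_Integration.integral_sum[OF i])
  also have "\<dots> = (\<Sum>K\<in>\<T>. LINT x|lebesgue_on (interior K). f x)"
    by (intro sum.cong refl, subst integral_restrict_space) auto
  finally show "(LINT x|lebesgue_on \<Omega>. f x) = (\<Sum>K\<in>\<T>. LINT x|lebesgue_on (interior K). f x)" .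
qed

lemma elgrad_eqI:
  assumes K: "K \<in> \<T>" and v: "\<And>x. x \<in> K \<Longrightarrow> v x = d + g \<bullet> x"
  shows "elgrad v K = g"
proof -
  obtain z where z: "cball z (c * h) \<subseteq> K" using ex_inball[OF K] by blast
  have "\<exists>d. \<forall>x\<in>K. v x = d + elgrad v K \<bullet> x"
    unfolding elgrad_def by (rule someI[where x = g]) (use v in blast)
  then obtain d' where "\<forall>x\<in>K. v x = d' + elgrad v K \<bullet> x" by blast
  then show ?thesis using affine_eq_if_eq_on_ball[OF ch_pos, of z d' "elgrad v K" d g] z v by (metis subsetD)
qed

lemma P1_elgrad:
  assumes "v \<in> P1 \<T>" "K \<in> \<T>"
  obtains d where "\<And>x. x \<in> K \<Longrightarrow> v x = d + elgrad v K \<bullet> x"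
proof -
  obtain d g where dg: "\<forall>x\<in>K. v x = d + g \<bullet> x" using assms unfolding P1_def by blast
  then have "elgrad v K = g" using elgrad_eqI[OF assms(2), of v d g] by blast
  then show thesis using that dg by blast
qed

lemma P1_diff:
  assumes "v \<in> P1 \<T>" "K \<in> \<T>" "x \<in> K" "y \<in> K"
  shows "v x - v y = elgrad v K \<bullet> (x - y)"
proof -
  obtain d where "\<And>x. x \<in> K \<Longrightarrow> v x = d + elgrad v K \<bullet> x" using P1_elgrad[OF assms(1,2)] by blast
  then show ?thesis using assms by (simp add: inner_diff_right)
qed

lemma P1_sum:
  assumes "finite A" "\<And>a. a \<in> A \<Longrightarrow> f a \<in> P1 \<T>"
  shows "(\<lambda>x. \<Sum>a\<in>A. k a * f a x) \<in> P1 \<T>"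
    and "K \<in> \<T> \<Longrightarrow> elgrad (\<lambda>x. \<Sum>a\<in>A. k a * f a x) K = (\<Sum>a\<in>A. k a *\<^sub>R elgrad (f a) K)"
proof -
  have *: "\<exists>d. \<forall>x\<in>K. (\<Sum>a\<in>A. k a * f a x) = d + (\<Sum>a\<in>A. k a *\<^sub>R elgrad (f a) K) \<bullet> x" if K: "K \<in> \<T>" for K
  proof -
    have "\<forall>a\<in>A. \<exists>d. \<forall>x\<in>K. f a x = d + elgrad (f a) K \<bullet> x"
      using P1_elgrad[OF assms(2) K] by metis
    then obtain d where "\<forall>a\<in>A. \<forall>x\<in>K. f a x = d a + elgrad (f a) K \<bullet> x" by metis
    then have "\<forall>x\<in>K. (\<Sum>a\<in>A. k a * f a x) = (\<Sum>a\<in>A. k a * d a) + (\<Sum>a\<in>A. k a *\<^sub>R elgrad (f a) K) \<bullet> x"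
      by (simp add: inner_sum_left sum.distrib[symmetric] algebra_simps)
    then show ?thesis by blast
  qed
  show "(\<lambda>x. \<Sum>a\<in>A. k a * f a x) \<in> P1 \<T>"
    unfolding P1_def mem_Collect_eq
  proof (intro conjI ballI)
    show "continuous_on (\<Union>\<T>) (\<lambda>x. \<Sum>a\<in>A. k a * f a x)"
      using assms(2) by (intro continuous_intros) (auto simp: P1_def)
  qed (use * in blast)
  assume K: "K \<in> \<T>"
  obtain d where "\<forall>x\<in>K. (\<Sum>a\<in>A. k a * f a x) = d + (\<Sum>a\<in>A. k a *\<^sub>R elgrad (f a) K) \<bullet> x"
    using *[OF K] by blast
  then show "elgrad (\<lambda>x. \<Sum>a\<in>A. k a * f a x) K = (\<Sum>a\<in>A. k a *\<^sub>R elgrad (f a) K)"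
    by (intro elgrad_eqI[OF K, where d = d]) blast
qed

lemma P1_cong:
  assumes "v \<in> P1 \<T>" "\<And>x. x \<in> closure \<Omega> \<Longrightarrow> w x = v x"
  shows "w \<in> P1 \<T>" and "K \<in> \<T> \<Longrightarrow> elgrad w K = elgrad v K"
proof -
  have c: "continuous_on (\<Union>\<T>) w"
    using assms unfolding P1_def Union_mesh by (metis (mono_tags, lifting) continuous_on_cong mem_Collect_eq)
  moreover have wK: "w x = v x" if "K \<in> \<T>" "x \<in> K" for K x using assms(2) that Union_mesh by blast
  ultimately show "w \<in> P1 \<T>" using assms(1) unfolding P1_def by auto
  assume K: "K \<in> \<T>"
  obtain d where "\<And>x. x \<in> K \<Longrightarrow> v x = d + elgrad v K \<bullet> x" using P1_elgrad[OF assms(1) K] by blast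
  then show "elgrad w K = elgrad v K" using wK[OF K] by (intro elgrad_eqI[OF K]) auto
qed

lemma P1_add:
  assumes "v \<in> P1 \<T>" "w \<in> P1 \<T>"
  shows "(\<lambda>x. k * v x + l * w x) \<in> P1 \<T>"
    and "K \<in> \<T> \<Longrightarrow> elgrad (\<lambda>x. k * v x + l * w x) K = k *\<^sub>R elgrad v K + l *\<^sub>R elgrad w K"
  using P1_sum(1)[of "UNIV :: bool set" "\<lambda>b. if b then v else w" "\<lambda>b. if b then k else l"]
    P1_sum(2)[of "UNIV :: bool set" "\<lambda>b. if b then v else w" K "\<lambda>b. if b then k else l"] assms
  by (auto simp: UNIV_bool add.commute)

lemma P1_const: "(\<lambda>x. k) \<in> P1 \<T>"
proof -
  have "\<forall>x\<in>K. k = k + 0 \<bullet> x" for K :: "(real^'n) set" by simp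
  then show ?thesis unfolding P1_def mem_Collect_eq using continuous_on_const by blast
qed

lemma affine_le_verts:
  assumes K: "K \<in> \<T>" and x: "x \<in> K" and le: "\<And>a. a \<in> verts K \<Longrightarrow> d + g \<bullet> a \<le> m"
  shows "d + g \<bullet> x \<le> (m::real)"
proof -
  have "convex_on (convex hull (verts K)) (\<lambda>x. d + g \<bullet> x)"
    by (rule convex_onI) (auto simp: inner_add_right algebra_simps convex_convex_hull)
  from convex_on_convex_hull_bound[OF this] show ?thesis
    using x le verts_element(1)[OF K] by blast
qed

lemma P1_le_verts:
  assumes "v \<in> P1 \<T>" "K \<in> \<T>" "x \<in> K" "\<And>a. a \<in> verts K \<Longrightarrow> v a \<le> m"
  shows "v x \<le> m"
proof -
  obtain d where d: "\<And>x. x \<in> K \<Longrightarrow> v x = d + elgrad v K \<bullet> x" using P1_elgrad[OF assms(1,2)] by blast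
  show ?thesis
    using affine_le_verts[OF assms(2,3), of d "elgrad v K" m] assms(4) d assms(3) verts_subset[OF assms(2)]
    by (metis subsetD)
qed

lemma P1_ge_verts:
  assumes "v \<in> P1 \<T>" "K \<in> \<T>" "x \<in> K" "\<And>a. a \<in> verts K \<Longrightarrow> m \<le> v a"
  shows "m \<le> v x"
proof -
  have "(\<lambda>x. (-1) * v x + 0 * v x) \<in> P1 \<T>" by (rule P1_add) fact+
  from P1_le_verts[OF this assms(2,3), of "-m"] show ?thesis using assms(4) by simp
qed

lemma P1_abs_le_verts:
  assumes "v \<in> P1 \<T>" "K \<in> \<T>" "x \<in> K" "\<And>a. a \<in> verts K \<Longrightarrow> \<bar>v a\<bar> \<le> m"
  shows "\<bar>v x\<bar> \<le> m"
  using P1_le_verts[OF assms(1-3), of m] P1_ge_verts[OF assms(1-3), of "-m"] assms(4)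
  by (metis abs_le_iff minus_le_iff)

lemma P1_eqI:
  assumes "v \<in> P1 \<T>" "w \<in> P1 \<T>" "\<And>a. a \<in> nodes \<T> \<Longrightarrow> v a = w a" "x \<in> closure \<Omega>"
  shows "v x = w x"
proof -
  obtain K where K: "K \<in> \<T>" "x \<in> K" using assms(4) Union_mesh by blast
  have "(\<lambda>x. 1 * v x + (-1) * w x) \<in> P1 \<T>" by (rule P1_add) fact+
  from P1_abs_le_verts[OF this K, of 0] show ?thesis using assms(3) verts_nodes[OF K(1)] by simp
qed

text \<open>An affine function takes its largest differences at vertices, and the element contains a
  segment of length 2 c h in the direction of the gradient. The factor 1/h of the gradient estimates
  below originates here.\<close>

lemma norm_elgrad_le:
  assumes "v \<in> P1 \<T>" "K \<in> \<T>" and le: "\<And>a b. a \<in> verts K \<Longrightarrow> b \<in> verts K \<Longrightarrow> v a - v b \<le> D"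
  shows "norm (elgrad v K) \<le> D / (2 * (c * h))"
proof -
  obtain z where z: "cball z (c * h) \<subseteq> K" using ex_inball[OF assms(2)] by blast
  obtain d where d: "\<And>x. x \<in> K \<Longrightarrow> v x = d + elgrad v K \<bullet> x" using P1_elgrad[OF assms(1,2)] by blast
  let ?g = "elgrad v K"
  have xy: "v x - v y \<le> D" if "x \<in> K" "y \<in> K" for x y
  proof -
    have 1: "v a - v y \<le> D" if "a \<in> verts K" for a
      using P1_ge_verts[OF assms(1,2) \<open>y \<in> K\<close>, of "v a - D"] le[OF that] by (smt (verit))
    then show ?thesis using P1_le_verts[OF assms(1,2) \<open>x \<in> K\<close>, of "D + v y"] by (smt (verit))
  qed
  show ?thesis
  proof (cases "?g = 0")
    case True
    have "z \<in> K" using z ch_pos by (auto simp: subset_eq)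
    then have "0 \<le> D" using xy[of z z] by simp
    then show ?thesis using True ch_pos by simp
  next
    case False
    define w where "w = (c * h / norm ?g) *\<^sub>R ?g"
    have "norm w = c * h" using False ch_pos by (simp add: w_def)
    then have "z + w \<in> K" "z - w \<in> K" using z by (auto simp: subset_eq dist_norm)
    then have "?g \<bullet> (z + w - (z - w)) \<le> D" using xy P1_diff[OF assms(1,2)] by metis
    moreover have "?g \<bullet> (z + w - (z - w)) = 2 * (?g \<bullet> w)"
    proof -
      have "z + w - (z - w) = w + w" by (simp add: algebra_simps)
      then show ?thesis by (simp only: inner_add_right)
    qed
    moreover have "?g \<bullet> w = c * h * norm ?g"
      using False by (simp add: w_def dot_square_norm power2_eq_square)
    ultimately show ?thesis using ch_pos by (simp add: pos_le_divide_eq mult_ac)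
  qed
qed

text \<open>Conformity lets the local interpolants agree: the intersection of two elements is a face
  of both, hence the hull of its extreme points, and these are vertices of both elements. Continuity
  then follows by gluing over finitely many closed sets.\<close>

lemma ex_P1:
  "\<exists>\<phi>\<in>P1 \<T>. \<forall>a\<in>nodes \<T>. \<phi> a = f a"
proof -
  have "\<forall>K\<in>\<T>. \<exists>d g. \<forall>a\<in>verts K. d + g \<bullet> a = f a"
    using affine_interpolation verts_element(3) by blast
  then obtain d g where dg: "\<And>K a. K \<in> \<T> \<Longrightarrow> a \<in> verts K \<Longrightarrow> d K + g K \<bullet> a = f a" by metis
  have consistent: "d K + g K \<bullet> x = d K' + g K' \<bullet> x"
    if K: "K \<in> \<T>" "K' \<in> \<T>" and x: "x \<in> K" "x \<in> K'" for K K' x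
  proof -
    have F: "(K \<inter> K') face_of K" "(K \<inter> K') face_of K'" using face_Int K by (metis inf_commute)+
    have "compact (K \<inter> K')" "convex (K \<inter> K')"
      using compact_element convex_element K by (auto simp: compact_Int convex_Int)
    then have hull: "K \<inter> K' = convex hull {a. a extreme_point_of (K \<inter> K')}"
      by (rule Krein_Milman_Minkowski)
    have "{a. a extreme_point_of (K \<inter> K')} \<subseteq> {y. (d K - d K') + (g K - g K') \<bullet> y = 0}"
    proof safe
      fix a assume "a extreme_point_of (K \<inter> K')"
      then have "a \<in> verts K" "a \<in> verts K'"
        using extreme_point_of_face[OF F(1)] extreme_point_of_face[OF F(2)] by (auto simp: verts_def)
      then have "d K + g K \<bullet> a = d K' + g K' \<bullet> a" using dg K by simp
      then show "(d K - d K') + (g K - g K') \<bullet> a = 0" by (simp add: inner_diff_left)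
    qed
    moreover have "convex {y. (d K - d K') + (g K - g K') \<bullet> y = 0}"
    proof -
      have "{y. (d K - d K') + (g K - g K') \<bullet> y = 0} = {y. (g K - g K') \<bullet> y = d K' - d K}" by auto
      then show ?thesis using convex_hyperplane by metis
    qed
    ultimately have "K \<inter> K' \<subseteq> {y. (d K - d K') + (g K - g K') \<bullet> y = 0}"
      using hull by (metis hull_minimal)
    then show ?thesis using x by (auto simp: inner_diff_left)
  qed
  define \<phi> where "\<phi> x = (let K = SOME K. K \<in> \<T> \<and> x \<in> K in d K + g K \<bullet> x)" for x
  have \<phi>: "\<phi> x = d K + g K \<bullet> x" if "K \<in> \<T>" "x \<in> K" for K x
  proof -
    have "(SOME K. K \<in> \<T> \<and> x \<in> K) \<in> \<T> \<and> x \<in> (SOME K. K \<in> \<T> \<and> x \<in> K)"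
      by (rule someI[where x = K]) (use that in blast)
    then show ?thesis unfolding \<phi>_def Let_def using consistent that by blast
  qed
  have "continuous_on (\<Union>K\<in>\<T>. K) \<phi>"
  proof (rule continuous_on_closed_Union[OF finite_mesh])
    fix K assume K: "K \<in> \<T>"
    show "closed K" using compact_element[OF K] compact_imp_closed by blast
    have "continuous_on K (\<lambda>x. d K + g K \<bullet> x)" by (intro continuous_intros)
    then show "continuous_on K \<phi>" using \<phi>[OF K] by (simp cong: continuous_on_cong)
  qed
  then have "\<phi> \<in> P1 \<T>" unfolding P1_def using \<phi> by auto
  moreover have "\<phi> a = f a" if "a \<in> nodes \<T>" for a
    using that \<phi> dg verts_subset unfolding nodes_eq by fastforce
  ultimately show ?thesis by blast
qed

lemma hat_P1: "hat \<T> a \<in> P1 \<T>"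
  and hat_node: "b \<in> nodes \<T> \<Longrightarrow> hat \<T> a b = (if b = a then 1 else 0)"
proof -
  have "hat \<T> a \<in> P1 \<T> \<and> (\<forall>b\<in>nodes \<T>. hat \<T> a b = (if b = a then 1 else 0))"
    unfolding hat_def
    by (rule someI_ex[of "\<lambda>\<phi>. \<phi> \<in> P1 \<T> \<and> (\<forall>b\<in>nodes \<T>. \<phi> b = (if b = a then 1 else 0))"])
      (use ex_P1[of "\<lambda>b. if b = a then 1 else 0"] in blast)
  then show "hat \<T> a \<in> P1 \<T>" "b \<in> nodes \<T> \<Longrightarrow> hat \<T> a b = (if b = a then 1 else 0)" by blast+
qed

lemma nodal_interp_P1: "nodal_interp \<T> f \<in> P1 \<T>"
  unfolding nodal_interp_def[abs_def] by (rule P1_sum[OF finite_nodes hat_P1])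

lemma elgrad_nodal_interp:
  "K \<in> \<T> \<Longrightarrow> elgrad (nodal_interp \<T> f) K = (\<Sum>a\<in>nodes \<T>. f a *\<^sub>R elgrad (hat \<T> a) K)"
  unfolding nodal_interp_def[abs_def] by (rule P1_sum[OF finite_nodes hat_P1])

lemma nodal_interp_node: assumes "b \<in> nodes \<T>" shows "nodal_interp \<T> f b = f b"
proof -
  have "nodal_interp \<T> f b = (\<Sum>a\<in>nodes \<T>. if a = b then f a else 0)"
    unfolding nodal_interp_def by (intro sum.cong) (auto simp: hat_node[OF assms])
  then show ?thesis using assms finite_nodes by simp
qed

lemma nodal_interp_of_P1: "v \<in> P1 \<T> \<Longrightarrow> x \<in> closure \<Omega> \<Longrightarrow> nodal_interp \<T> v x = v x"
  by (rule P1_eqI[OF nodal_interp_P1]) (auto simp: nodal_interp_node)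

text \<open>The preimages of the elements are finitely many closed sets covering the parameter
  interval, so Lipschitz bounds on the pieces combine to one on the whole. The constant depends on
  the mesh, which is harmless since it serves only to dominate difference quotients.\<close>

lemma P1_lipschitz_segment:
  assumes v: "v \<in> P1 \<T>" and seg: "\<And>t. 0 \<le> t \<Longrightarrow> t \<le> 1 \<Longrightarrow> x + t *\<^sub>R (y - x) \<in> closure \<Omega>"
  shows "\<bar>v y - v x\<bar> \<le> (\<Sum>K\<in>\<T>. norm (elgrad v K)) * norm (y - x)"
proof -
  let ?\<Lambda> = "\<Sum>K\<in>\<T>. norm (elgrad v K)"
  define U where "U K = {0..1} \<inter> (\<lambda>t::real. x + t *\<^sub>R (y - x)) -` K" for K
  have le: "norm (elgrad v K) \<le> ?\<Lambda>" if "K \<in> \<T>" for K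
    by (rule member_le_sum[OF that _ finite_mesh]) simp
  have "(?\<Lambda> * norm (y - x))-lipschitz_on {0..1} (\<lambda>t. v (x + t *\<^sub>R (y - x)))"
  proof (rule lipschitz_on_closed_Union[where U = U and I = \<T>])
    fix K assume K: "K \<in> \<T>"
    show "(?\<Lambda> * norm (y - x))-lipschitz_on (U K) (\<lambda>t. v (x + t *\<^sub>R (y - x)))"
    proof (rule lipschitz_onI)
      fix s t assume st: "s \<in> U K" "t \<in> U K"
      have "v (x + s *\<^sub>R (y - x)) - v (x + t *\<^sub>R (y - x)) = elgrad v K \<bullet> ((s - t) *\<^sub>R (y - x))"
        using P1_diff[OF v K, of "x + s *\<^sub>R (y - x)" "x + t *\<^sub>R (y - x)"] st
        by (simp add: U_def algebra_simps)
      also have "\<bar>\<dots>\<bar> \<le> norm (elgrad v K) * (\<bar>s - t\<bar> * norm (y - x))"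
        using Cauchy_Schwarz_ineq2[of "elgrad v K" "(s - t) *\<^sub>R (y - x)"] by simp
      also have "\<dots> \<le> ?\<Lambda> * (\<bar>s - t\<bar> * norm (y - x))" by (intro mult_right_mono le[OF K]) auto
      finally show "dist (v (x + s *\<^sub>R (y - x))) (v (x + t *\<^sub>R (y - x))) \<le> ?\<Lambda> * norm (y - x) * dist s t"
        by (simp add: dist_real_def mult_ac)
    qed (simp add: sum_nonneg)
    show "closed (U K)" unfolding U_def
      by (intro closed_vimage_Int continuous_intros compact_imp_closed[OF compact_element[OF K]])
  next
    show "{0..1} \<subseteq> (\<Union>K\<in>\<T>. U K)"
    proof
      fix t :: real assume "t \<in> {0..1}"
      then have "x + t *\<^sub>R (y - x) \<in> \<Union>\<T>" using seg Union_mesh by simp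
      then show "t \<in> (\<Union>K\<in>\<T>. U K)" using \<open>t \<in> {0..1}\<close> by (auto simp: U_def)
    qed
  qed (use finite_mesh in \<open>auto simp: sum_nonneg\<close>)
  from lipschitz_onD[OF this, of 1 0] show ?thesis by (simp add: dist_real_def)
qed

end

section \<open>Weak gradients of piecewise affine functions\<close>

lemma L2_component:
  fixes G :: "'a::euclidean_space \<Rightarrow> real^'n"
  assumes "G \<in> L2 \<Omega>"
  shows "(\<lambda>x. G x $ i) \<in> borel_measurable (lebesgue_on \<Omega>)" "integrable (lebesgue_on \<Omega>) (\<lambda>x. (G x $ i)\<^sup>2)"
proof -
  have [measurable]: "G \<in> borel_measurable (lebesgue_on \<Omega>)" and G2: "integrable (lebesgue_on \<Omega>) (\<lambda>x. (norm (G x))\<^sup>2)"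
    using assms by (auto simp: L2_def)
  show m [measurable]: "(\<lambda>x. G x $ i) \<in> borel_measurable (lebesgue_on \<Omega>)"
    unfolding cart_eq_inner_axis by measurable
  show "integrable (lebesgue_on \<Omega>) (\<lambda>x. (G x $ i)\<^sup>2)"
    by (rule Bochner_Integration.integrable_bound[OF G2])
      (auto simp: power_mono component_le_norm_cart abs_le_square_iff[symmetric])
qed

lemma test_function_square_integrable:
  fixes \<Omega> :: "'a::euclidean_space set"
  assumes \<Omega>: "open \<Omega>" "bounded \<Omega>" and \<phi>: "test_function \<Omega> \<phi>"
  shows "\<phi> \<in> borel_measurable (lebesgue_on \<Omega>)" "integrable (lebesgue_on \<Omega>) (\<lambda>x. (\<phi> x)\<^sup>2)"
proof -
  have sm: "smooth_on UNIV \<phi>" using \<phi> by (simp add: test_function_def)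
  show m [measurable]: "\<phi> \<in> borel_measurable (lebesgue_on \<Omega>)"
    using continuous_on_subset[OF smooth_on_UNIV_continuous[OF sm] subset_UNIV] \<Omega>(1)
    by (intro continuous_imp_measurable_on_sets_lebesgue) auto
  obtain c where c: "\<And>x. \<bar>\<phi> x\<bar> \<le> c" using test_function_bounds[OF \<phi>] by metis
  interpret finite_measure "lebesgue_on \<Omega>"
    by (rule finite_measure_lebesgue_on_bounded) (use \<Omega> in auto)
  show "integrable (lebesgue_on \<Omega>) (\<lambda>x. (\<phi> x)\<^sup>2)"
  proof (rule integrable_const_bound[of _ "c\<^sup>2"])
    have "(\<phi> x)\<^sup>2 \<le> c\<^sup>2" for x
      using c[of x] by (metis abs_ge_zero power2_abs power_mono)
    then show "AE x in lebesgue_on \<Omega>. norm ((\<phi> x)\<^sup>2) \<le> c\<^sup>2" by simp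
  qed measurable
qed

text \<open>Componentwise, the difference of the two gradients is orthogonal to all test functions.
  This makes the chosen representative \<open>grad\<close> computable for discrete
  functions.\<close>

lemma weak_grad_unique:
  fixes \<Omega> :: "(real^'n) set"
  assumes \<Omega>: "open \<Omega>" "bounded \<Omega>" and G: "G \<in> L2 \<Omega>" "has_weak_grad \<Omega> v G"
    and G': "G' \<in> L2 \<Omega>" "has_weak_grad \<Omega> v G'"
  shows "AE x in lebesgue_on \<Omega>. G x = G' x"
proof -
  have "AE x in lebesgue_on \<Omega>. G x $ i - G' x $ i = 0" for i
  proof (rule AE_zero_if_test_functions[OF \<Omega>])
    note [measurable] = L2_component(1)[OF G(1)] L2_component(1)[OF G'(1)]
    show "(\<lambda>x. G x $ i - G' x $ i) \<in> borel_measurable (lebesgue_on \<Omega>)" by measurable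
    show "integrable (lebesgue_on \<Omega>) (\<lambda>x. (G x $ i - G' x $ i)\<^sup>2)"
      by (intro integrable_diff_square L2_component G G')
    fix \<eta> assume \<eta>: "test_function \<Omega> \<eta>"
    have "integrable (lebesgue_on \<Omega>) (\<lambda>x. G x $ i * \<eta> x)" "integrable (lebesgue_on \<Omega>) (\<lambda>x. G' x $ i * \<eta> x)"
      by (intro integrable_mult_if_squares L2_component G G' test_function_square_integrable[OF \<Omega> \<eta>])+
    then have "(LINT x|lebesgue_on \<Omega>. (G x $ i - G' x $ i) * \<eta> x)
       = (LINT x|lebesgue_on \<Omega>. G x $ i * \<eta> x) - (LINT x|lebesgue_on \<Omega>. G' x $ i * \<eta> x)"
      by (simp add: left_diff_distrib)
    also have "\<dots> = 0"
    proof -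
      have "(LINT x|lebesgue_on \<Omega>. v x * frechet_derivative \<eta> (at x) (axis i 1)) = - (LINT x|lebesgue_on \<Omega>. G x $ i * \<eta> x)"
        using G(2) \<eta> unfolding has_weak_grad_def by blast
      moreover have "(LINT x|lebesgue_on \<Omega>. v x * frechet_derivative \<eta> (at x) (axis i 1)) = - (LINT x|lebesgue_on \<Omega>. G' x $ i * \<eta> x)"
        using G'(2) \<eta> unfolding has_weak_grad_def by blast
      ultimately show ?thesis by linarith
    qed
    finally show "(LINT x|lebesgue_on \<Omega>. (G x $ i - G' x $ i) * \<eta> x) = 0" .
  qed
  then have "AE x in lebesgue_on \<Omega>. \<forall>i\<in>UNIV. G x $ i - G' x $ i = 0"
    by (intro AE_finite_allI) auto
  then show ?thesis by eventually_elim (simp add: vec_eq_iff)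
qed

text \<open>The product is continuous on \<Omega> and zero off K, and the open sets \<Omega> and the
  complement of K cover the space. Arbitrary values of v outside \<Omega> thereby become
  harmless.\<close>

lemma continuous_on_UNIV_mult_compact_support:
  fixes v g :: "'a::euclidean_space \<Rightarrow> real"
  assumes "open \<Omega>" "continuous_on \<Omega> v" "continuous_on UNIV g" "compact K" "K \<subseteq> \<Omega>" "\<And>x. x \<notin> K \<Longrightarrow> g x = 0"
  shows "continuous_on UNIV (\<lambda>x. v x * g x)" "integrable lborel (\<lambda>x. v x * g x)"
    "(LINT x|lebesgue_on \<Omega>. v x * g x) = (LINT x|lborel. v x * g x)"
proof -
  have oK: "open (- K)" using assms(4) by (simp add: compact_imp_closed open_Compl)
  have "continuous_on \<Omega> (\<lambda>x. v x * g x)"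
    using assms(2,3) by (auto intro!: continuous_intros intro: continuous_on_subset)
  moreover have "continuous_on (- K) (\<lambda>x. v x * g x) \<longleftrightarrow> continuous_on (- K) (\<lambda>x. 0 :: real)"
    by (rule continuous_on_cong) (use assms(6) in auto)
  ultimately have "continuous_on (\<Omega> \<union> - K) (\<lambda>x. v x * g x)"
    using assms(1) oK by (intro continuous_on_open_Un) auto
  moreover have "\<Omega> \<union> - K = UNIV" using assms(5) by blast
  ultimately show c: "continuous_on UNIV (\<lambda>x. v x * g x)" by simp
  have "integrable lborel (\<lambda>x. indicator K x *\<^sub>R (v x * g x))"
    using borel_integrable_compact[OF assms(4) continuous_on_subset[OF c]] by simp
  moreover have "(\<lambda>x. indicator K x *\<^sub>R (v x * g x)) = (\<lambda>x. v x * g x)"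
    using assms(6) by (auto split: split_indicator)
  ultimately show "integrable lborel (\<lambda>x. v x * g x)" by simp
  have "(LINT x|lebesgue_on \<Omega>. v x * g x) = (LINT x:\<Omega>|lborel. v x * g x)"
    by (rule integral_lebesgue_on_borel) (use c assms(1) borel_measurable_continuous_onI in auto)
  also have "\<dots> = (LINT x|lborel. v x * g x)"
    unfolding set_lebesgue_integral_def
    by (intro Bochner_Integration.integral_cong) (use assms(5,6) in \<open>auto split: split_indicator\<close>)
  finally show "(LINT x|lebesgue_on \<Omega>. v x * g x) = (LINT x|lborel. v x * g x)" .
qed

context fe_mesh
begin

text \<open>The value on the element frontiers is 0, which matters only on a null set; as a finite
  sum over open sets the function is Borel on the whole space.\<close>

definition pgrad :: "(real^'n \<Rightarrow> real) \<Rightarrow> real^'n \<Rightarrow> real^'n" where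
  "pgrad v x = (\<Sum>K\<in>\<T>. indicator (interior K) x *\<^sub>R elgrad v K)"

lemma pgrad_interior:
  assumes "K \<in> \<T>" "x \<in> interior K" shows "pgrad v x = elgrad v K"
proof -
  have "pgrad v x = indicator (interior K) x *\<^sub>R elgrad v K + (\<Sum>K\<in>\<T>-{K}. indicator (interior K) x *\<^sub>R elgrad v K)"
    unfolding pgrad_def by (rule sum.remove[OF finite_mesh assms(1)])
  also have "(\<Sum>K\<in>\<T>-{K}. indicator (interior K) x *\<^sub>R elgrad v K) = 0"
  proof (intro sum.neutral ballI)
    fix K' assume "K' \<in> \<T> - {K}"
    then have "interior K \<inter> interior K' = {}" using interior_disjoint[OF assms(1)] by blast
    then show "indicator (interior K') x *\<^sub>R elgrad v K' = 0" using assms(2) by (auto simp: indicator_def)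
  qed
  finally show ?thesis using assms(2) by simp
qed

lemma pgrad_measurable [measurable]: "pgrad v \<in> borel_measurable borel"
  unfolding pgrad_def[abs_def] by (intro borel_measurable_sum borel_measurable_scaleR borel_measurable_indicator) auto

lemma norm_pgrad_le: "norm (pgrad v x) \<le> (\<Sum>K\<in>\<T>. norm (elgrad v K))"
  unfolding pgrad_def by (intro sum_norm_le) (auto split: split_indicator)

lemma AE_interior: "AE x in lebesgue. x \<in> \<Omega> \<longrightarrow> (\<exists>K\<in>\<T>. x \<in> interior K)"
  using domain_AE_interiors
proof eventually_elim
  case (elim x)
  show ?case
  proof (rule impI, rule ccontr)
    assume x: "x \<in> \<Omega>" "\<not> (\<exists>K\<in>\<T>. x \<in> interior K)"
    then have "(\<Sum>K\<in>\<T>. indicator (interior K) x :: real) = 0" by (intro sum.neutral) auto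
    then show False using elim x(1) by simp
  qed
qed

lemma domain_sets: "\<Omega> \<in> sets borel" "\<Omega> \<in> sets lebesgue"
  using open_domain by auto

lemma AE_interior_on: "AE x in lebesgue_on \<Omega>. \<exists>K\<in>\<T>. x \<in> interior K"
  using AE_interior by (subst AE_restrict_space_iff) (auto simp: domain_sets)

lemma P1_continuous: "v \<in> P1 \<T> \<Longrightarrow> continuous_on (closure \<Omega>) v"
  unfolding P1_def Union_mesh by blast

lemma P1_bounded:
  assumes "v \<in> P1 \<T>"
  obtains b where "b \<ge> 0" "\<And>x. x \<in> closure \<Omega> \<Longrightarrow> \<bar>v x\<bar> \<le> b"
proof -
  have "compact (closure \<Omega>)" using bounded_domain by simp
  then have "bounded (v ` closure \<Omega>)"
    using compact_imp_bounded compact_continuous_image P1_continuous[OF assms] by blast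
  then obtain c where "\<forall>x\<in>closure \<Omega>. \<bar>v x\<bar> \<le> c" by (auto simp: bounded_iff)
  then show thesis using that[of "\<bar>c\<bar>"] by force
qed

lemma finite_measure_domain: "finite_measure (lebesgue_on \<Omega>)"
  using finite_measure_lebesgue_on_bounded bounded_domain domain_sets by blast

lemma P1_measurable:
  assumes "v \<in> P1 \<T>" shows "v \<in> borel_measurable (lebesgue_on \<Omega>)"
  using continuous_on_subset[OF P1_continuous[OF assms] closure_subset] domain_sets
  by (intro continuous_imp_measurable_on_sets_lebesgue) auto

lemma P1_L2:
  assumes "v \<in> P1 \<T>" shows "v \<in> L2 \<Omega>"
proof -
  obtain c where c: "c \<ge> 0" "\<And>x. x \<in> closure \<Omega> \<Longrightarrow> \<bar>v x\<bar> \<le> c" using P1_bounded[OF assms] by blast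
  note [measurable] = P1_measurable[OF assms]
  interpret finite_measure "lebesgue_on \<Omega>" by (rule finite_measure_domain)
  have "integrable (lebesgue_on \<Omega>) (\<lambda>x. (norm (v x))\<^sup>2)"
  proof (rule integrable_const_bound[of _ "c\<^sup>2"])
    show "AE x in lebesgue_on \<Omega>. norm ((norm (v x))\<^sup>2) \<le> c\<^sup>2"
    proof (rule AE_I2)
      fix x assume "x \<in> space (lebesgue_on \<Omega>)"
      then have "\<bar>v x\<bar> \<le> c" using c(2) closure_subset by auto
      then show "norm ((norm (v x))\<^sup>2) \<le> c\<^sup>2" using c(1) by (simp add: abs_le_square_iff[symmetric])
    qed
  qed measurable
  then show ?thesis by (simp add: L2_def P1_measurable[OF assms])
qed

lemma pgrad_L2: "pgrad v \<in> L2 \<Omega>"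
proof -
  have m: "pgrad v \<in> borel_measurable (lebesgue_on \<Omega>)"
    by (intro measurable_restrict_space1 measurable_completion) simp
  note [measurable] = m
  interpret finite_measure "lebesgue_on \<Omega>" by (rule finite_measure_domain)
  have "integrable (lebesgue_on \<Omega>) (\<lambda>x. (norm (pgrad v x))\<^sup>2)"
    by (rule integrable_const_bound[of _ "(\<Sum>K\<in>\<T>. norm (elgrad v K))\<^sup>2"])
      (use norm_pgrad_le in \<open>auto intro!: power_mono\<close>)
  then show ?thesis by (simp add: L2_def m)
qed

text \<open>Difference quotients of \<open>v \<phi>\<close> have integral \<open>0\<close>, are bounded because \<open>v\<close> is Lipschitz along
  segments in the domain, and converge in the interior of every element.\<close>

lemma P1_has_weak_grad:
  assumes v: "v \<in> P1 \<T>"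
  shows "has_weak_grad \<Omega> v (pgrad v)"
  unfolding has_weak_grad_def
proof (intro allI impI)
  fix \<phi> and i :: 'n
  assume \<phi>: "test_function \<Omega> \<phi>"
  obtain K0 where K0: "compact K0" "K0 \<subseteq> \<Omega>" "\<And>x. x \<notin> K0 \<Longrightarrow> \<phi> x = 0" and sm: "smooth_on UNIV \<phi>"
    using \<phi> unfolding test_function_def by blast
  define e :: "real^'n" where "e = axis i 1"
  have ne: "norm e = 1" by (simp add: e_def)
  define D\<phi> where "D\<phi> x = frechet_derivative \<phi> (at x) e" for x
  obtain b where b: "\<And>x. \<bar>\<phi> x\<bar> \<le> b" "\<And>x. \<bar>D\<phi> x\<bar> \<le> b" "b \<ge> 0"
    unfolding D\<phi>_def using test_function_bounds[OF \<phi>] by metis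
  obtain V where V: "V \<ge> 0" "\<And>x. x \<in> closure \<Omega> \<Longrightarrow> \<bar>v x\<bar> \<le> V" using P1_bounded[OF v] by blast
  define \<Lambda> where "\<Lambda> = (\<Sum>K\<in>\<T>. norm (elgrad v K))"
  have \<Lambda>0: "\<Lambda> \<ge> 0" by (simp add: \<Lambda>_def sum_nonneg)
  obtain \<delta> where \<delta>: "\<delta> > 0" "(\<Union>x\<in>K0. cball x \<delta>) \<subseteq> \<Omega>"
    using compact_subset_open_imp_cball_epsilon_subset[OF K0(1) open_domain K0(2)] by blast
  have D\<phi>0: "D\<phi> x = 0" if "x \<notin> K0" for x
    unfolding D\<phi>_def by (rule frechet_derivative_outside_support[OF K0(1,3) that])
  have line: "((\<lambda>s. \<phi> (x + s *\<^sub>R e)) has_real_derivative D\<phi> (x + s *\<^sub>R e)) (at s)" for x s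
  proof -
    interpret linear "frechet_derivative \<phi> (at (x + s *\<^sub>R e))"
      using smooth_on_UNIV_has_derivative[OF sm] has_derivative_linear by blast
    show ?thesis using smooth_on_line_has_derivative[OF sm, of x "- e" s] by (simp add: D\<phi>_def neg)
  qed
  have lip: "\<bar>\<phi> (x + t *\<^sub>R e) - \<phi> x\<bar> \<le> b * \<bar>t\<bar>" for x t
  proof -
    have "norm (\<phi> (x + t *\<^sub>R e) - \<phi> (x + 0 *\<^sub>R e)) \<le> b * norm (t - 0)"
      by (rule field_differentiable_bound[where S = UNIV, OF _ DERIV_subset[OF line]]) (use b in auto)
    then show ?thesis by simp
  qed
  have cv: "continuous_on \<Omega> v" using P1_continuous[OF v] closure_subset continuous_on_subset by blast
  have cD: "continuous_on UNIV D\<phi>"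
    unfolding D\<phi>_def by (rule smooth_on_UNIV_continuous_derivative[OF sm])
  note F = continuous_on_UNIV_mult_compact_support[OF open_domain cv smooth_on_UNIV_continuous[OF sm] K0]
  note H = continuous_on_UNIV_mult_compact_support[OF open_domain cv cD K0(1,2) D\<phi>0]
  define f where "f x = v x * \<phi> x" for x
  have fm [measurable]: "f \<in> borel_measurable borel" unfolding f_def using F(1) borel_measurable_continuous_onI by blast
  have [measurable]: "\<phi> \<in> borel_measurable borel"
    using smooth_on_UNIV_continuous[OF sm] borel_measurable_continuous_onI by blast
  have Hm [measurable]: "(\<lambda>x. v x * D\<phi> x) \<in> borel_measurable borel" using H(1) borel_measurable_continuous_onI by blast
  have pm [measurable]: "(\<lambda>x. pgrad v x $ i) \<in> borel_measurable borel"
    unfolding cart_eq_inner_axis by measurable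
  \<comment> \<open>The steps never exceed \<delta>, the distance reserved around the support: if
    one end point lies in the support, the whole segment stays in \<Omega>, where v is Lipschitz
    along it.\<close>
  define t where "t n = \<delta> / real (Suc n)" for n
  have t: "t n > 0" "t n \<le> \<delta>" for n using \<delta>(1) by (auto simp: t_def divide_simps)
  have t0: "t \<longlonglongrightarrow> 0"
    using LIMSEQ_Suc[OF lim_const_over_n[of \<delta>]] by (simp add: t_def[abs_def])
  obtain R0 where R0: "\<And>x. x \<in> K0 \<Longrightarrow> norm x \<le> R0"
    using compact_imp_bounded[OF K0(1)] by (auto simp: bounded_iff)
  define M where "M = \<Lambda> * b + V * b"
  have M0: "M \<ge> 0" using \<Lambda>0 b(3) V(1) by (simp add: M_def)
  have near: "y \<in> \<Omega>" if "x \<in> K0" "dist x y \<le> \<delta>" for x y using \<delta>(2) that by (auto simp: subset_eq)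
  have bd: "\<bar>(f (x + t n *\<^sub>R e) - f x) / t n\<bar> \<le> M * indicator (cball 0 (R0 + \<delta>)) x" for n x
  proof (cases "x \<in> K0 \<or> x + t n *\<^sub>R e \<in> K0")
    case False
    then show ?thesis using K0(3) M0 by (simp add: f_def)
  next
    case True
    have seg: "x + s *\<^sub>R e \<in> \<Omega>" if s: "0 \<le> s" "s \<le> t n" for s
    proof -
      have "dist x (x + s *\<^sub>R e) \<le> \<delta>" "dist (x + t n *\<^sub>R e) (x + s *\<^sub>R e) \<le> \<delta>"
        using s t[of n] ne by (auto simp: dist_norm scaleR_left_diff_distrib[symmetric])
      then show ?thesis using True near by blast
    qed
    have "norm x \<le> R0 + \<delta>"
    proof -
      have "norm x \<le> norm (x + t n *\<^sub>R e) + norm (t n *\<^sub>R e)" by (metis add_diff_cancel norm_triangle_ineq4)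
      then show ?thesis using True R0[of x] R0[of "x + t n *\<^sub>R e"] t[of n] ne \<delta>(1) by auto
    qed
    moreover have "\<bar>f (x + t n *\<^sub>R e) - f x\<bar> \<le> M * t n"
    proof -
      have "x + r *\<^sub>R (x + t n *\<^sub>R e - x) \<in> closure \<Omega>" if "0 \<le> r" "r \<le> 1" for r
        using seg[of "r * t n"] that t(1)[of n] closure_subset by (auto simp: mult_left_le_one_le)
      from P1_lipschitz_segment[OF v this]
      have 1: "\<bar>v (x + t n *\<^sub>R e) - v x\<bar> \<le> \<Lambda> * t n" using t(1)[of n] ne by (simp add: \<Lambda>_def)
      have "x \<in> \<Omega>" using seg[of 0] t(1)[of n] by simp
      then have 2: "\<bar>v x\<bar> \<le> V" using V(2) closure_subset by blast
      have "f (x + t n *\<^sub>R e) - f x = (v (x + t n *\<^sub>R e) - v x) * \<phi> (x + t n *\<^sub>R e) + v x * (\<phi> (x + t n *\<^sub>R e) - \<phi> x)"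
        by (simp add: f_def algebra_simps)
      also have "\<bar>\<dots>\<bar> \<le> \<bar>v (x + t n *\<^sub>R e) - v x\<bar> * \<bar>\<phi> (x + t n *\<^sub>R e)\<bar> + \<bar>v x\<bar> * \<bar>\<phi> (x + t n *\<^sub>R e) - \<phi> x\<bar>"
        by (simp add: abs_mult[symmetric] abs_triangle_ineq)
      also have "\<dots> \<le> (\<Lambda> * t n) * b + V * (b * t n)"
        using 1 2 b lip[of x "t n"] t(1)[of n] V(1) \<Lambda>0 by (intro add_mono mult_mono) auto
      finally show ?thesis by (simp add: M_def algebra_simps)
    qed
    ultimately show ?thesis using t(1)[of n] by (simp add: divide_simps)
  qed
  have lim: "AE x in lborel. (\<lambda>n. (f (x + t n *\<^sub>R e) - f x) / t n) \<longlonglongrightarrow> pgrad v x $ i * \<phi> x + v x * D\<phi> x"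
    using AE_interior unfolding AE_completion_iff
  proof eventually_elim
    case (elim x)
    show ?case
    proof (cases "x \<in> \<Omega>")
      case False
      then have "x \<notin> K0" using K0(2) by blast
      moreover have "x + t n *\<^sub>R e \<notin> K0" for n
        using near[of "x + t n *\<^sub>R e" x] False t[of n] ne by (auto simp: dist_norm)
      ultimately show ?thesis using K0(3) D\<phi>0 by (simp add: f_def)
    next
      case True
      then obtain K where K: "K \<in> \<T>" "x \<in> interior K" using elim by blast
      have lx: "(\<lambda>n. x + t n *\<^sub>R e) \<longlonglongrightarrow> x + 0 *\<^sub>R e" by (intro tendsto_intros t0)
      then have "\<forall>\<^sub>F n in sequentially. x + t n *\<^sub>R e \<in> interior K"
        using topological_tendstoD[OF lx open_interior[of K]] K(2) by simp
      then have ev: "\<forall>\<^sub>F n in sequentially. (elgrad v K \<bullet> e) * \<phi> (x + t n *\<^sub>R e) + v x * ((\<phi> (x + t n *\<^sub>R e) - \<phi> x) / t n)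
          = (f (x + t n *\<^sub>R e) - f x) / t n"
      proof eventually_elim
        case (elim n)
        have "v (x + t n *\<^sub>R e) - v x = t n * (elgrad v K \<bullet> e)"
          using P1_diff[OF v K(1), of "x + t n *\<^sub>R e" x] elim K(2) interior_subset by fastforce
        moreover have "f (x + t n *\<^sub>R e) - f x = (v (x + t n *\<^sub>R e) - v x) * \<phi> (x + t n *\<^sub>R e) + v x * (\<phi> (x + t n *\<^sub>R e) - \<phi> x)"
          by (simp add: f_def algebra_simps)
        ultimately show ?case using t(1)[of n] by (simp add: add_divide_distrib)
      qed
      have dl: "((\<lambda>s. (\<phi> (x + s *\<^sub>R e) - \<phi> x) / s) \<longlongrightarrow> D\<phi> x) (at 0)"
        using line[of x 0] unfolding DERIV_def by simp
      have "filterlim t (at 0) sequentially"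
        unfolding filterlim_at using t0 less_imp_neq[OF t(1)] by (auto intro!: always_eventually)
      from filterlim_compose[OF dl this]
      have l1: "(\<lambda>n. (\<phi> (x + t n *\<^sub>R e) - \<phi> x) / t n) \<longlonglongrightarrow> D\<phi> x" .
      have l2: "(\<lambda>n. \<phi> (x + t n *\<^sub>R e)) \<longlonglongrightarrow> \<phi> x"
        using isCont_tendsto_compose[OF _ lx, of \<phi>] smooth_on_UNIV_continuous[OF sm]
        by (simp add: continuous_on_eq_continuous_at)
      have "(\<lambda>n. (elgrad v K \<bullet> e) * \<phi> (x + t n *\<^sub>R e) + v x * ((\<phi> (x + t n *\<^sub>R e) - \<phi> x) / t n))
          \<longlonglongrightarrow> (elgrad v K \<bullet> e) * \<phi> x + v x * D\<phi> x"
        by (intro tendsto_intros l1 l2)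
      from Lim_transform_eventually[OF this ev]
      show ?thesis using pgrad_interior[OF K, of v] by (simp add: e_def cart_eq_inner_axis)
    qed
  qed
  have fi: "integrable lborel f" unfolding f_def by (rule F(2))
  have lim_int: "(\<lambda>n. LINT x|lborel. (f (x + t n *\<^sub>R e) - f x) / t n) \<longlonglongrightarrow> (LINT x|lborel. pgrad v x $ i * \<phi> x + v x * D\<phi> x)"
  proof (rule integral_dominated_convergence[OF _ _ _ lim])
    show "integrable lborel (\<lambda>x::real^'n. M * indicator (cball 0 (R0 + \<delta>)) x :: real)"
      using emeasure_bounded_finite[of "cball (0::real^'n) (R0 + \<delta>)"]
      by (intro integrable_mult_right integrable_real_indicator) auto
    show "AE x in lborel. norm ((f (x + t n *\<^sub>R e) - f x) / t n) \<le> M * indicator (cball 0 (R0 + \<delta>)) x" for n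
      using bd by (intro AE_I2) simp
  qed measurable
  have zero: "(LINT x|lborel. (f (x + t n *\<^sub>R e) - f x) / t n) = 0" for n
  proof -
    have "integrable lborel (\<lambda>x. f (x + t n *\<^sub>R e))"
      using lborel_integrable_translate[of f "t n *\<^sub>R e"] fi by simp
    then have "(LINT x|lborel. (f (x + t n *\<^sub>R e) - f x) / t n)
        = ((LINT x|lborel. f (x + t n *\<^sub>R e)) - (LINT x|lborel. f x)) / t n"
      using fi by simp
    then show ?thesis using lborel_integral_translate[of f "t n *\<^sub>R e"] by simp
  qed
  have "(LINT x|lborel. pgrad v x $ i * \<phi> x + v x * D\<phi> x) = 0"
    by (rule LIMSEQ_unique[OF lim_int[unfolded zero] tendsto_const])
  moreover have pi: "integrable lborel (\<lambda>x. pgrad v x $ i * \<phi> x)"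
  proof -
    have "integrable lborel (\<lambda>x. 1 * \<phi> x)"
      by (rule continuous_on_UNIV_mult_compact_support[OF open_domain continuous_on_const smooth_on_UNIV_continuous[OF sm] K0])
    moreover have "\<bar>pgrad v x $ i\<bar> \<le> \<Lambda>" for x
      using component_le_norm_cart[of "pgrad v x" i] norm_pgrad_le[of v x] by (simp add: \<Lambda>_def)
    ultimately have "integrable lborel (\<lambda>x. \<phi> x * pgrad v x $ i)"
      using integrable_mult_bounded[of lborel \<phi> "\<lambda>x. pgrad v x $ i" \<Lambda>] by simp
    then show ?thesis by (simp add: mult.commute)
  qed
  ultimately have 1: "(LINT x|lborel. v x * D\<phi> x) = - (LINT x|lborel. pgrad v x $ i * \<phi> x)"
    using H(2) by simp
  have "(LINT x|lebesgue_on \<Omega>. pgrad v x $ i * \<phi> x) = (LINT x:\<Omega>|lborel. pgrad v x $ i * \<phi> x)"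
    by (rule integral_lebesgue_on_borel) (use domain_sets in auto)
  also have "\<dots> = (LINT x|lborel. pgrad v x $ i * \<phi> x)"
    unfolding set_lebesgue_integral_def
    by (intro Bochner_Integration.integral_cong) (use K0 in \<open>auto split: split_indicator\<close>)
  finally show "(LINT x|lebesgue_on \<Omega>. v x * frechet_derivative \<phi> (at x) (axis i 1)) =
      - (LINT x|lebesgue_on \<Omega>. pgrad v x $ i * \<phi> x)"
    using 1 H(3) by (simp add: D\<phi>_def e_def)
qed

lemma P1_grad:
  assumes v: "v \<in> P1 \<T>"
  shows "AE x in lebesgue_on \<Omega>. grad \<Omega> v x = pgrad v x"
proof -
  have "grad \<Omega> v \<in> L2 \<Omega> \<and> has_weak_grad \<Omega> v (grad \<Omega> v)"
    unfolding grad_def by (rule someI[where x = "pgrad v"]) (use pgrad_L2 P1_has_weak_grad[OF v] in blast)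
  then show ?thesis
    using weak_grad_unique[OF open_domain bounded_domain _ _ pgrad_L2 P1_has_weak_grad[OF v]] by blast
qed

end

section \<open>Elementwise integrals, inverse estimates and finite overlap\<close>

lemma card_disjoint_balls_le:
  fixes z :: "'i \<Rightarrow> real^'n"
  assumes "finite I" "r > 0" "R > 0" and sub: "\<And>i. i \<in> I \<Longrightarrow> ball (z i) r \<subseteq> ball x R"
    and disj: "\<And>i j. i \<in> I \<Longrightarrow> j \<in> I \<Longrightarrow> i \<noteq> j \<Longrightarrow> ball (z i) r \<inter> ball (z j) r = {}"
  shows "real (card I) \<le> (R / r) ^ CARD('n)"
proof -
  let ?u = "unit_ball_vol (real CARD('n))"
  have "measure lborel (\<Union>i\<in>I. ball (z i) r) = (\<Sum>i\<in>I. measure lborel (ball (z i) r))"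
    by (rule measure_UNION'[OF assms(1)])
      (use emeasure_bounded_finite[OF bounded_ball] disj in \<open>auto simp: fmeasurable_def pairwise_def disjnt_def\<close>)
  also have "\<dots> = real (card I) * (?u * r ^ CARD('n))" using assms(2) by (simp add: content_ball)
  finally have "real (card I) * (?u * r ^ CARD('n)) = measure lborel (\<Union>i\<in>I. ball (z i) r)" ..
  also have "\<dots> \<le> measure lborel (ball x R)"
    by (rule measure_mono_fmeasurable)
      (use sub emeasure_bounded_finite[of "ball x R"] in \<open>auto simp: fmeasurable_def intro!: borel_open open_UN\<close>)
  also have "\<dots> = ?u * R ^ CARD('n)" using assms(3) by (simp add: content_ball)
  finally have "?u * (real (card I) * r ^ CARD('n)) \<le> ?u * R ^ CARD('n)" by (simp add: mult_ac)
  then have "real (card I) * r ^ CARD('n) \<le> R ^ CARD('n)" by simp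
  then show ?thesis using assms(2) by (simp add: power_divide pos_le_divide_eq)
qed

text \<open>The weight is split into two square roots and the double sum is read as one sum over
  pairs, which reduces the claim to the inequality for finite sums of reals.\<close>

lemma weighted_sum_cauchy_schwarz:
  fixes G H :: "'k \<Rightarrow> 'i \<Rightarrow> 'a::real_inner"
  assumes "\<And>K. K \<in> T \<Longrightarrow> A K \<ge> 0"
  shows "\<bar>\<Sum>K\<in>T. A K * (\<Sum>i\<in>I. G K i \<bullet> H K i)\<bar>
    \<le> sqrt (\<Sum>K\<in>T. A K * (\<Sum>i\<in>I. (norm (G K i))\<^sup>2)) * sqrt (\<Sum>K\<in>T. A K * (\<Sum>i\<in>I. (norm (H K i))\<^sup>2))"
proof -
  let ?g = "\<lambda>(K, i). sqrt (A K) * norm (G K i)" and ?h = "\<lambda>(K, i). sqrt (A K) * norm (H K i)"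
  have "\<bar>\<Sum>K\<in>T. A K * (\<Sum>i\<in>I. G K i \<bullet> H K i)\<bar> \<le> (\<Sum>K\<in>T. \<Sum>i\<in>I. \<bar>A K * (G K i \<bullet> H K i)\<bar>)"
    unfolding sum_distrib_left by (intro order_trans[OF sum_abs] sum_mono sum_abs)
  also have "\<dots> \<le> (\<Sum>K\<in>T. \<Sum>i\<in>I. A K * (norm (G K i) * norm (H K i)))"
    using assms Cauchy_Schwarz_ineq2 by (intro sum_mono) (auto simp: abs_mult intro!: mult_left_mono)
  also have "\<dots> = (\<Sum>K\<in>T. \<Sum>i\<in>I. (sqrt (A K) * norm (G K i)) * (sqrt (A K) * norm (H K i)))"
    using assms by (intro sum.cong refl) (simp add: mult_ac flip: mult.assoc[of "sqrt _" "sqrt _"])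
  also have "\<dots> = (\<Sum>x\<in>T \<times> I. ?g x * ?h x)" by (simp add: sum.cartesian_product case_prod_unfold)
  also have "\<dots> \<le> sqrt ((\<Sum>x\<in>T \<times> I. (?g x)\<^sup>2) * (\<Sum>x\<in>T \<times> I. (?h x)\<^sup>2))"
    by (intro real_le_rsqrt Cauchy_Schwarz_ineq_sum)
  also have "(\<Sum>x\<in>T \<times> I. (?g x)\<^sup>2) = (\<Sum>K\<in>T. A K * (\<Sum>i\<in>I. (norm (G K i))\<^sup>2))"
    using assms by (simp add: sum.cartesian_product' case_prod_unfold power_mult_distrib sum_distrib_left)
  also have "(\<Sum>x\<in>T \<times> I. (?h x)\<^sup>2) = (\<Sum>K\<in>T. A K * (\<Sum>i\<in>I. (norm (H K i))\<^sup>2))"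
    using assms by (simp add: sum.cartesian_product' case_prod_unfold power_mult_distrib sum_distrib_left)
  finally show ?thesis by (simp add: real_sqrt_mult)
qed

context fe_mesh
begin

definition area :: "(real^'n) set \<Rightarrow> real" where
  "area K = measure lebesgue (interior K)"

lemma lmeasurable_interior: "K \<in> \<T> \<Longrightarrow> interior K \<in> lmeasurable"
  using compact_element compact_imp_bounded by (intro lmeasurable_open) (auto intro: bounded_interior)

lemma area_pos: assumes "K \<in> \<T>" shows "area K > 0"
proof -
  obtain z where "cball z (c * h) \<subseteq> K" using ex_inball[OF assms] by blast
  then have "interior (cball z (c * h)) \<subseteq> interior K" by (rule interior_mono)
  then have "ball z (c * h) \<subseteq> interior K" by simp
  then have "interior K \<noteq> {}" using ch_pos by force
  then show ?thesis unfolding area_def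
    using lmeasurable_interior[OF assms] open_interior[of K] open_not_negligible[of "interior K"]
    by (metis measure_nonneg negligible_iff_measure order_le_less)
qed

lemma measure_lebesgue_on_interior:
  assumes "K \<in> \<T>"
  shows "finite_measure (lebesgue_on (interior K))" "(LINT x|lebesgue_on (interior K). k) = area K * k"
proof -
  show "finite_measure (lebesgue_on (interior K))"
    using compact_element[OF assms] by (intro finite_measure_lebesgue_on_bounded) (auto simp: compact_imp_bounded bounded_interior)
  have "measure (lebesgue_on (interior K)) (interior K) = area K"
    by (simp add: measure_restrict_space area_def)
  then show "(LINT x|lebesgue_on (interior K). k) = area K * k" by simp
qed

lemma grad_vec_pgrad:
  fixes u :: "real^'n \<Rightarrow> real^'m"
  assumes "u \<in> P1_vec \<T>"
  shows "AE x in lebesgue_on \<Omega>. \<forall>i. grad_vec \<Omega> u x $ i = pgrad (\<lambda>y. u y $ i) x"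
proof -
  have "AE x in lebesgue_on \<Omega>. \<forall>i\<in>UNIV. grad \<Omega> (\<lambda>y. u y $ i) x = pgrad (\<lambda>y. u y $ i) x"
    using assms P1_grad by (intro AE_finite_allI) (auto simp: P1_vec_def)
  then show ?thesis by eventually_elim (simp add: grad_vec_def)
qed

text \<open>From here on the form (grad u, grad w) is a finite sum of constants. The Cauchy-Schwarz
  estimates and the time derivative of the energy work on this sum instead of on integrals of chosen
  gradients.\<close>

lemma grad_vec_inner:
  fixes u w :: "real^'n \<Rightarrow> real^'m"
  assumes u: "u \<in> P1_vec \<T>" and w: "w \<in> P1_vec \<T>"
  shows "L2_inner \<Omega> (grad_vec \<Omega> u) (grad_vec \<Omega> w)
    = (\<Sum>K\<in>\<T>. area K * (\<Sum>i\<in>UNIV. elgrad (\<lambda>y. u y $ i) K \<bullet> elgrad (\<lambda>y. w y $ i) K))"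
proof -
  define f where "f x = (\<Sum>i\<in>UNIV. pgrad (\<lambda>y. u y $ i) x \<bullet> pgrad (\<lambda>y. w y $ i) x)" for x
  define d where "d K = (\<Sum>i\<in>UNIV. elgrad (\<lambda>y. u y $ i) K \<bullet> elgrad (\<lambda>y. w y $ i) K)" for K
  have fK: "f x = d K" if "K \<in> \<T>" "x \<in> interior K" for K x
    using pgrad_interior[OF that] by (simp add: f_def d_def)
  have "f \<in> borel_measurable borel" unfolding f_def by measurable
  then have fm: "f \<in> borel_measurable (lebesgue_on \<Omega>)"
    by (intro measurable_restrict_space1 measurable_completion) simp
  interpret finite_measure "lebesgue_on \<Omega>" by (rule finite_measure_domain)
  have fi: "integrable (lebesgue_on \<Omega>) f"
  proof (rule integrable_const_bound[OF _ fm])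
    show "AE x in lebesgue_on \<Omega>. norm (f x) \<le> (\<Sum>K\<in>\<T>. \<bar>d K\<bar>)"
      using AE_interior_on
    proof eventually_elim
      case (elim x)
      then obtain K where K: "K \<in> \<T>" "x \<in> interior K" by blast
      then show ?case using fK[OF K] member_le_sum[OF K(1) _ finite_mesh, of "\<lambda>K. \<bar>d K\<bar>"] by simp
    qed
  qed
  have ae: "AE x in lebesgue_on \<Omega>. grad_vec \<Omega> u x \<bullet> grad_vec \<Omega> w x = f x"
    using grad_vec_pgrad[OF u] grad_vec_pgrad[OF w] by eventually_elim (simp add: inner_vec_def[where 'b = 'm] f_def)
  have "L2_inner \<Omega> (grad_vec \<Omega> u) (grad_vec \<Omega> w) = (LINT x|lebesgue_on \<Omega>. f x)"
    unfolding L2_inner_def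
  proof (rule integral_cong_AE[OF _ fm ae])
    have gm: "grad \<Omega> v \<in> borel_measurable (lebesgue_on \<Omega>)" if "v \<in> P1 \<T>" for v
    proof -
      have "\<exists>G. G \<in> L2 \<Omega> \<and> has_weak_grad \<Omega> v G" using pgrad_L2 P1_has_weak_grad[OF that] by blast
      then have "grad \<Omega> v \<in> L2 \<Omega>" unfolding grad_def by (metis (mono_tags, lifting) someI_ex)
      then show ?thesis by (simp add: L2_def)
    qed
    have "(\<lambda>x. \<Sum>i\<in>UNIV. grad \<Omega> (\<lambda>y. u y $ i) x \<bullet> grad \<Omega> (\<lambda>y. w y $ i) x) \<in> borel_measurable (lebesgue_on \<Omega>)"
      using u w by (intro borel_measurable_sum borel_measurable_inner gm) (auto simp: P1_vec_def)
    then show "(\<lambda>x. grad_vec \<Omega> u x \<bullet> grad_vec \<Omega> w x) \<in> borel_measurable (lebesgue_on \<Omega>)"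
      by (simp add: inner_vec_def[where 'b = 'm] grad_vec_def)
  qed
  also have "\<dots> = (\<Sum>K\<in>\<T>. LINT x|lebesgue_on (interior K). f x)" by (rule integral_split_elements[OF fi])
  also have "\<dots> = (\<Sum>K\<in>\<T>. LINT x|lebesgue_on (interior K). d K)"
    by (intro sum.cong Bochner_Integration.integral_cong refl) (auto simp: fK)
  also have "\<dots> = (\<Sum>K\<in>\<T>. area K * d K)" by (intro sum.cong refl measure_lebesgue_on_interior)
  finally show ?thesis by (simp add: d_def)
qed

lemma P1_square_integrable:
  assumes "v \<in> P1 \<T>"
  shows "integrable (lebesgue_on \<Omega>) (\<lambda>x. (v x)\<^sup>2)"
    and "K \<in> \<T> \<Longrightarrow> integrable (lebesgue_on (interior K)) (\<lambda>x. (v x)\<^sup>2)"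
    and "K \<in> \<T> \<Longrightarrow> v \<in> borel_measurable (lebesgue_on (interior K))"
proof -
  show 1: "integrable (lebesgue_on \<Omega>) (\<lambda>x. (v x)\<^sup>2)" using P1_L2[OF assms] by (simp add: L2_def)
  then show "K \<in> \<T> \<Longrightarrow> integrable (lebesgue_on (interior K)) (\<lambda>x. (v x)\<^sup>2)"
    by (rule integral_split_elements(2))
  assume "K \<in> \<T>"
  then have "interior K \<subseteq> closure \<Omega>" using interior_element_subset closure_subset by blast
  then show "v \<in> borel_measurable (lebesgue_on (interior K))"
    using continuous_on_subset[OF P1_continuous[OF assms]] by (intro continuous_imp_measurable_on_sets_lebesgue) auto
qed

text \<open>On the copy of \<open>K\<close> shrunk by the factor \<open>1/4\<close> towards a node where \<open>\<bar>v\<bar>\<close> is maximal,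
  \<open>\<bar>v\<bar>\<close> is at least half of that maximum.\<close>

lemma nodal_value_le_integral:
  assumes v: "v \<in> P1 \<T>" and K: "K \<in> \<T>" and b: "b \<in> verts K"
  shows "area K * (v b)\<^sup>2 \<le> 4 ^ (CARD('n) + 1) * (LINT x|lebesgue_on (interior K). (v x)\<^sup>2)"
proof -
  obtain a where a: "a \<in> verts K" "\<And>b. b \<in> verts K \<Longrightarrow> \<bar>v b\<bar> \<le> \<bar>v a\<bar>"
  proof -
    have fin: "finite ((\<lambda>a. \<bar>v a\<bar>) ` verts K)" using verts_element(2)[OF K] by simp
    then have "Max ((\<lambda>a. \<bar>v a\<bar>) ` verts K) \<in> (\<lambda>a. \<bar>v a\<bar>) ` verts K"
      using verts_nonempty[OF K] by (intro Max_in) auto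
    then obtain a where "a \<in> verts K" "\<bar>v a\<bar> = Max ((\<lambda>a. \<bar>v a\<bar>) ` verts K)" by force
    then show ?thesis using that[of a] Max_ge[OF fin] by simp
  qed
  have vK: "\<bar>v x\<bar> \<le> \<bar>v a\<bar>" if "x \<in> K" for x by (rule P1_abs_le_verts[OF v K that a(2)])
  have aK: "a \<in> K" using a(1) verts_subset[OF K] by blast
  \<comment> \<open>With weight 3/4 at a, the modulus of v on S is at least 3/4 - 1/4 = 1/2 of its
    maximum. The volume factor 4^n and the square of 2 combine to 4^(n+1).\<close>
  define S where "S = (\<lambda>x. (1/4) *\<^sub>R x + (3/4) *\<^sub>R a) ` interior K"
  have mS: "measure lebesgue S = (1/4) ^ CARD('n) * area K"
    unfolding S_def area_def using measure_lebesgue_affine[of "1/4" "(3/4) *\<^sub>R a" "interior K"] by simp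
  have oS: "open S"
  proof -
    have "S = (\<lambda>x. (3/4) *\<^sub>R a + x) ` ((\<lambda>x. (1/4) *\<^sub>R x) ` interior K)"
      by (simp add: S_def image_image add.commute)
    then show ?thesis using open_translation[OF open_scaling[of "1/4" "interior K"]] by simp
  qed
  have SK: "S \<subseteq> K"
  proof
    fix y assume "y \<in> S"
    then obtain x where x: "x \<in> K" "y = (1/4) *\<^sub>R x + (3/4) *\<^sub>R a" using interior_subset by (auto simp: S_def)
    then show "y \<in> K" using convexD[OF convex_element[OF K] x(1) aK, of "1/4" "3/4"] by simp
  qed
  then have SiK: "S \<subseteq> interior K" using oS by (rule interior_maximal)
  have vS: "(v a)\<^sup>2 / 4 \<le> (v y)\<^sup>2" if "y \<in> S" for y
  proof -
    obtain x where x: "x \<in> K" "y = (1/4) *\<^sub>R x + (3/4) *\<^sub>R a" using \<open>y \<in> S\<close> interior_subset unfolding S_def by blast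
    have "v y - v a = elgrad v K \<bullet> (y - a)" "v x - v a = elgrad v K \<bullet> (x - a)"
      using P1_diff[OF v K _ aK] SK that x(1) by blast+
    moreover have "y - a = (1/4) *\<^sub>R (x - a)" by (simp add: x(2) algebra_simps) (simp flip: scaleR_left_distrib)
    ultimately have "v y = v x / 4 + 3 * v a / 4" by simp
    then have "\<bar>v a\<bar> / 2 \<le> \<bar>v y\<bar>" using vK[OF x(1)] by linarith
    then have "(\<bar>v a\<bar> / 2)\<^sup>2 \<le> \<bar>v y\<bar>\<^sup>2" by (intro power_mono) auto
    then show ?thesis by (simp add: power_divide)
  qed
  have Sl: "S \<in> lmeasurable" using oS by (intro fmeasurableI2[OF lmeasurable_interior[OF K] SiK]) auto
  have "(v a)\<^sup>2 / 4 * measure lebesgue S = (LINT x|lebesgue. indicator S x *\<^sub>R ((v a)\<^sup>2 / 4))"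
    by (simp add: mult.commute)
  also have "\<dots> \<le> (LINT x|lebesgue. indicator (interior K) x *\<^sub>R (v x)\<^sup>2)"
  proof (rule integral_mono)
    show "integrable lebesgue (\<lambda>x. indicator S x *\<^sub>R ((v a)\<^sup>2 / 4))"
      using Sl by (auto simp: fmeasurable_def intro!: integrable_mult_left integrable_real_indicator)
    show "integrable lebesgue (\<lambda>x. indicator (interior K) x *\<^sub>R (v x)\<^sup>2)"
      using P1_square_integrable(2)[OF v K] by (subst (asm) integrable_restrict_space) auto
    show "indicator S x *\<^sub>R ((v a)\<^sup>2 / 4) \<le> indicator (interior K) x *\<^sub>R (v x)\<^sup>2" for x
      using vS SiK by (auto split: split_indicator)
  qed
  also have "\<dots> = (LINT x|lebesgue_on (interior K). (v x)\<^sup>2)"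
    by (subst integral_restrict_space) auto
  finally have "area K * (v a)\<^sup>2 \<le> 4 ^ (CARD('n) + 1) * (LINT x|lebesgue_on (interior K). (v x)\<^sup>2)"
    unfolding mS by (simp add: power_divide field_simps)
  moreover have "area K * (v b)\<^sup>2 \<le> area K * (v a)\<^sup>2"
    using a(2)[OF b] area_pos[OF K] by (intro mult_left_mono) (auto simp: abs_le_square_iff[symmetric])
  ultimately show ?thesis by simp
qed

text \<open>The interpolated product is determined by vertex values, whose differences obey the
  discrete product rule (v a - v b) * p a + v b * (p a - p b). Each difference is at most the
  gradient times h, and this h cancels the 1/h of \<open>norm_elgrad_le\<close>. The second bound
  forgoes the splitting and keeps 1/h.\<close>

lemma elgrad_nodal_product_le:
  assumes v: "v \<in> P1 \<T>" and p: "p \<in> P1 \<T>" and K: "K \<in> \<T>"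
    and v1: "\<And>a. a \<in> verts K \<Longrightarrow> \<bar>v a\<bar> \<le> 1" and P: "\<And>a. a \<in> verts K \<Longrightarrow> \<bar>p a\<bar> \<le> P"
  shows "norm (elgrad (nodal_interp \<T> (\<lambda>y. v y * p y)) K) \<le> (norm (elgrad v K) * P + norm (elgrad p K)) / (2 * c)"
    and "norm (elgrad (nodal_interp \<T> (\<lambda>y. v y * p y)) K) \<le> P / (c * h)"
proof -
  let ?w = "nodal_interp \<T> (\<lambda>y. v y * p y)"
  have w: "?w a = v a * p a" if "a \<in> verts K" for a using nodal_interp_node verts_nodes[OF K that] by simp
  have 1: "\<bar>f a - f b\<bar> \<le> norm (elgrad f K) * h" if "f \<in> P1 \<T>" "a \<in> verts K" "b \<in> verts K" for f a b
  proof -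
    have ab: "a \<in> K" "b \<in> K" using that verts_subset[OF K] by auto
    have "\<bar>f a - f b\<bar> \<le> norm (elgrad f K) * norm (a - b)"
      using P1_diff[OF that(1) K ab] Cauchy_Schwarz_ineq2 by metis
    also have "\<dots> \<le> norm (elgrad f K) * h"
      using dist_element_le[OF K ab] by (intro mult_left_mono) (auto simp: dist_norm)
    finally show ?thesis .
  qed
  have "norm (elgrad ?w K) \<le> ((norm (elgrad v K) * P + norm (elgrad p K)) * h) / (2 * (c * h))"
  proof (rule norm_elgrad_le[OF nodal_interp_P1 K])
    fix a b assume ab: "a \<in> verts K" "b \<in> verts K"
    have P0: "P \<ge> 0" using P[OF ab(1)] by linarith
    have "?w a - ?w b = (v a - v b) * p a + v b * (p a - p b)" using w ab by (simp add: algebra_simps)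
    also have "\<dots> \<le> \<bar>v a - v b\<bar> * \<bar>p a\<bar> + \<bar>v b\<bar> * \<bar>p a - p b\<bar>"
      by (metis abs_ge_self abs_mult add_mono)
    also have "\<dots> \<le> (norm (elgrad v K) * h) * P + 1 * (norm (elgrad p K) * h)"
      using 1[OF v ab] 1[OF p ab] P v1 ab h_pos by (intro add_mono mult_mono) auto
    finally show "?w a - ?w b \<le> (norm (elgrad v K) * P + norm (elgrad p K)) * h" by (simp add: algebra_simps)
  qed
  then show "norm (elgrad ?w K) \<le> (norm (elgrad v K) * P + norm (elgrad p K)) / (2 * c)"
    using h_pos by simp
  have "norm (elgrad ?w K) \<le> (2 * P) / (2 * (c * h))"
  proof (rule norm_elgrad_le[OF nodal_interp_P1 K])
    fix a b assume ab: "a \<in> verts K" "b \<in> verts K"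
    have *: "\<bar>v a * p a\<bar> \<le> 1 * P" if "a \<in> verts K" for a
      unfolding abs_mult using v1[OF that] P[OF that] by (intro mult_mono) auto
    then show "?w a - ?w b \<le> 2 * P" using *[OF ab(1)] *[OF ab(2)] unfolding w[OF ab(1)] w[OF ab(2)] by linarith
  qed
  then show "norm (elgrad ?w K) \<le> P / (c * h)" by simp
qed

text \<open>An element whose enlarged ball contains x has its inscribed ball of radius c h inside
  the ball of radius (R + c) h about x. Inscribed balls of different elements are disjoint, so
  comparing volumes bounds their number, and h cancels.\<close>

lemma overlap_le:
  assumes R: "R > 0" and z: "\<And>K. K \<in> \<T> \<Longrightarrow> cball (z K) (c * h) \<subseteq> K"
  shows "(\<Sum>K\<in>\<T>. indicator (\<Omega> \<inter> ball (z K) (R * h)) x) \<le> ((R + c) / c) ^ CARD('n) * (indicator \<Omega> x :: real)"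
proof (cases "x \<in> \<Omega>")
  case False
  have "(\<Sum>K\<in>\<T>. indicator (\<Omega> \<inter> ball (z K) (R * h)) x :: real) = 0"
    using False by (intro sum.neutral) auto
  then show ?thesis using False by simp
next
  case True
  define I where "I = {K \<in> \<T>. x \<in> ball (z K) (R * h)}"
  have "(\<Sum>K\<in>\<T>. indicator (\<Omega> \<inter> ball (z K) (R * h)) x :: real) = (\<Sum>K\<in>\<T>. if x \<in> ball (z K) (R * h) then 1 else 0)"
    using True by (intro sum.cong) auto
  also have "\<dots> = real (card I)"
    unfolding I_def using finite_mesh by (simp add: sum.If_cases Int_def)
  also have "\<dots> \<le> ((R + c) * h / (c * h)) ^ CARD('n)"
  proof (rule card_disjoint_balls_le[where z = z and x = x])
    show "finite I" unfolding I_def using finite_mesh by simp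
    show "0 < c * h" by (rule ch_pos)
    show "0 < (R + c) * h" using R c_pos h_pos by simp
    show "ball (z K) (c * h) \<subseteq> ball x ((R + c) * h)" if "K \<in> I" for K
    proof
      fix y assume "y \<in> ball (z K) (c * h)"
      then have "dist x y < R * h + c * h"
        using that dist_triangle[of x y "z K"] by (auto simp: I_def dist_commute)
      then show "y \<in> ball x ((R + c) * h)" by (simp add: algebra_simps)
    qed
    have sub: "ball (z K) (c * h) \<subseteq> interior K" if "K \<in> \<T>" for K
      using interior_mono[OF z[OF that]] by simp
    show "ball (z K) (c * h) \<inter> ball (z K') (c * h) = {}" if "K \<in> I" "K' \<in> I" "K \<noteq> K'" for K K'
      using sub[of K] sub[of K'] interior_disjoint[of K K'] that by (auto simp: I_def)
  qed
  finally show ?thesis using True h_pos by simp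
qed

end

section \<open>Quasi-interpolation\<close>

context fe_mesh
begin

text \<open>The nodal values of the quasi-interpolant are averages over balls pushed into the domain,
  so that the Poincare inequality is only needed on balls.\<close>

lemma quasi_interpolant:
  fixes q :: "real^'n \<Rightarrow> real" and C4 C5 E :: real
  assumes \<kappa>: "\<kappa> \<ge> 0"
    and push: "\<And>a. a \<in> closure \<Omega> \<Longrightarrow> \<exists>w. norm w \<le> \<kappa> * h \<and> ball (a - w) (2 * h) \<subseteq> \<Omega> \<and>
         (\<forall>x\<in>\<Omega> \<inter> ball a (2 * h). \<forall>s. 0 \<le> s \<and> s \<le> 1 \<longrightarrow> x - s *\<^sub>R w \<in> \<Omega>)"
    and wg: "weak_grad_pair \<Omega> q G"
    and Q: "AE x in lborel. x \<in> \<Omega> \<longrightarrow> \<bar>q x\<bar> \<le> Q" "Q \<ge> 0"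
  defines "C4 \<equiv> 2 * \<kappa>\<^sup>2 + 2 ^ (CARD('n) + 4)" and "C5 \<equiv> ((\<kappa> + 4 + c) / c) ^ CARD('n)"
    and "E \<equiv> (LINT x:\<Omega>|lborel. (norm (G x))\<^sup>2)"
  obtains p where "p \<in> P1 \<T>" "\<And>a. a \<in> nodes \<T> \<Longrightarrow> \<bar>p a\<bar> \<le> Q"
    "(\<Sum>K\<in>\<T>. area K * (norm (elgrad p K))\<^sup>2) \<le> C4 * C5 / c\<^sup>2 * E"
    "(\<Sum>K\<in>\<T>. LINT x|lebesgue_on (interior K). (q x - p x)\<^sup>2) \<le> (CARD('n) + 1) * C4 * C5 * h\<^sup>2 * E"
proof -
  have q: "q \<in> borel_measurable borel" "integrable lborel q" "integrable lborel (\<lambda>x. (q x)\<^sup>2)"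
    and G: "G \<in> borel_measurable borel" "integrable lborel (\<lambda>x. (norm (G x))\<^sup>2)"
    using wg by (auto simp: weak_grad_pair_def)
  note [measurable] = q(1) G(1) and [measurable] = domain_sets(1)
  have C4: "C4 \<ge> 0" by (simp add: C4_def)
  have "\<forall>a\<in>closure \<Omega>. \<exists>w. norm w \<le> \<kappa> * h \<and> ball (a - w) (2 * h) \<subseteq> \<Omega> \<and>
         (\<forall>x\<in>\<Omega> \<inter> ball a (2 * h). \<forall>s. 0 \<le> s \<and> s \<le> 1 \<longrightarrow> x - s *\<^sub>R w \<in> \<Omega>)" using push by blast
  from bchoice[OF this] obtain w where w0: "\<forall>a\<in>closure \<Omega>. norm (w a) \<le> \<kappa> * h \<and> ball (a - w a) (2 * h) \<subseteq> \<Omega> \<and>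
         (\<forall>x\<in>\<Omega> \<inter> ball a (2 * h). \<forall>s. 0 \<le> s \<and> s \<le> 1 \<longrightarrow> x - s *\<^sub>R w a \<in> \<Omega>)"
    by blast
  have w: "\<And>a. a \<in> closure \<Omega> \<Longrightarrow> norm (w a) \<le> \<kappa> * h"
    "\<And>a. a \<in> closure \<Omega> \<Longrightarrow> ball (a - w a) (2 * h) \<subseteq> \<Omega>"
    "\<And>a x s. a \<in> closure \<Omega> \<Longrightarrow> x \<in> \<Omega> \<Longrightarrow> dist a x < 2 * h \<Longrightarrow> 0 \<le> s \<Longrightarrow> s \<le> 1 \<Longrightarrow> x - s *\<^sub>R w a \<in> \<Omega>"
    using w0 by auto
  obtain z where z: "\<And>K. K \<in> \<T> \<Longrightarrow> cball (z K) (c * h) \<subseteq> K" using ex_inball by metis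
  define B where "B a = ball (a - w a) (2 * h)" for a
  obtain p where p: "p \<in> P1 \<T>" "\<And>a. a \<in> nodes \<T> \<Longrightarrow> p a = set_avg (B a) q"
    using ex_P1[of "\<lambda>a. set_avg (B a) q"] by blast
  \<comment> \<open>The centre \<open>z K\<close> is within h of every vertex a of K, and the pushed
    points and balls stay within (\<kappa> + 3) h of a; hence the radius (\<kappa> + 4) h.
    \<open>C5\<close> is the overlap number of these patches.\<close>
  define N where "N K = \<Omega> \<inter> ball (z K) ((\<kappa> + 4) * h)" for K
  define EN where "EN K = (LINT x:N K|lborel. (norm (G x))\<^sup>2)" for K
  have [measurable]: "N K \<in> sets borel" for K unfolding N_def using open_domain by auto
  have iG: "integrable lborel (\<lambda>x. indicator S x *\<^sub>R (norm (G x))\<^sup>2)" if "S \<in> sets borel" for S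
    using integrable_mult_indicator[of S lborel "\<lambda>x. (norm (G x))\<^sup>2"] G that by simp
  have EN0: "EN K \<ge> 0" for K unfolding EN_def set_lebesgue_integral_def by (rule integral_nonneg_AE) simp
  have sumEN: "(\<Sum>K\<in>\<T>. EN K) \<le> C5 * E"
  proof -
    have "(\<Sum>K\<in>\<T>. EN K) = (LINT x|lborel. (\<Sum>K\<in>\<T>. indicator (N K) x *\<^sub>R (norm (G x))\<^sup>2))"
      unfolding EN_def set_lebesgue_integral_def by (intro Bochner_Integration.integral_sum[symmetric] iG) simp
    also have "\<dots> \<le> (LINT x|lborel. C5 * (indicator \<Omega> x *\<^sub>R (norm (G x))\<^sup>2))"
    proof (rule integral_mono)
      show "integrable lborel (\<lambda>x. \<Sum>K\<in>\<T>. indicator (N K) x *\<^sub>R (norm (G x))\<^sup>2)"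
        by (intro Bochner_Integration.integrable_sum iG) simp
      show "integrable lborel (\<lambda>x. C5 * (indicator \<Omega> x *\<^sub>R (norm (G x))\<^sup>2))"
        by (intro integrable_mult_right iG) simp
      fix x
      have "(\<Sum>K\<in>\<T>. indicator (N K) x) \<le> C5 * (indicator \<Omega> x :: real)"
        unfolding N_def C5_def using overlap_le[of "\<kappa> + 4" z x] \<kappa> z by simp
      then have "(\<Sum>K\<in>\<T>. indicator (N K) x) * (norm (G x))\<^sup>2 \<le> (C5 * indicator \<Omega> x) * (norm (G x))\<^sup>2"
        by (rule mult_right_mono) simp
      then show "(\<Sum>K\<in>\<T>. indicator (N K) x *\<^sub>R (norm (G x))\<^sup>2) \<le> C5 * (indicator \<Omega> x *\<^sub>R (norm (G x))\<^sup>2)"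
        by (simp add: sum_distrib_right mult.assoc)
    qed
    also have "\<dots> = C5 * E" by (simp add: E_def set_lebesgue_integral_def)
    finally show ?thesis .
  qed
  have iqk: "integrable (lebesgue_on (interior K)) (\<lambda>x. (q x - k)\<^sup>2)"
    and qm: "q \<in> borel_measurable (lebesgue_on (interior K))"
    and iq2: "integrable (lebesgue_on (interior K)) (\<lambda>x. (q x)\<^sup>2)" if K: "K \<in> \<T>" for K k
  proof -
    interpret finite_measure "lebesgue_on (interior K)" by (rule measure_lebesgue_on_interior[OF K])
    show m: "q \<in> borel_measurable (lebesgue_on (interior K))"
      by (intro measurable_restrict_space1 measurable_completion) simp
    show 2: "integrable (lebesgue_on (interior K)) (\<lambda>x. (q x)\<^sup>2)"
      using integrable_mult_indicator[OF _ q(3), of "interior K"]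
      by (subst integrable_lebesgue_on_borel) (auto simp: set_integrable_def)
    show "integrable (lebesgue_on (interior K)) (\<lambda>x. (q x - k)\<^sup>2)"
      by (rule integrable_diff_square[OF m _ 2]) auto
  qed
  have local: "(LINT x|lebesgue_on (interior K). (q x - p a)\<^sup>2) \<le> C4 * h\<^sup>2 * EN K"
    if K: "K \<in> \<T>" and a: "a \<in> verts K" for K a
  proof -
    have aK: "a \<in> K" using a verts_subset[OF K] by blast
    then have aO: "a \<in> closure \<Omega>" using K Union_mesh by blast
    have zK: "z K \<in> K" using z[OF K] ch_pos by (auto simp: subset_eq)
    have nw: "norm (w a) \<le> \<kappa> * h" by (rule w(1)[OF aO])
    have xa: "dist a x \<le> h" "x \<in> \<Omega>" if "x \<in> interior K" for x
      using dist_element_le[OF K aK, of x] interior_subset interior_element_subset[OF K] that by blast+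
    have NI: "y \<in> N K" if "y \<in> \<Omega>" "dist a y < (\<kappa> + 3) * h" for y
    proof -
      have "dist (z K) y \<le> dist (z K) a + dist a y" by (rule dist_triangle)
      then show ?thesis using that dist_element_le[OF K zK aK] by (simp add: N_def algebra_simps)
    qed
    have "(LINT x:interior K|lborel. (q x - set_avg (ball (a - w a) (2 * h)) q)\<^sup>2)
       \<le> (2 * (norm (w a))\<^sup>2 + 2 ^ (CARD('n) + 2) * (2 * h)\<^sup>2) * (LINT x:N K|lborel. (norm (G x))\<^sup>2)"
    proof (rule poincare_shifted_ball[OF wg open_interior])
      show "bounded (interior K)" using compact_element[OF K] by (simp add: compact_imp_bounded bounded_interior)
      show "open (N K)" "N K \<subseteq> \<Omega>" using open_domain by (auto simp: N_def)
      show "0 < 2 * h" using h_pos by simp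
      show "ball (a - w a) (2 * h) \<subseteq> N K"
      proof
        fix y assume y: "y \<in> ball (a - w a) (2 * h)"
        have "dist a y \<le> dist a (a - w a) + dist (a - w a) y" by (rule dist_triangle)
        also have "\<dots> < \<kappa> * h + 2 * h" using y nw by (simp add: dist_norm)
        finally have "dist a y < (\<kappa> + 3) * h" using h_pos by (simp add: algebra_simps)
        then show "y \<in> N K" using NI w(2)[OF aO] y by blast
      qed
      fix x assume x: "x \<in> interior K"
      show "x - w a \<in> ball (a - w a) (2 * h)" using xa(1)[OF x] h_pos by (simp add: dist_norm algebra_simps)
      fix s :: real assume s: "0 \<le> s" "s \<le> 1"
      have "dist a (x - s *\<^sub>R w a) \<le> dist a x + dist x (x - s *\<^sub>R w a)" by (rule dist_triangle)
      also have "dist x (x - s *\<^sub>R w a) = s * norm (w a)" using s by (simp add: dist_norm)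
      also have "s * norm (w a) \<le> \<kappa> * h" using s nw mult_left_le_one_le[of "norm (w a)" s] by simp
      finally have "dist a (x - s *\<^sub>R w a) < (\<kappa> + 3) * h" using xa(1)[OF x] h_pos by (simp add: algebra_simps)
      moreover have "x - s *\<^sub>R w a \<in> \<Omega>"
        using w(3)[OF aO xa(2)[OF x] _ s] xa(1)[OF x] h_pos by simp
      ultimately show "x - s *\<^sub>R w a \<in> N K" by (intro NI)
    qed
    also have "(2 * (norm (w a))\<^sup>2 + 2 ^ (CARD('n) + 2) * (2 * h)\<^sup>2) * (LINT x:N K|lborel. (norm (G x))\<^sup>2)
        \<le> (C4 * h\<^sup>2) * EN K"
      unfolding EN_def[symmetric]
    proof (rule mult_right_mono[OF _ EN0])
      \<comment> \<open>The ball radius 2 h turns 2^(n+2) r^2 into 2^(n+4) h^2, the second term of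
        \<open>C4\<close>.\<close>
      have "(norm (w a))\<^sup>2 \<le> (\<kappa> * h)\<^sup>2" using nw by (intro power_mono) auto
      then show "2 * (norm (w a))\<^sup>2 + 2 ^ (CARD('n) + 2) * (2 * h)\<^sup>2 \<le> C4 * h\<^sup>2"
        by (simp add: C4_def power_mult_distrib power_add algebra_simps)
    qed
    also have "set_avg (ball (a - w a) (2 * h)) q = p a" using p(2) verts_nodes[OF K a] by (simp add: B_def)
    finally show ?thesis by (subst integral_lebesgue_on_borel) auto
  qed
  show thesis
  proof (rule that[OF p(1)])
    fix a assume a: "a \<in> nodes \<T>"
    have aO: "a \<in> closure \<Omega>" using a nodes_subset by blast
    have BO: "B a \<subseteq> \<Omega>" using w(2)[OF aO] by (simp add: B_def)
    define V where "V = measure lborel (B a)"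
    have V: "V > 0" using h_pos by (simp add: V_def B_def content_ball)
    have ind: "integrable lborel (\<lambda>x. Q * indicator (B a) x)"
      using emeasure_bounded_finite[of "B a"] by (intro integrable_mult_right integrable_real_indicator) (auto simp: B_def)
    have "\<bar>LINT x:B a|lborel. q x\<bar> \<le> (LINT x|lborel. norm (indicator (B a) x *\<^sub>R q x))"
      unfolding set_lebesgue_integral_def using integral_norm_bound[of lborel "\<lambda>x. indicator (B a) x *\<^sub>R q x"] by simp
    also have "\<dots> \<le> (LINT x|lborel. Q * indicator (B a) x)"
    proof (rule integral_mono_AE[OF _ ind])
      show "integrable lborel (\<lambda>x. norm (indicator (B a) x *\<^sub>R q x))"
        using q(2) by (intro integrable_norm integrable_mult_indicator) (auto simp: B_def)
      show "AE x in lborel. norm (indicator (B a) x *\<^sub>R q x) \<le> Q * indicator (B a) x"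
        using Q(1) by eventually_elim (use BO in \<open>auto split: split_indicator\<close>)
    qed
    also have "\<dots> = Q * V" using emeasure_bounded_finite[of "B a"] by (simp add: V_def B_def)
    finally show "\<bar>p a\<bar> \<le> Q" using V p(2)[OF a] by (simp add: set_avg_def V_def[symmetric] pos_divide_le_eq)
  next
    have el: "area K * (norm (elgrad p K))\<^sup>2 \<le> C4 / c\<^sup>2 * EN K" if K: "K \<in> \<T>" for K
    proof -
      define X where "X = C4 * h\<^sup>2 * EN K"
      have X0: "X \<ge> 0" using C4 EN0 by (simp add: X_def)
      have A: "area K > 0" by (rule area_pos[OF K])
      \<comment> \<open>Two nodal values are compared through q: each is close to q in mean square
        on K, so integrating the constant (p a - p b)^2 over K bounds it by twice the sum of two
        local errors, hence by 4 X.\<close>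
      have "p a - p b \<le> sqrt (4 * X / area K)" if a: "a \<in> verts K" and b: "b \<in> verts K" for a b
      proof -
        have "area K * (p a - p b)\<^sup>2 = (LINT x|lebesgue_on (interior K). (p a - p b)\<^sup>2)"
          by (rule measure_lebesgue_on_interior(2)[OF K, symmetric])
        also have "\<dots> \<le> (LINT x|lebesgue_on (interior K). 2 * (q x - p a)\<^sup>2 + 2 * (q x - p b)\<^sup>2)"
        proof (rule integral_mono)
          interpret finite_measure "lebesgue_on (interior K)" by (rule measure_lebesgue_on_interior[OF K])
          show "integrable (lebesgue_on (interior K)) (\<lambda>x. (p a - p b)\<^sup>2)" by simp
          show "integrable (lebesgue_on (interior K)) (\<lambda>x. 2 * (q x - p a)\<^sup>2 + 2 * (q x - p b)\<^sup>2)"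
            by (intro Bochner_Integration.integrable_add integrable_mult_right iqk[OF K])
          fix x
          have "0 \<le> ((q x - p a) + (q x - p b))\<^sup>2" by simp
          then show "(p a - p b)\<^sup>2 \<le> 2 * (q x - p a)\<^sup>2 + 2 * (q x - p b)\<^sup>2"
            by (simp add: power2_eq_square algebra_simps)
        qed
        also have "\<dots> = 2 * (LINT x|lebesgue_on (interior K). (q x - p a)\<^sup>2) + 2 * (LINT x|lebesgue_on (interior K). (q x - p b)\<^sup>2)"
          using iqk[OF K] by simp
        also have "\<dots> \<le> 4 * X" using local[OF K a] local[OF K b] by (simp add: X_def)
        finally have "(p a - p b)\<^sup>2 \<le> 4 * X / area K" using A by (simp add: pos_le_divide_eq mult.commute)
        then show ?thesis by (rule real_le_rsqrt)
      qed
      then have "norm (elgrad p K) \<le> sqrt (4 * X / area K) / (2 * (c * h))"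
        by (rule norm_elgrad_le[OF p(1) K])
      then have "(norm (elgrad p K))\<^sup>2 \<le> (sqrt (4 * X / area K) / (2 * (c * h)))\<^sup>2" by (intro power_mono) auto
      also have "\<dots> = (4 * X / area K) / (4 * c\<^sup>2 * h\<^sup>2)"
        using X0 A by (simp add: power_divide power_mult_distrib)
      also have "\<dots> = C4 / c\<^sup>2 * EN K / area K" using h_pos c_pos by (simp add: X_def)
      finally have "area K * (norm (elgrad p K))\<^sup>2 \<le> area K * (C4 / c\<^sup>2 * EN K / area K)"
        using A by (intro mult_left_mono) auto
      then show ?thesis using A by simp
    qed
    have "(\<Sum>K\<in>\<T>. area K * (norm (elgrad p K))\<^sup>2) \<le> (\<Sum>K\<in>\<T>. C4 / c\<^sup>2 * EN K)" by (intro sum_mono el)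
    also have "\<dots> = C4 / c\<^sup>2 * (\<Sum>K\<in>\<T>. EN K)" by (simp add: sum_distrib_left)
    also have "\<dots> \<le> C4 / c\<^sup>2 * (C5 * E)" using C4 by (intro mult_left_mono sumEN) auto
    finally show "(\<Sum>K\<in>\<T>. area K * (norm (elgrad p K))\<^sup>2) \<le> C4 * C5 / c\<^sup>2 * E" by simp
    have err: "(LINT x|lebesgue_on (interior K). (q x - p x)\<^sup>2) \<le> (CARD('n) + 1) * (C4 * h\<^sup>2 * EN K)" if K: "K \<in> \<T>" for K
    proof -
      have "(LINT x|lebesgue_on (interior K). (q x - p x)\<^sup>2) \<le> (LINT x|lebesgue_on (interior K). (\<Sum>a\<in>verts K. (q x - p a)\<^sup>2))"
      proof (rule integral_mono)
        show "integrable (lebesgue_on (interior K)) (\<lambda>x. (q x - p x)\<^sup>2)"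
          by (rule integrable_diff_square[OF qm[OF K] P1_square_integrable(3)[OF p(1) K] iq2[OF K] P1_square_integrable(2)[OF p(1) K]])
        show "integrable (lebesgue_on (interior K)) (\<lambda>x. \<Sum>a\<in>verts K. (q x - p a)\<^sup>2)"
          by (intro Bochner_Integration.integrable_sum iqk[OF K])
        fix x assume "x \<in> space (lebesgue_on (interior K))"
        then have xK: "x \<in> K" using interior_subset by auto
        define m where "m = sqrt (\<Sum>a\<in>verts K. (q x - p a)\<^sup>2)"
        \<comment> \<open>For fixed x the number q x is a constant, so p - q x is affine on K and
          bounded by its vertex values. The squared error at x is thus at most the sum of the
          squared vertex errors, already estimated; their number gives the factor n + 1.\<close>
        have "(\<lambda>y. 1 * p y + (- q x) * 1) \<in> P1 \<T>" by (rule P1_add[OF p(1) P1_const])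
        then have "\<bar>1 * p x + (- q x) * 1\<bar> \<le> m"
        proof (rule P1_abs_le_verts[OF _ K xK])
          fix a assume a: "a \<in> verts K"
          have "(q x - p a)\<^sup>2 \<le> (\<Sum>a\<in>verts K. (q x - p a)\<^sup>2)"
            by (rule member_le_sum[OF a _ verts_element(2)[OF K]]) simp
          then have "\<bar>q x - p a\<bar> \<le> m" unfolding m_def by (metis real_sqrt_abs real_sqrt_le_mono)
          then show "\<bar>1 * p a + (- q x) * 1\<bar> \<le> m" by (simp add: abs_minus_commute)
        qed
        then have "\<bar>q x - p x\<bar> \<le> m" by (simp add: abs_minus_commute)
        then have "\<bar>q x - p x\<bar>\<^sup>2 \<le> m\<^sup>2" by (intro power_mono) auto
        also have "m\<^sup>2 = (\<Sum>a\<in>verts K. (q x - p a)\<^sup>2)" unfolding m_def by (simp add: sum_nonneg)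
        finally show "(q x - p x)\<^sup>2 \<le> (\<Sum>a\<in>verts K. (q x - p a)\<^sup>2)" by simp
      qed
      also have "\<dots> = (\<Sum>a\<in>verts K. LINT x|lebesgue_on (interior K). (q x - p a)\<^sup>2)"
        by (rule Bochner_Integration.integral_sum) (rule iqk[OF K])
      also have "\<dots> \<le> (\<Sum>a\<in>verts K. C4 * h\<^sup>2 * EN K)" by (intro sum_mono local[OF K])
      also have "\<dots> = (CARD('n) + 1) * (C4 * h\<^sup>2 * EN K)" using verts_element(4)[OF K] by simp
      finally show ?thesis .
    qed
    have "(\<Sum>K\<in>\<T>. LINT x|lebesgue_on (interior K). (q x - p x)\<^sup>2) \<le> (\<Sum>K\<in>\<T>. (CARD('n) + 1) * (C4 * h\<^sup>2 * EN K))"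
      by (intro sum_mono err)
    also have "\<dots> = (CARD('n) + 1) * C4 * h\<^sup>2 * (\<Sum>K\<in>\<T>. EN K)" by (simp add: sum_distrib_left mult.assoc)
    also have "\<dots> \<le> (CARD('n) + 1) * C4 * h\<^sup>2 * (C5 * E)" using C4 by (intro mult_left_mono sumEN) auto
    finally show "(\<Sum>K\<in>\<T>. LINT x|lebesgue_on (interior K). (q x - p x)\<^sup>2) \<le> (CARD('n) + 1) * C4 * C5 * h\<^sup>2 * E"
      by (simp add: mult_ac)
  qed
qed

end

section \<open>Bounds for the multiplier\<close>

text \<open>Functions in \<open>L2\<close> are only Lebesgue measurable, whereas the translation
  estimates run on \<open>lborel\<close>. The value 0 off \<Omega> lets integrals over \<Omega> be
  read over the whole space.\<close>

lemma borel_representative_real: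
  fixes f :: "'a::euclidean_space \<Rightarrow> real"
  assumes \<Omega>: "open \<Omega>" and f: "f \<in> borel_measurable (lebesgue_on \<Omega>)"
  obtains f0 where "f0 \<in> borel_measurable borel" "\<And>x. x \<notin> \<Omega> \<Longrightarrow> f0 x = 0" "AE x in lebesgue_on \<Omega>. f x = f0 x"
proof -
  have "(\<lambda>x. indicator \<Omega> x *\<^sub>R f x) \<in> borel_measurable lebesgue"
    using f \<Omega> by (subst (asm) borel_measurable_restrict_space_iff) (auto simp: mult.commute)
  then obtain g where g: "g \<in> borel_measurable borel" "AE x in lborel. indicator \<Omega> x *\<^sub>R f x = g x"
    using completion_ex_borel_measurable_real[of "\<lambda>x. indicator \<Omega> x *\<^sub>R f x" lborel] by auto
  have "AE x in lebesgue. indicator \<Omega> x *\<^sub>R f x = g x" using g(2) by (simp add: AE_completion_iff)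
  then have "AE x in lebesgue. x \<in> \<Omega> \<longrightarrow> f x = indicator \<Omega> x * g x"
    by eventually_elim (auto split: split_indicator)
  then have "AE x in lebesgue_on \<Omega>. f x = indicator \<Omega> x * g x"
    using \<Omega> by (subst AE_restrict_space_iff) auto
  moreover have "(\<lambda>x. indicator \<Omega> x * g x) \<in> borel_measurable borel"
    using g(1) \<Omega> by (intro borel_measurable_times borel_measurable_indicator) auto
  ultimately show thesis using that[of "\<lambda>x. indicator \<Omega> x * g x"] by simp
qed

lemma borel_representative_vec:
  fixes f :: "'a::euclidean_space \<Rightarrow> real^'n"
  assumes \<Omega>: "open \<Omega>" and f: "f \<in> borel_measurable (lebesgue_on \<Omega>)"
  obtains f0 where "f0 \<in> borel_measurable borel" "\<And>x. x \<notin> \<Omega> \<Longrightarrow> f0 x = 0" "AE x in lebesgue_on \<Omega>. f x = f0 x"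
proof -
  have "\<exists>f0. f0 \<in> borel_measurable borel \<and> (\<forall>x. x \<notin> \<Omega> \<longrightarrow> f0 x = 0) \<and> (AE x in lebesgue_on \<Omega>. f x $ i = f0 x)" for i
  proof -
    have "(\<lambda>x. f x $ i) \<in> borel_measurable (lebesgue_on \<Omega>)"
      using f unfolding cart_eq_inner_axis by measurable
    from borel_representative_real[OF \<Omega> this] show ?thesis by metis
  qed
  then obtain g where g: "\<And>i. g i \<in> borel_measurable borel" "\<And>i x. x \<notin> \<Omega> \<Longrightarrow> g i x = 0"
    "\<And>i. AE x in lebesgue_on \<Omega>. f x $ i = g i x" by metis
  show thesis
  proof
    show "(\<lambda>x. \<chi> i. g i x) \<in> borel_measurable borel"
      using g(1) by (subst borel_measurable_euclidean_space) (auto simp: Basis_vec_def inner_axis)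
    show "(\<chi> i. g i x) = 0" if "x \<notin> \<Omega>" for x using g(2) that by (simp add: vec_eq_iff)
    have "AE x in lebesgue_on \<Omega>. \<forall>i\<in>UNIV. f x $ i = g i x" using g(3) by (intro AE_finite_allI) auto
    then show "AE x in lebesgue_on \<Omega>. f x = (\<chi> i. g i x)" by eventually_elim (simp add: vec_eq_iff)
  qed
qed

lemma lebesgue_on_eq_lborel:
  fixes f :: "'a::euclidean_space \<Rightarrow> real"
  assumes "open \<Omega>" "f \<in> borel_measurable borel" "\<And>x. x \<notin> \<Omega> \<Longrightarrow> f x = 0"
  shows "(LINT x|lebesgue_on \<Omega>. f x) = (LINT x|lborel. f x)"
    and "integrable (lebesgue_on \<Omega>) f \<longleftrightarrow> integrable lborel f"
proof -
  have eq: "(\<lambda>x. indicator \<Omega> x * f x) = f" using assms(3) by (auto split: split_indicator)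
  have "\<Omega> \<in> sets borel" using assms(1) by simp
  then show "(LINT x|lebesgue_on \<Omega>. f x) = (LINT x|lborel. f x)"
    "integrable (lebesgue_on \<Omega>) f \<longleftrightarrow> integrable lborel f"
    using integral_lebesgue_on_borel[OF assms(2)] integrable_lebesgue_on_borel[OF assms(2)]
    by (simp_all add: set_lebesgue_integral_def set_integrable_def eq)
qed

text \<open>Extension by zero in general destroys weak differentiability across the boundary, but
  the pair is tested only with functions supported in \<Omega>, where nothing changes. This is the
  passage from \<open>H1\<close> and its chosen gradient to the translation estimates.\<close>

lemma H1_weak_grad_pair:
  fixes q :: "real^'n \<Rightarrow> real"
  assumes \<Omega>: "open \<Omega>" "bounded \<Omega>" and q: "q \<in> H1 \<Omega>"
  obtains q0 G0 where "weak_grad_pair \<Omega> q0 G0" "AE x in lebesgue_on \<Omega>. q x = q0 x"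
    "(LINT x:\<Omega>|lborel. (norm (G0 x))\<^sup>2) = (L2_norm \<Omega> (grad \<Omega> q))\<^sup>2"
proof -
  have q2: "q \<in> L2 \<Omega>" and ex: "\<exists>G. G \<in> L2 \<Omega> \<and> has_weak_grad \<Omega> q G" using q by (auto simp: H1_def)
  have g: "grad \<Omega> q \<in> L2 \<Omega>" "has_weak_grad \<Omega> q (grad \<Omega> q)"
    using someI_ex[OF ex] unfolding grad_def by auto
  have qm: "q \<in> borel_measurable (lebesgue_on \<Omega>)" and gm: "grad \<Omega> q \<in> borel_measurable (lebesgue_on \<Omega>)"
    using q2 g(1) by (auto simp: L2_def)
  obtain q0 where q0: "q0 \<in> borel_measurable borel" "\<And>x. x \<notin> \<Omega> \<Longrightarrow> q0 x = 0" "AE x in lebesgue_on \<Omega>. q x = q0 x"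
    using borel_representative_real[OF \<Omega>(1) qm] by metis
  obtain G0 where G0: "G0 \<in> borel_measurable borel" "\<And>x. x \<notin> \<Omega> \<Longrightarrow> G0 x = 0" "AE x in lebesgue_on \<Omega>. grad \<Omega> q x = G0 x"
    using borel_representative_vec[OF \<Omega>(1) gm] by metis
  note [measurable] = q0(1) G0(1)
  have lm: "f \<in> borel_measurable borel \<Longrightarrow> f \<in> borel_measurable (lebesgue_on \<Omega>)" for f :: "real^'n \<Rightarrow> real"
    by (intro measurable_restrict_space1 measurable_completion) simp
  interpret finite_measure "lebesgue_on \<Omega>"
    by (rule finite_measure_lebesgue_on_bounded) (use \<Omega> in auto)
  have q0sq: "integrable (lebesgue_on \<Omega>) (\<lambda>x. (q0 x)\<^sup>2)"
  proof (rule integrable_cong_AE_imp)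
    show "integrable (lebesgue_on \<Omega>) (\<lambda>x. (norm (q x))\<^sup>2)" using q2 by (simp add: L2_def)
    show "AE x in lebesgue_on \<Omega>. (norm (q x))\<^sup>2 = (q0 x)\<^sup>2" using q0(3) by eventually_elim simp
  qed (rule lm, measurable)
  have G0sq: "integrable (lebesgue_on \<Omega>) (\<lambda>x. (norm (G0 x))\<^sup>2)"
  proof (rule integrable_cong_AE_imp)
    show "integrable (lebesgue_on \<Omega>) (\<lambda>x. (norm (grad \<Omega> q x))\<^sup>2)" using g(1) by (simp add: L2_def)
    show "AE x in lebesgue_on \<Omega>. (norm (grad \<Omega> q x))\<^sup>2 = (norm (G0 x))\<^sup>2" using G0(3) by eventually_elim simp
  qed (rule lm, measurable)
  have "integrable (lebesgue_on \<Omega>) q0" by (rule integrable_if_square[OF lm[OF q0(1)] q0sq])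
  then have 1: "integrable lborel q0" using lebesgue_on_eq_lborel(2)[OF \<Omega>(1) q0(1,2)] by simp
  have 2: "integrable lborel (\<lambda>x. (q0 x)\<^sup>2)"
    using lebesgue_on_eq_lborel(2)[OF \<Omega>(1), of "\<lambda>x. (q0 x)\<^sup>2"] q0sq q0(2) by simp
  have 3: "integrable lborel (\<lambda>x. (norm (G0 x))\<^sup>2)"
    using lebesgue_on_eq_lborel(2)[OF \<Omega>(1), of "\<lambda>x. (norm (G0 x))\<^sup>2"] G0sq G0(2) by simp
  have "weak_grad_pair \<Omega> q0 G0"
    unfolding weak_grad_pair_def
  proof (intro conjI allI impI q0(1) G0(1) 1 2 3)
    fix \<phi> and i :: 'n assume \<phi>: "test_function \<Omega> \<phi>"
    then have sm: "smooth_on UNIV \<phi>" by (simp add: test_function_def)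
    have [measurable]: "\<phi> \<in> borel_measurable borel" "(\<lambda>x. frechet_derivative \<phi> (at x) (axis i 1)) \<in> borel_measurable borel"
      using smooth_on_UNIV_continuous[OF sm] smooth_on_UNIV_continuous_derivative[OF sm] borel_measurable_continuous_onI by auto
    have [measurable]: "(\<lambda>x. G0 x $ i) \<in> borel_measurable borel" unfolding cart_eq_inner_axis by measurable
    have gi: "(\<lambda>x. grad \<Omega> q x $ i) \<in> borel_measurable (lebesgue_on \<Omega>)" by (rule L2_component(1)[OF g(1)])
    have "(LINT x|lborel. q0 x * frechet_derivative \<phi> (at x) (axis i 1))
      = (LINT x|lebesgue_on \<Omega>. q0 x * frechet_derivative \<phi> (at x) (axis i 1))"
      by (rule lebesgue_on_eq_lborel(1)[symmetric, OF \<Omega>(1)]) (use q0(2) in auto)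
    also have "\<dots> = (LINT x|lebesgue_on \<Omega>. q x * frechet_derivative \<phi> (at x) (axis i 1))"
    proof (rule integral_cong_AE)
      show "AE x in lebesgue_on \<Omega>. q0 x * frechet_derivative \<phi> (at x) (axis i 1) = q x * frechet_derivative \<phi> (at x) (axis i 1)"
        using q0(3) by eventually_elim simp
    qed (intro borel_measurable_times qm lm; measurable)+
    also have "\<dots> = - (LINT x|lebesgue_on \<Omega>. grad \<Omega> q x $ i * \<phi> x)"
      using g(2) \<phi> unfolding has_weak_grad_def by blast
    also have "(LINT x|lebesgue_on \<Omega>. grad \<Omega> q x $ i * \<phi> x) = (LINT x|lebesgue_on \<Omega>. G0 x $ i * \<phi> x)"
    proof (rule integral_cong_AE)
      show "AE x in lebesgue_on \<Omega>. grad \<Omega> q x $ i * \<phi> x = G0 x $ i * \<phi> x"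
        using G0(3) by eventually_elim simp
    qed (intro borel_measurable_times gi lm; measurable)+
    also have "\<dots> = (LINT x|lborel. G0 x $ i * \<phi> x)"
      by (rule lebesgue_on_eq_lborel(1)[OF \<Omega>(1)]) (use G0(2) in auto)
    finally show "(LINT x|lborel. q0 x * frechet_derivative \<phi> (at x) (axis i 1)) = - (LINT x|lborel. G0 x $ i * \<phi> x)" .
  qed
  moreover have "(LINT x:\<Omega>|lborel. (norm (G0 x))\<^sup>2) = (L2_norm \<Omega> (grad \<Omega> q))\<^sup>2"
  proof -
    have "(LINT x:\<Omega>|lborel. (norm (G0 x))\<^sup>2) = (LINT x|lebesgue_on \<Omega>. (norm (G0 x))\<^sup>2)"
      by (rule integral_lebesgue_on_borel[symmetric]) (use \<Omega> in auto)
    also have "\<dots> = L2_inner \<Omega> (grad \<Omega> q) (grad \<Omega> q)"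
      unfolding L2_inner_def
    proof (rule integral_cong_AE)
      show "AE x in lebesgue_on \<Omega>. (norm (G0 x))\<^sup>2 = grad \<Omega> q x \<bullet> grad \<Omega> q x"
        using G0(3) by eventually_elim (simp add: power2_norm_eq_inner)
      show "(\<lambda>x. (norm (G0 x))\<^sup>2) \<in> borel_measurable (lebesgue_on \<Omega>)" by (rule lm) measurable
      show "(\<lambda>x. grad \<Omega> q x \<bullet> grad \<Omega> q x) \<in> borel_measurable (lebesgue_on \<Omega>)"
        by (rule borel_measurable_inner[OF gm gm])
    qed
    also have "\<dots> = (L2_norm \<Omega> (grad \<Omega> q))\<^sup>2"
      unfolding L2_norm_def by (rule real_sqrt_pow2[symmetric]) (simp add: L2_inner_def)
    finally show ?thesis .
  qed
  ultimately show thesis using that q0(3) by blast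
qed

text \<open>A nonempty open set has positive measure, so the essential supremum of |q| is
  nonnegative, and it is finite by membership in \<open>Linf\<close>. Hence
  \<open>real_of_ereal\<close> returns it faithfully.\<close>

lemma Linf_norm_bound:
  fixes q :: "'a::euclidean_space \<Rightarrow> real"
  assumes \<Omega>: "open \<Omega>" "\<Omega> \<noteq> {}" and q: "q \<in> Linf \<Omega>"
  shows "AE x in lebesgue_on \<Omega>. \<bar>q x\<bar> \<le> Linf_norm \<Omega> q" "Linf_norm \<Omega> q \<ge> 0"
proof -
  let ?s = "esssup (lebesgue_on \<Omega>) (\<lambda>x. ereal \<bar>q x\<bar>)"
  have "\<not> negligible \<Omega>" using open_not_negligible[OF \<Omega>] .
  then have "emeasure (lebesgue_on \<Omega>) (space (lebesgue_on \<Omega>)) \<noteq> 0"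
    using \<Omega> by (auto simp: emeasure_restrict_space negligible_iff_null_sets null_sets_def)
  then have "esssup (lebesgue_on \<Omega>) (\<lambda>x. 0 :: ereal) = 0" by (rule esssup_const)
  moreover have "esssup (lebesgue_on \<Omega>) (\<lambda>x. 0 :: ereal) \<le> ?s" by (rule esssup_mono) auto
  ultimately have s0: "0 \<le> ?s" by simp
  moreover have "?s < \<infinity>" using q by (simp add: Linf_def)
  ultimately have s: "ereal (Linf_norm \<Omega> q) = ?s" unfolding Linf_norm_def by (intro ereal_real') auto
  show "Linf_norm \<Omega> q \<ge> 0" using s s0 by (metis ereal_less_eq(5))
  show "AE x in lebesgue_on \<Omega>. \<bar>q x\<bar> \<le> Linf_norm \<Omega> q"
    using esssup_AE[of "\<lambda>x. ereal \<bar>q x\<bar>" "lebesgue_on \<Omega>"] unfolding s[symmetric] by simp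
qed

section \<open>Testing with interpolated multiples of u\<close>

context fe_mesh
begin

lemma L2_norm_P1: "v \<in> P1 \<T> \<Longrightarrow> (L2_norm \<Omega> v)\<^sup>2 = (\<Sum>K\<in>\<T>. LINT x|lebesgue_on (interior K). (v x)\<^sup>2)"
  unfolding L2_norm_def L2_inner_def
  by (subst real_sqrt_pow2) (simp_all add: integral_split_elements(1)[OF P1_square_integrable(1)] sum_nonneg flip: power2_eq_square)

lemma L2_norm_grad_vec:
  fixes u :: "real^'n \<Rightarrow> real^'m"
  assumes "u \<in> P1_vec \<T>"
  shows "L2_norm \<Omega> (grad_vec \<Omega> u) = sqrt (\<Sum>K\<in>\<T>. area K * (\<Sum>i\<in>UNIV. (norm (elgrad (\<lambda>y. u y $ i) K))\<^sup>2))"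
  unfolding L2_norm_def grad_vec_inner[OF assms assms] by (simp add: power2_norm_eq_inner)

definition nodal_multiple :: "(real^'n \<Rightarrow> real^'m) \<Rightarrow> (real^'n \<Rightarrow> real) \<Rightarrow> real^'n \<Rightarrow> real^'m" where
  "nodal_multiple u p x = (\<chi> i. nodal_interp \<T> (\<lambda>y. u y $ i * p y) x)"

lemma nodal_multiple_P1: "nodal_multiple u p \<in> P1_vec \<T>"
  unfolding P1_vec_def nodal_multiple_def using nodal_interp_P1 by simp

text \<open>Cauchy-Schwarz over elements and components leaves the gradient of the nodal product.
  The first bound controls the vertex values of p by its L^2 norm and pays 1/h; it is meant for p =
  q. The second uses a sup bound on p: the derivative falling on u reproduces the norm of its
  gradient, which is where the quadratic dependence in the final estimate comes from.\<close>

lemma multiplier_test_bound: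
  fixes u :: "real^'n \<Rightarrow> real^'m"
  assumes u: "u \<in> P1_vec \<T>" "\<And>a. a \<in> nodes \<T> \<Longrightarrow> norm (u a) = 1" and p: "p \<in> P1 \<T>"
  shows "\<bar>L2_inner \<Omega> (grad_vec \<Omega> u) (grad_vec \<Omega> (nodal_multiple u p))\<bar>
      \<le> L2_norm \<Omega> (grad_vec \<Omega> u) * sqrt (CARD('m) * 4 ^ (CARD('n) + 1)) / (c * h) * L2_norm \<Omega> p"
    and "(\<And>a. a \<in> nodes \<T> \<Longrightarrow> \<bar>p a\<bar> \<le> P) \<Longrightarrow> P \<ge> 0 \<Longrightarrow> \<bar>L2_inner \<Omega> (grad_vec \<Omega> u) (grad_vec \<Omega> (nodal_multiple u p))\<bar>
      \<le> L2_norm \<Omega> (grad_vec \<Omega> u) / c * (P * L2_norm \<Omega> (grad_vec \<Omega> u)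
          + sqrt (CARD('m)) * sqrt (\<Sum>K\<in>\<T>. area K * (norm (elgrad p K))\<^sup>2))"
proof -
  let ?v = "nodal_multiple u p"
  let ?U = "L2_norm \<Omega> (grad_vec \<Omega> u)"
  let ?gu = "\<lambda>K i. norm (elgrad (\<lambda>y. u y $ i) K)"
  let ?gv = "\<lambda>K i. norm (elgrad (\<lambda>y. ?v y $ i) K)"
  have U0: "?U \<ge> 0" unfolding L2_norm_def by (simp add: L2_inner_def)
  have ui: "(\<lambda>y. u y $ i) \<in> P1 \<T>" for i using u(1) by (simp add: P1_vec_def)
  have u1: "\<bar>u a $ i\<bar> \<le> 1" if "a \<in> nodes \<T>" for a i using component_le_norm_cart[of "u a" i] u(2)[OF that] by simp
  have v: "(\<lambda>y. ?v y $ i) = nodal_interp \<T> (\<lambda>y. u y $ i * p y)" for i by (simp add: nodal_multiple_def)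
  have "\<bar>L2_inner \<Omega> (grad_vec \<Omega> u) (grad_vec \<Omega> ?v)\<bar>
    \<le> sqrt (\<Sum>K\<in>\<T>. area K * (\<Sum>i\<in>UNIV. (?gu K i)\<^sup>2)) * sqrt (\<Sum>K\<in>\<T>. area K * (\<Sum>i\<in>UNIV. (?gv K i)\<^sup>2))"
    unfolding grad_vec_inner[OF u(1) nodal_multiple_P1]
    by (rule weighted_sum_cauchy_schwarz) (simp add: area_pos less_imp_le)
  then have cs: "\<bar>L2_inner \<Omega> (grad_vec \<Omega> u) (grad_vec \<Omega> ?v)\<bar> \<le> ?U * sqrt (\<Sum>K\<in>\<T>. area K * (\<Sum>i\<in>UNIV. (?gv K i)\<^sup>2))"
    by (simp add: L2_norm_grad_vec[OF u(1)])
  show "\<bar>L2_inner \<Omega> (grad_vec \<Omega> u) (grad_vec \<Omega> ?v)\<bar>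
      \<le> ?U * sqrt (CARD('m) * 4 ^ (CARD('n) + 1)) / (c * h) * L2_norm \<Omega> p"
  proof -
    define k where "k = CARD('m) * 4 ^ (CARD('n) + 1) / (c * h)\<^sup>2"
    have "(\<Sum>K\<in>\<T>. area K * (\<Sum>i\<in>UNIV. (?gv K i)\<^sup>2)) \<le> (\<Sum>K\<in>\<T>. k * (LINT x|lebesgue_on (interior K). (p x)\<^sup>2))"
    proof (rule sum_mono)
      fix K assume K: "K \<in> \<T>"
      define X where "X = 4 ^ (CARD('n) + 1) * (LINT x|lebesgue_on (interior K). (p x)\<^sup>2)"
      have A: "area K > 0" by (rule area_pos[OF K])
      have X0: "X \<ge> 0" by (simp add: X_def)
      have pa: "\<bar>p a\<bar> \<le> sqrt (X / area K)" if "a \<in> verts K" for a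
      proof -
        have "(p a)\<^sup>2 \<le> X / area K"
          using nodal_value_le_integral[OF p K that] A by (simp add: pos_le_divide_eq mult.commute X_def)
        then show ?thesis by (metis real_sqrt_abs real_sqrt_le_mono)
      qed
      have "(?gv K i)\<^sup>2 \<le> X / area K / (c * h)\<^sup>2" for i
      proof -
        have "?gv K i \<le> sqrt (X / area K) / (c * h)"
          unfolding v by (rule elgrad_nodal_product_le(2)[OF ui p K _ pa]) (use u1 verts_nodes[OF K] in auto)
        then have "(?gv K i)\<^sup>2 \<le> (sqrt (X / area K) / (c * h))\<^sup>2" by (intro power_mono) auto
        then show ?thesis using X0 A by (simp add: power_divide)
      qed
      then have "(\<Sum>i\<in>UNIV. (?gv K i)\<^sup>2) \<le> (\<Sum>i\<in>(UNIV::'m set). X / area K / (c * h)\<^sup>2)" by (intro sum_mono)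
      then have "area K * (\<Sum>i\<in>UNIV. (?gv K i)\<^sup>2) \<le> area K * (CARD('m) * (X / area K / (c * h)\<^sup>2))"
        using A by (intro mult_left_mono) auto
      also have "\<dots> = k * (LINT x|lebesgue_on (interior K). (p x)\<^sup>2)" using A by (simp add: k_def X_def)
      finally show "area K * (\<Sum>i\<in>UNIV. (?gv K i)\<^sup>2) \<le> k * (LINT x|lebesgue_on (interior K). (p x)\<^sup>2)" .
    qed
    also have "\<dots> = k * (L2_norm \<Omega> p)\<^sup>2" by (simp add: L2_norm_P1[OF p] sum_distrib_left)
    finally have "sqrt (\<Sum>K\<in>\<T>. area K * (\<Sum>i\<in>UNIV. (?gv K i)\<^sup>2)) \<le> sqrt (k * (L2_norm \<Omega> p)\<^sup>2)" by (rule real_sqrt_le_mono)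
    also have "\<dots> = sqrt (CARD('m) * 4 ^ (CARD('n) + 1)) / (c * h) * L2_norm \<Omega> p"
    proof -
      have "L2_norm \<Omega> p \<ge> 0" unfolding L2_norm_def by (simp add: L2_inner_def)
      then show ?thesis using h_pos c_pos by (simp add: k_def real_sqrt_mult real_sqrt_divide abs_mult)
    qed
    finally have "?U * sqrt (\<Sum>K\<in>\<T>. area K * (\<Sum>i\<in>UNIV. (?gv K i)\<^sup>2))
        \<le> ?U * (sqrt (CARD('m) * 4 ^ (CARD('n) + 1)) / (c * h) * L2_norm \<Omega> p)" by (rule mult_left_mono[OF _ U0])
    then show ?thesis using cs by simp
  qed
  assume P: "\<And>a. a \<in> nodes \<T> \<Longrightarrow> \<bar>p a\<bar> \<le> P" and P0: "P \<ge> 0"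
  show "\<bar>L2_inner \<Omega> (grad_vec \<Omega> u) (grad_vec \<Omega> ?v)\<bar>
      \<le> ?U / c * (P * ?U + sqrt (CARD('m)) * sqrt (\<Sum>K\<in>\<T>. area K * (norm (elgrad p K))\<^sup>2))"
  proof -
    define S where "S = (\<Sum>K\<in>\<T>. area K * (norm (elgrad p K))\<^sup>2)"
    have S0: "S \<ge> 0" unfolding S_def by (intro sum_nonneg mult_nonneg_nonneg) (auto simp: area_pos less_imp_le)
    have "(\<Sum>K\<in>\<T>. area K * (\<Sum>i\<in>UNIV. (?gv K i)\<^sup>2))
      \<le> (\<Sum>K\<in>\<T>. P\<^sup>2 / c\<^sup>2 * (area K * (\<Sum>i\<in>UNIV. (?gu K i)\<^sup>2)) + CARD('m) / c\<^sup>2 * (area K * (norm (elgrad p K))\<^sup>2))"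
    proof (rule sum_mono)
      fix K assume K: "K \<in> \<T>"
      have A: "area K > 0" by (rule area_pos[OF K])
      have "(?gv K i)\<^sup>2 \<le> P\<^sup>2 / c\<^sup>2 * (?gu K i)\<^sup>2 + (norm (elgrad p K))\<^sup>2 / c\<^sup>2" for i
      proof -
        have "?gv K i \<le> (?gu K i * P + norm (elgrad p K)) / (2 * c)"
          unfolding v by (rule elgrad_nodal_product_le(1)[OF ui p K]) (use u1 P verts_nodes[OF K] in auto)
        then have "(?gv K i)\<^sup>2 \<le> ((?gu K i * P + norm (elgrad p K)) / (2 * c))\<^sup>2" by (intro power_mono) auto
        also have "\<dots> = (?gu K i * P + norm (elgrad p K))\<^sup>2 / (4 * c\<^sup>2)" by (simp add: power_divide power_mult_distrib)
        also have "\<dots> \<le> (4 * ((?gu K i * P)\<^sup>2 + (norm (elgrad p K))\<^sup>2)) / (4 * c\<^sup>2)"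
        proof (rule divide_right_mono)
          have "(?gu K i * P + norm (elgrad p K))\<^sup>2 \<le> 2 * ((?gu K i * P)\<^sup>2 + (norm (elgrad p K))\<^sup>2)"
            using sum_squares_bound[of "?gu K i * P" "norm (elgrad p K)"] by (simp add: power2_sum)
          \<comment> \<open>The factor 2 is relaxed to 4 so that it cancels against the square of 2
            c.\<close>
          also have "\<dots> \<le> 4 * ((?gu K i * P)\<^sup>2 + (norm (elgrad p K))\<^sup>2)" by simp
          finally show "(?gu K i * P + norm (elgrad p K))\<^sup>2 \<le> 4 * ((?gu K i * P)\<^sup>2 + (norm (elgrad p K))\<^sup>2)" .
        qed simp
        also have "\<dots> = P\<^sup>2 / c\<^sup>2 * (?gu K i)\<^sup>2 + (norm (elgrad p K))\<^sup>2 / c\<^sup>2"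
          using c_pos by (simp add: power_mult_distrib add_divide_distrib)
        finally show ?thesis .
      qed
      then have "(\<Sum>i\<in>UNIV. (?gv K i)\<^sup>2) \<le> (\<Sum>i\<in>UNIV. P\<^sup>2 / c\<^sup>2 * (?gu K i)\<^sup>2 + (norm (elgrad p K))\<^sup>2 / c\<^sup>2)"
        by (intro sum_mono)
      also have "\<dots> = P\<^sup>2 / c\<^sup>2 * (\<Sum>i\<in>UNIV. (?gu K i)\<^sup>2) + CARD('m) / c\<^sup>2 * (norm (elgrad p K))\<^sup>2"
        by (simp add: sum.distrib sum_distrib_left)
      finally have "area K * (\<Sum>i\<in>UNIV. (?gv K i)\<^sup>2)
        \<le> area K * (P\<^sup>2 / c\<^sup>2 * (\<Sum>i\<in>UNIV. (?gu K i)\<^sup>2) + CARD('m) / c\<^sup>2 * (norm (elgrad p K))\<^sup>2)"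
        using A by (intro mult_left_mono) auto
      then show "area K * (\<Sum>i\<in>UNIV. (?gv K i)\<^sup>2)
        \<le> P\<^sup>2 / c\<^sup>2 * (area K * (\<Sum>i\<in>UNIV. (?gu K i)\<^sup>2)) + CARD('m) / c\<^sup>2 * (area K * (norm (elgrad p K))\<^sup>2)"
        by (simp add: algebra_simps)
    qed
    also have "\<dots> = P\<^sup>2 / c\<^sup>2 * ?U\<^sup>2 + CARD('m) / c\<^sup>2 * S"
    proof -
      have "?U\<^sup>2 = (\<Sum>K\<in>\<T>. area K * (\<Sum>i\<in>UNIV. (?gu K i)\<^sup>2))"
        unfolding L2_norm_grad_vec[OF u(1)]
        by (intro real_sqrt_pow2 sum_nonneg mult_nonneg_nonneg) (auto simp: area_pos less_imp_le)
      then show ?thesis by (simp only: sum.distrib sum_distrib_left S_def)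
    qed
    finally have "sqrt (\<Sum>K\<in>\<T>. area K * (\<Sum>i\<in>UNIV. (?gv K i)\<^sup>2)) \<le> sqrt (P\<^sup>2 / c\<^sup>2 * ?U\<^sup>2 + CARD('m) / c\<^sup>2 * S)"
      by (rule real_sqrt_le_mono)
    also have "\<dots> \<le> sqrt (P\<^sup>2 / c\<^sup>2 * ?U\<^sup>2) + sqrt (CARD('m) / c\<^sup>2 * S)"
      using S0 by (intro sqrt_add_le_add_sqrt) auto
    also have "\<dots> = (P * ?U + sqrt (CARD('m)) * sqrt S) / c"
      using P0 U0 c_pos by (simp add: real_sqrt_mult real_sqrt_divide add_divide_distrib)
    finally have "?U * sqrt (\<Sum>K\<in>\<T>. area K * (\<Sum>i\<in>UNIV. (?gv K i)\<^sup>2)) \<le> ?U * ((P * ?U + sqrt (CARD('m)) * sqrt S) / c)"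
      by (rule mult_left_mono[OF _ U0])
    then show ?thesis using cs by (simp add: S_def)
  qed
qed

lemma multiplier_L2_bound:
  fixes u :: "real^'n \<Rightarrow> real^'m"
  assumes u: "u \<in> P1_vec \<T>" "\<And>a. a \<in> nodes \<T> \<Longrightarrow> norm (u a) = 1" and q: "q \<in> P1 \<T>"
    and eq: "\<And>p. p \<in> P1 \<T> \<Longrightarrow> L2_inner \<Omega> q p = - L2_inner \<Omega> (grad_vec \<Omega> u) (grad_vec \<Omega> (nodal_multiple u p))"
  shows "L2_norm \<Omega> q \<le> L2_norm \<Omega> (grad_vec \<Omega> u) * sqrt (CARD('m) * 4 ^ (CARD('n) + 1)) / (c * h)"
proof -
  let ?C = "L2_norm \<Omega> (grad_vec \<Omega> u) * sqrt (CARD('m) * 4 ^ (CARD('n) + 1)) / (c * h)"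
  have n0: "L2_norm \<Omega> w \<ge> 0" for w :: "real^'n \<Rightarrow> real^'n^'m" unfolding L2_norm_def by (simp add: L2_inner_def)
  have q0: "L2_norm \<Omega> q \<ge> 0" unfolding L2_norm_def by (simp add: L2_inner_def)
  have "L2_norm \<Omega> q * L2_norm \<Omega> q = L2_inner \<Omega> q q" unfolding L2_norm_def by (simp add: L2_inner_def)
  also have "\<dots> \<le> ?C * L2_norm \<Omega> q" using eq[OF q] multiplier_test_bound(1)[OF u q] by simp
  finally have *: "L2_norm \<Omega> q * L2_norm \<Omega> q \<le> ?C * L2_norm \<Omega> q" .
  show ?thesis
  proof (cases "L2_norm \<Omega> q = 0")
    case True then show ?thesis using n0 ch_pos by simp
  next
    case False
    then have "L2_norm \<Omega> q > 0" using q0 by linarith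
    with * show ?thesis by (rule mult_right_le_imp_le)
  qed
qed

end

definition interp_const :: "nat \<Rightarrow> real \<Rightarrow> real \<Rightarrow> real" where
  "interp_const n \<kappa> c = (2 * \<kappa>\<^sup>2 + 2 ^ (n + 4)) * ((\<kappa> + 4 + c) / c) ^ n"

definition inverse_const :: "nat \<Rightarrow> nat \<Rightarrow> real \<Rightarrow> real" where
  "inverse_const m n c = sqrt (m * 4 ^ (n + 1)) / c"

text \<open>The summands follow the splitting of the test function: 1 / c belongs to the derivative
  on u in the discrete part, the bracket to the gradient of the quasi-interpolant and to its L^2
  error times the inverse estimate, the last summand to meshes with h \<ge> \<open>h0\<close>, with
  V the volume of \<Omega>.\<close>

definition dual_const :: "nat \<Rightarrow> nat \<Rightarrow> real \<Rightarrow> real \<Rightarrow> real \<Rightarrow> real \<Rightarrow> real" where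
  "dual_const m n c \<kappa> h0 V = 1 / c + (sqrt m * sqrt (interp_const n \<kappa> c / c\<^sup>2) / c
     + inverse_const m n c * sqrt ((n + 1) * interp_const n \<kappa> c)) + inverse_const m n c * sqrt V / h0"

lemma L2_norm_nonneg: "L2_norm \<Omega> f \<ge> 0"
  by (simp add: L2_norm_def L2_inner_def)

lemma L2_inner_cauchy_schwarz:
  fixes f g :: "'a::euclidean_space \<Rightarrow> real"
  assumes "f \<in> borel_measurable (lebesgue_on \<Omega>)" "g \<in> borel_measurable (lebesgue_on \<Omega>)"
    and "integrable (lebesgue_on \<Omega>) (\<lambda>x. (f x)\<^sup>2)" "integrable (lebesgue_on \<Omega>) (\<lambda>x. (g x)\<^sup>2)"
  shows "\<bar>L2_inner \<Omega> f g\<bar> \<le> L2_norm \<Omega> f * L2_norm \<Omega> g"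
  using integral_cauchy_schwarz[OF assms] by (simp add: L2_inner_def L2_norm_def power2_eq_square)

context fe_mesh
begin

lemma interp_const_nonneg: "\<kappa> \<ge> 0 \<Longrightarrow> interp_const n \<kappa> c \<ge> 0"
  using c_pos by (auto simp: interp_const_def)

lemma inverse_const_nonneg: "inverse_const m n c \<ge> 0"
  using c_pos by (auto simp: inverse_const_def)

lemma multiplier_dual_bound:
  fixes u :: "real^'n \<Rightarrow> real^'m"
  assumes u: "u \<in> P1_vec \<T>" "\<And>a. a \<in> nodes \<T> \<Longrightarrow> norm (u a) = 1" and q: "q \<in> P1 \<T>"
    and eq: "\<And>p. p \<in> P1 \<T> \<Longrightarrow> L2_inner \<Omega> q p = - L2_inner \<Omega> (grad_vec \<Omega> u) (grad_vec \<Omega> (nodal_multiple u p))"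
    and \<kappa>: "\<kappa> \<ge> 0" and h0: "h0 > 0"
    and push: "\<And>a. a \<in> closure \<Omega> \<Longrightarrow> h < h0 \<Longrightarrow> \<exists>w. norm w \<le> \<kappa> * h \<and> ball (a - w) (2 * h) \<subseteq> \<Omega> \<and>
         (\<forall>x\<in>\<Omega> \<inter> ball a (2 * h). \<forall>s. 0 \<le> s \<and> s \<le> 1 \<longrightarrow> x - s *\<^sub>R w \<in> \<Omega>)"
    and ne: "\<Omega> \<noteq> {}" and f: "f \<in> H1 \<Omega>" "f \<in> Linf \<Omega>"
  defines "U \<equiv> L2_norm \<Omega> (grad_vec \<Omega> u)"
  shows "\<bar>L2_inner \<Omega> q f\<bar> \<le> dual_const CARD('m) CARD('n) c \<kappa> h0 (measure lebesgue \<Omega>) * (1 + U) * U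
    * (L2_norm \<Omega> (grad \<Omega> f) + Linf_norm \<Omega> f)"
proof -
  define ic where "ic = interp_const CARD('n) \<kappa> c"
  define inv where "inv = inverse_const CARD('m) CARD('n) c"
  define Q where "Q = Linf_norm \<Omega> f"
  define g where "g = L2_norm \<Omega> (grad \<Omega> f)"
  define V where "V = measure lebesgue \<Omega>"
  have ic0: "ic \<ge> 0" unfolding ic_def by (rule interp_const_nonneg[OF \<kappa>])
  have inv0: "inv \<ge> 0" unfolding inv_def by (rule inverse_const_nonneg)
  have U0: "U \<ge> 0" and g0: "g \<ge> 0" unfolding U_def g_def by (rule L2_norm_nonneg)+
  have Q: "AE x in lebesgue_on \<Omega>. \<bar>f x\<bar> \<le> Q" "Q \<ge> 0"
    using Linf_norm_bound[OF open_domain ne f(2)] by (auto simp: Q_def)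
  have fm: "f \<in> borel_measurable (lebesgue_on \<Omega>)" and f2: "integrable (lebesgue_on \<Omega>) (\<lambda>x. (f x)\<^sup>2)"
    using f(1) by (auto simp: H1_def L2_def)
  note qm = P1_measurable[OF q] and q2 = P1_square_integrable(1)[OF q]
  have qle: "L2_norm \<Omega> q \<le> U * inv / h"
    using multiplier_L2_bound[OF u q eq] by (simp add: U_def inv_def inverse_const_def)
  interpret finite_measure "lebesgue_on \<Omega>" by (rule finite_measure_domain)
  have V0: "V \<ge> 0" by (simp add: V_def)
  define A1 A2 A3 where "A1 = 1 / c" and "A2 = sqrt CARD('m) * sqrt (ic / c\<^sup>2) / c + inv * sqrt ((CARD('n) + 1) * ic)"
    and "A3 = inv * sqrt V / h0"
  have A0: "A1 \<ge> 0" "A2 \<ge> 0" "A3 \<ge> 0"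
    using c_pos ic0 inv0 h0 V0 by (auto simp: A1_def A2_def A3_def)
  \<comment> \<open>A common majorant for the three kinds of terms: 1 + U covers both the linear and
    the quadratic dependence on U, one factor U being kept outside.\<close>
  have mono: "X \<le> (1 + U) * (g + Q)" if "X = U * Q \<or> X = g \<or> X = Q" for X
    using that U0 g0 Q(2) by (auto simp: algebra_simps)
  have "\<bar>L2_inner \<Omega> q f\<bar> \<le> U * (A1 * (U * Q) + A2 * g + A3 * Q)"
  proof (cases "h < h0")
    case True
    obtain q0 G0 where wg: "weak_grad_pair \<Omega> q0 G0" "AE x in lebesgue_on \<Omega>. f x = q0 x"
      "(LINT x:\<Omega>|lborel. (norm (G0 x))\<^sup>2) = g\<^sup>2"
      unfolding g_def by (rule H1_weak_grad_pair[OF open_domain bounded_domain f(1)])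
    have q0b: "q0 \<in> borel_measurable borel" using wg(1) by (simp add: weak_grad_pair_def)
    have q0m: "q0 \<in> borel_measurable (lebesgue_on \<Omega>)"
      using q0b by (intro measurable_restrict_space1 measurable_completion) simp
    have "AE x in lebesgue_on \<Omega>. \<bar>q0 x\<bar> \<le> Q" using Q(1) wg(2) by eventually_elim simp
    then have "AE x in lebesgue. x \<in> \<Omega> \<longrightarrow> \<bar>q0 x\<bar> \<le> Q"
      by (subst (asm) AE_restrict_space_iff) (auto simp: domain_sets)
    then have Q': "AE x in lborel. x \<in> \<Omega> \<longrightarrow> \<bar>q0 x\<bar> \<le> Q" by (simp add: AE_completion_iff)
    obtain p where p: "p \<in> P1 \<T>" "\<And>a. a \<in> nodes \<T> \<Longrightarrow> \<bar>p a\<bar> \<le> Q"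
      "(\<Sum>K\<in>\<T>. area K * (norm (elgrad p K))\<^sup>2) \<le> ic / c\<^sup>2 * g\<^sup>2"
      "(\<Sum>K\<in>\<T>. LINT x|lebesgue_on (interior K). (q0 x - p x)\<^sup>2) \<le> (CARD('n) + 1) * ic * h\<^sup>2 * g\<^sup>2"
    proof (rule quasi_interpolant[OF \<kappa> push[OF _ True] wg(1) Q' Q(2)])
      fix p assume p: "p \<in> P1 \<T>" "\<And>a. a \<in> nodes \<T> \<Longrightarrow> \<bar>p a\<bar> \<le> Q"
        "(\<Sum>K\<in>\<T>. area K * (norm (elgrad p K))\<^sup>2)
          \<le> (2 * \<kappa>\<^sup>2 + 2 ^ (CARD('n) + 4)) * ((\<kappa> + 4 + c) / c) ^ CARD('n) / c\<^sup>2 * (LINT x:\<Omega>|lborel. (norm (G0 x))\<^sup>2)"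
        "(\<Sum>K\<in>\<T>. LINT x|lebesgue_on (interior K). (q0 x - p x)\<^sup>2)
          \<le> (CARD('n) + 1) * (2 * \<kappa>\<^sup>2 + 2 ^ (CARD('n) + 4)) * ((\<kappa> + 4 + c) / c) ^ CARD('n) * h\<^sup>2 * (LINT x:\<Omega>|lborel. (norm (G0 x))\<^sup>2)"
      show thesis
        by (rule that[OF p(1,2)]) (use p(3,4) in \<open>simp_all only: wg(3) ic_def interp_const_def mult.assoc\<close>)
    qed auto
    have q02: "integrable (lebesgue_on \<Omega>) (\<lambda>x. (q0 x)\<^sup>2)"
    proof (rule integrable_cong_AE_imp[OF f2])
      show "AE x in lebesgue_on \<Omega>. (f x)\<^sup>2 = (q0 x)\<^sup>2" using wg(2) by eventually_elim simp
    qed (use q0m in measurable)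
    note pm = P1_measurable[OF p(1)] and p2 = P1_square_integrable(1)[OF p(1)]
    have d2: "integrable (lebesgue_on \<Omega>) (\<lambda>x. (q0 x - p x)\<^sup>2)"
      by (rule integrable_diff_square[OF q0m pm q02 p2])
    have dm: "(\<lambda>x. q0 x - p x) \<in> borel_measurable (lebesgue_on \<Omega>)" using q0m pm by measurable
    have "L2_inner \<Omega> q f = (LINT x|lebesgue_on \<Omega>. q x * p x + q x * (q0 x - p x))"
      unfolding L2_inner_def
    proof (rule integral_cong_AE)
      show "AE x in lebesgue_on \<Omega>. q x \<bullet> f x = q x * p x + q x * (q0 x - p x)"
        using wg(2) by eventually_elim (simp add: algebra_simps)
    qed (use qm fm pm dm in measurable)
    also have "\<dots> = L2_inner \<Omega> q p + L2_inner \<Omega> q (\<lambda>x. q0 x - p x)"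
      unfolding L2_inner_def
      using integrable_mult_if_squares[OF qm pm q2 p2] integrable_mult_if_squares[OF qm dm q2 d2] by simp
    finally have split: "L2_inner \<Omega> q f = L2_inner \<Omega> q p + L2_inner \<Omega> q (\<lambda>x. q0 x - p x)" .
    have "sqrt (\<Sum>K\<in>\<T>. area K * (norm (elgrad p K))\<^sup>2) \<le> sqrt (ic / c\<^sup>2 * g\<^sup>2)"
      using p(3) by (rule real_sqrt_le_mono)
    also have "\<dots> = sqrt (ic / c\<^sup>2) * g" using g0 by (simp only: real_sqrt_mult real_sqrt_abs abs_of_nonneg)
    finally have S: "sqrt (\<Sum>K\<in>\<T>. area K * (norm (elgrad p K))\<^sup>2) \<le> sqrt (ic / c\<^sup>2) * g" .
    have "\<bar>L2_inner \<Omega> q p\<bar> \<le> U / c * (Q * U + sqrt CARD('m) * sqrt (\<Sum>K\<in>\<T>. area K * (norm (elgrad p K))\<^sup>2))"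
      using multiplier_test_bound(2)[OF u p(1), of Q] p(2) Q(2) eq[OF p(1)] by (simp add: U_def)
    also have "\<dots> \<le> U / c * (Q * U + sqrt CARD('m) * (sqrt (ic / c\<^sup>2) * g))"
      using U0 c_pos S by (intro mult_left_mono add_left_mono) auto
    also have "\<dots> = U * (A1 * (U * Q) + sqrt CARD('m) * sqrt (ic / c\<^sup>2) / c * g)"
      using c_pos by (simp add: A1_def field_simps)
    finally have 1: "\<bar>L2_inner \<Omega> q p\<bar> \<le> U * (A1 * (U * Q) + sqrt CARD('m) * sqrt (ic / c\<^sup>2) / c * g)" .
    have "(L2_norm \<Omega> (\<lambda>x. q0 x - p x))\<^sup>2 = (LINT x|lebesgue_on \<Omega>. (q0 x - p x)\<^sup>2)"
      unfolding L2_norm_def L2_inner_def by (subst real_sqrt_pow2) (simp_all flip: power2_eq_square)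
    also have "\<dots> = (\<Sum>K\<in>\<T>. LINT x|lebesgue_on (interior K). (q0 x - p x)\<^sup>2)"
      by (rule integral_split_elements(1)[OF d2])
    also have "\<dots> \<le> (CARD('n) + 1) * ic * h\<^sup>2 * g\<^sup>2" by (rule p(4))
    finally have "L2_norm \<Omega> (\<lambda>x. q0 x - p x) \<le> sqrt ((CARD('n) + 1) * ic * h\<^sup>2 * g\<^sup>2)" by (rule real_le_rsqrt)
    also have "\<dots> = sqrt ((CARD('n) + 1) * ic) * (h * g)"
      using g0 h_pos by (simp add: real_sqrt_mult)
    finally have err: "L2_norm \<Omega> (\<lambda>x. q0 x - p x) \<le> sqrt ((CARD('n) + 1) * ic) * (h * g)" .
    have "\<bar>L2_inner \<Omega> q (\<lambda>x. q0 x - p x)\<bar> \<le> L2_norm \<Omega> q * L2_norm \<Omega> (\<lambda>x. q0 x - p x)"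
      by (rule L2_inner_cauchy_schwarz[OF qm dm q2 d2])
    also have "\<dots> \<le> (U * inv / h) * (sqrt ((CARD('n) + 1) * ic) * (h * g))"
      using U0 inv0 h_pos by (intro mult_mono qle err L2_norm_nonneg) auto
    also have "\<dots> = U * (inv * sqrt ((CARD('n) + 1) * ic) * g)" using h_pos by simp
    finally have "\<bar>L2_inner \<Omega> q f\<bar> \<le> U * (A1 * (U * Q) + sqrt CARD('m) * sqrt (ic / c\<^sup>2) / c * g)
        + U * (inv * sqrt ((CARD('n) + 1) * ic) * g)"
      unfolding split using 1 by linarith
    also have "\<dots> = U * (A1 * (U * Q) + A2 * g)" by (simp add: A2_def algebra_simps)
    also have "\<dots> \<le> U * (A1 * (U * Q) + A2 * g + A3 * Q)" using U0 A0 Q(2) by (intro mult_left_mono) auto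
    finally show ?thesis .
  next
    \<comment> \<open>Coarse mesh: f is not approximated at all. Its L^2 norm is at most sqrt V
      times the sup norm, and 1/h \<le> 1/\<open>h0\<close>.\<close>
    case False
    have "(L2_norm \<Omega> f)\<^sup>2 = (LINT x|lebesgue_on \<Omega>. (f x)\<^sup>2)"
      unfolding L2_norm_def L2_inner_def by (subst real_sqrt_pow2) (simp_all flip: power2_eq_square)
    also have "\<dots> \<le> (LINT x|lebesgue_on \<Omega>. Q\<^sup>2)"
    proof (rule integral_mono_AE[OF f2])
      show "AE x in lebesgue_on \<Omega>. (f x)\<^sup>2 \<le> Q\<^sup>2"
        using Q(1) by eventually_elim (metis abs_ge_zero power2_abs power_mono)
    qed simp
    also have "\<dots> = V * Q\<^sup>2" by (simp add: V_def measure_restrict_space domain_sets)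
    finally have "L2_norm \<Omega> f \<le> sqrt (V * Q\<^sup>2)" by (rule real_le_rsqrt)
    then have fle: "L2_norm \<Omega> f \<le> sqrt V * Q" using Q(2) by (simp add: real_sqrt_mult)
    have "\<bar>L2_inner \<Omega> q f\<bar> \<le> L2_norm \<Omega> q * L2_norm \<Omega> f"
      by (rule L2_inner_cauchy_schwarz[OF qm fm q2 f2])
    also have "\<dots> \<le> (U * inv / h) * (sqrt V * Q)"
      using U0 inv0 h_pos by (intro mult_mono qle fle L2_norm_nonneg) auto
    also have "\<dots> \<le> (U * inv / h0) * (sqrt V * Q)"
      using False U0 inv0 h0 Q(2) V0 by (intro mult_right_mono divide_left_mono) auto
    also have "\<dots> = U * (A3 * Q)" by (simp add: A3_def)
    also have "\<dots> \<le> U * (A1 * (U * Q) + A2 * g + A3 * Q)" using U0 A0 Q(2) g0 by (intro mult_left_mono) auto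
    finally show ?thesis .
  qed
  also have "\<dots> \<le> U * (A1 * ((1 + U) * (g + Q)) + A2 * ((1 + U) * (g + Q)) + A3 * ((1 + U) * (g + Q)))"
    using U0 A0 mono by (intro mult_left_mono add_mono) auto
  also have "\<dots> = (A1 + A2 + A3) * (1 + U) * U * (g + Q)" by (simp add: algebra_simps)
  also have "A1 + A2 + A3 = dual_const CARD('m) CARD('n) c \<kappa> h0 (measure lebesgue \<Omega>)"
    by (simp add: A1_def A2_def A3_def dual_const_def ic_def inv_def V_def)
  finally show ?thesis by (simp add: g_def Q_def)
qed

text \<open>A real \<open>SUP\<close> is meaningful for a nonempty set bounded above; the constant
  function 1 provides an element and the hypothesis a bound. The estimate is two-sided because the
  dual norm is squared in the time integral.\<close>

lemma dual_norm_bound: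
  assumes ne: "\<Omega> \<noteq> {}"
    and le: "\<And>f. f \<in> H1 \<Omega> \<Longrightarrow> f \<in> Linf \<Omega> \<Longrightarrow> \<bar>L2_inner \<Omega> q f\<bar> \<le> B * (L2_norm \<Omega> (grad \<Omega> f) + Linf_norm \<Omega> f)"
  shows "\<bar>H1Linf_dual_norm \<Omega> q\<bar> \<le> B"
proof -
  let ?S = "{f \<in> H1 \<Omega> \<inter> Linf \<Omega>. Linf_norm \<Omega> f \<noteq> 0}"
  let ?r = "\<lambda>f. L2_inner \<Omega> q f / (L2_norm \<Omega> (grad \<Omega> f) + Linf_norm \<Omega> f)"
  have r: "\<bar>?r f\<bar> \<le> B" if f: "f \<in> ?S" for f
  proof -
    have d: "L2_norm \<Omega> (grad \<Omega> f) + Linf_norm \<Omega> f > 0"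
      using f Linf_norm_bound(2)[OF open_domain ne, of f] L2_norm_nonneg[of \<Omega> "grad \<Omega> f"] by auto
    then have "\<bar>?r f\<bar> = \<bar>L2_inner \<Omega> q f\<bar> / (L2_norm \<Omega> (grad \<Omega> f) + Linf_norm \<Omega> f)" by simp
    also have "\<dots> \<le> B" using le[of f] f d by (simp add: pos_divide_le_eq)
    finally show ?thesis .
  qed
  have one: "(\<lambda>_. 1) \<in> ?S"
  proof -
    have "(\<lambda>_. 1) \<in> P1 \<T>" by (rule P1_const)
    then have "(\<lambda>_. 1) \<in> H1 \<Omega>" unfolding H1_def using P1_L2 pgrad_L2 P1_has_weak_grad by blast
    moreover have "esssup (lebesgue_on \<Omega>) (\<lambda>x. ereal \<bar>1\<bar>) = ereal \<bar>1\<bar>"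
    proof (rule esssup_const)
      show "emeasure (lebesgue_on \<Omega>) (space (lebesgue_on \<Omega>)) \<noteq> 0"
        using open_not_negligible[OF open_domain ne] domain_sets
        by (auto simp: emeasure_restrict_space negligible_iff_null_sets null_sets_def)
    qed
    ultimately show ?thesis by (simp add: Linf_def Linf_norm_def)
  qed
  have bdd: "bdd_above (?r ` ?S)" 
  proof (rule bdd_aboveI2)
    fix f assume "f \<in> ?S"
    from r[OF this] show "?r f \<le> B" by linarith
  qed
  have "H1Linf_dual_norm \<Omega> q \<le> B"
    unfolding H1Linf_dual_norm_def
  proof (rule cSUP_least)
    fix f assume "f \<in> ?S"
    from r[OF this] show "?r f \<le> B" by linarith
  qed (use one in blast)
  moreover have "- B \<le> ?r (\<lambda>_. 1)" using r[OF one] by linarith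
  then have "- B \<le> H1Linf_dual_norm \<Omega> q"
    unfolding H1Linf_dual_norm_def using cSUP_upper[OF one bdd] by linarith
  ultimately show ?thesis by linarith
qed

end

section \<open>The semidiscrete problem\<close>

text \<open>Derivatives are taken within the half-line; nontriviality of the filter makes them
  unique, also the one-sided one at t = 0.\<close>

lemma at_within_Ici_neq_bot: "0 \<le> t \<Longrightarrow> at t within {0::real..} \<noteq> bot"
proof -
  assume "0 \<le> t"
  then have "at_right t \<le> at t within {0..}" by (intro at_le) auto
  then show ?thesis using trivial_limit_at_right_real[of t] by (metis bot.extremum_uniqueI trivial_limit_def)
qed

lemma antisymmetric_sum_zero:
  fixes f :: "'i \<Rightarrow> 'i \<Rightarrow> real"
  assumes "\<And>i j. f i j = - f j i"
  shows "(\<Sum>i\<in>A. \<Sum>j\<in>A. f i j) = 0"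
proof -
  have "(\<Sum>i\<in>A. \<Sum>j\<in>A. f i j) = (\<Sum>j\<in>A. \<Sum>i\<in>A. f i j)" by (rule sum.swap)
  also have "\<dots> = (\<Sum>j\<in>A. \<Sum>i\<in>A. - f j i)" by (intro sum.cong refl assms)
  finally have "(\<Sum>i\<in>A. \<Sum>j\<in>A. f i j) = (\<Sum>j\<in>A. \<Sum>i\<in>A. - f j i)" .
  then show ?thesis by (simp add: sum_negf)
qed

lemma levi_civita_swap:
  "levi_civita i j k = - levi_civita j i k" "levi_civita i j k = - levi_civita k j i"
  by (auto simp: levi_civita_def Let_def)

text \<open>The alternating symbol changes sign when two indices are exchanged, while the product
  with the repeated vector is symmetric in them. For the second argument these indices are i and k,
  so the sum over j is first moved outside. The argument is the same for two and for three
  indices.\<close>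

lemma vcross_orthogonal:
  fixes a b :: "real^'n::{finite,linorder}"
  shows "vcross a b \<bullet> a = 0" "vcross a b \<bullet> b = 0"
proof -
  have "vcross a b \<bullet> a = (\<Sum>i\<in>UNIV. \<Sum>j\<in>UNIV. \<Sum>k\<in>UNIV. levi_civita i j k * a $ j * b $ k * a $ i)"
    by (simp add: vcross_def inner_vec_def sum_distrib_right)
  also have "\<dots> = 0"
    by (rule antisymmetric_sum_zero, subst levi_civita_swap(1)) (simp add: sum_negf mult_ac)
  finally show "vcross a b \<bullet> a = 0" .
  have "vcross a b \<bullet> b = (\<Sum>i\<in>UNIV. \<Sum>j\<in>UNIV. \<Sum>k\<in>UNIV. levi_civita i j k * a $ j * b $ k * b $ i)"
    by (simp add: vcross_def inner_vec_def sum_distrib_right)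
  also have "\<dots> = (\<Sum>j\<in>UNIV. \<Sum>i\<in>UNIV. \<Sum>k\<in>UNIV. levi_civita i j k * a $ j * b $ k * b $ i)"
    by (rule sum.swap)
  also have "\<dots> = (\<Sum>j\<in>(UNIV::'n set). 0)"
    by (intro sum.cong refl antisymmetric_sum_zero, subst levi_civita_swap(2)) (simp add: mult_ac)
  finally show "vcross a b \<bullet> b = 0" by simp
qed

section \<open>Nodal constraint, time derivative and energy\<close>

context fe_mesh
begin

lemma nodal_interp_cong:
  "(\<And>a. a \<in> nodes \<T> \<Longrightarrow> f a = g a) \<Longrightarrow> nodal_interp \<T> f = nodal_interp \<T> g"
  by (auto simp: nodal_interp_def intro!: sum.cong)

lemma lumped_inner_zero:
  fixes v w :: "real^'n \<Rightarrow> real^'m"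
  assumes "\<And>a. a \<in> nodes \<T> \<Longrightarrow> v a \<bullet> w a = 0"
  shows "lumped_inner \<Omega> \<T> v w = 0"
proof -
  have "nodal_interp \<T> (\<lambda>y. v y \<bullet> w y) = nodal_interp \<T> (\<lambda>y. 0)"
    by (rule nodal_interp_cong[OF assms])
  then show ?thesis by (simp add: lumped_inner_def nodal_interp_def)
qed

text \<open>The interpolated integrand is affine on each element with nonnegative vertex values,
  hence nonnegative between the nodes too.\<close>

lemma lumped_inner_self_nonneg:
  fixes v :: "real^'n \<Rightarrow> real^'m"
  shows "lumped_inner \<Omega> \<T> v v \<ge> 0"
proof -
  have "0 \<le> nodal_interp \<T> (\<lambda>y. v y \<bullet> v y) x" if "x \<in> \<Omega>" for x
  proof -
    obtain K where K: "K \<in> \<T>" "x \<in> K" using \<open>x \<in> \<Omega>\<close> Union_mesh closure_subset by blast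
    show ?thesis
      by (rule P1_ge_verts[OF nodal_interp_P1 K]) (simp add: nodal_interp_node verts_nodes[OF K(1)])
  qed
  then show ?thesis unfolding lumped_inner_def by (intro integral_nonneg_AE AE_I2) simp
qed

lemma P1_zero_if_norm_zero:
  assumes "w \<in> P1 \<T>" "(LINT x|lebesgue_on \<Omega>. (w x)\<^sup>2) = 0" "a \<in> nodes \<T>"
  shows "w a = 0"
proof -
  obtain K where K: "K \<in> \<T>" "a \<in> verts K" using assms(3) unfolding nodes_eq by blast
  have "(\<Sum>K\<in>\<T>. LINT x|lebesgue_on (interior K). (w x)\<^sup>2) = 0"
    using assms(2) integral_split_elements(1)[OF P1_square_integrable(1)[OF assms(1)]] by simp
  then have "(LINT x|lebesgue_on (interior K). (w x)\<^sup>2) = 0"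
    using sum_nonneg_0[OF finite_mesh _ _ K(1), of "\<lambda>K. LINT x|lebesgue_on (interior K). (w x)\<^sup>2"] by simp
  then have "area K * (w a)\<^sup>2 \<le> 0" using nodal_value_le_integral[OF assms(1) K] by simp
  then show ?thesis using area_pos[OF K(1)] by (simp add: mult_le_0_iff)
qed

text \<open>The defect, that is the interpolant of |u|^2 minus 1, is itself a discrete function and
  may be used as test function. Its L^2 norm then vanishes, which forces a discrete function to be
  zero at every node.\<close>

lemma unit_length_constraint:
  fixes u :: "real^'n \<Rightarrow> real^'m"
  assumes "\<And>p. p \<in> P1 \<T> \<Longrightarrow> L2_inner \<Omega> (nodal_interp \<T> (\<lambda>x. u x \<bullet> u x)) p = L2_inner \<Omega> (\<lambda>_. 1) p"
    and a: "a \<in> nodes \<T>"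
  shows "norm (u a) = 1"
proof -
  let ?I = "nodal_interp \<T> (\<lambda>x. u x \<bullet> u x)"
  define w where "w x = 1 * ?I x + (-1) * 1" for x
  have w: "w \<in> P1 \<T>" unfolding w_def[abs_def] by (rule P1_add[OF nodal_interp_P1 P1_const])
  note prod = integrable_mult_if_squares[OF P1_measurable P1_measurable P1_square_integrable(1) P1_square_integrable(1)]
  have "(LINT x|lebesgue_on \<Omega>. (w x)\<^sup>2) = (LINT x|lebesgue_on \<Omega>. ?I x * w x - 1 * w x)"
    by (intro Bochner_Integration.integral_cong refl) (simp add: w_def power2_eq_square algebra_simps)
  also have "\<dots> = (LINT x|lebesgue_on \<Omega>. ?I x * w x) - (LINT x|lebesgue_on \<Omega>. 1 * w x)"
    by (intro Bochner_Integration.integral_diff prod nodal_interp_P1 P1_const w)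
  also have "\<dots> = 0" using assms(1)[OF w] by (simp add: L2_inner_def)
  finally have "w a = 0" by (rule P1_zero_if_norm_zero[OF w _ a])
  then have "u a \<bullet> u a = 1" by (simp add: w_def nodal_interp_node[OF a])
  then show ?thesis by (simp add: norm_eq_1)
qed

lemma smooth_curve_has_derivative:
  fixes w :: "real \<Rightarrow> real^'n \<Rightarrow> 'b::real_normed_vector"
  assumes "smooth_curve \<T> V w" "x \<in> closure \<Omega>" "t \<ge> 0"
  shows "((\<lambda>s. w s x) has_vector_derivative dt w t x) (at t within {0..})"
proof -
  have "Ck_on (Suc 0) {0..} (\<lambda>t. w t x)"
    using assms(1,2) Union_mesh unfolding smooth_curve_def smooth_on_def by blast
  then have "(\<lambda>t. w t x) differentiable (at t within {0..})"
    using assms(3) by (simp add: differentiable_on_def)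
  then show ?thesis unfolding dt_def by (rule vector_derivative_works[THEN iffD1])
qed

text \<open>Smoothness of a curve is stated pointwise in space. The nodal representation with fixed
  hat functions turns u into a finite sum whose coefficients alone depend on time, so the derivative
  is again discrete and element gradients commute with it.\<close>

lemma dt_P1_vec:
  fixes u :: "real \<Rightarrow> real^'n \<Rightarrow> real^'m"
  assumes sc: "smooth_curve \<T> (P1_vec \<T>) u" and t: "t \<ge> 0"
  shows "dt u t \<in> P1_vec \<T>"
    and "K \<in> \<T> \<Longrightarrow> ((\<lambda>s. elgrad (\<lambda>y. u s y $ i) K) has_vector_derivative elgrad (\<lambda>y. dt u t y $ i) K) (at t within {0..})"
proof -
  have uP: "(\<lambda>y. u s y $ i) \<in> P1 \<T>" if "s \<ge> 0" for s i
    using sc that by (auto simp: smooth_curve_def P1_vec_def)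
  have comp: "((\<lambda>s. u s x $ i) has_vector_derivative dt u t x $ i) (at t within {0..})" if "x \<in> closure \<Omega>" for x i
    using bounded_linear.has_vector_derivative[OF bounded_linear_vec_nth smooth_curve_has_derivative[OF sc that t]] .
  have eqn: "dt u t x $ i = nodal_interp \<T> (\<lambda>y. dt u t y $ i) x" if x: "x \<in> closure \<Omega>" for x i
  proof -
    have "((\<lambda>s. nodal_interp \<T> (\<lambda>y. u s y $ i) x) has_vector_derivative nodal_interp \<T> (\<lambda>y. dt u t y $ i) x) (at t within {0..})"
      unfolding nodal_interp_def
      by (intro has_vector_derivative_sum has_vector_derivative_mult_left comp) (use nodes_subset in blast)
    then have "((\<lambda>s. u s x $ i) has_vector_derivative nodal_interp \<T> (\<lambda>y. dt u t y $ i) x) (at t within {0..})"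
      by (rule has_vector_derivative_transform[rotated 2]) (use t nodal_interp_of_P1[OF uP x] in auto)
    then show ?thesis using comp[OF x] at_within_Ici_neq_bot[OF t] by (intro vector_derivative_unique_within)
  qed
  show "dt u t \<in> P1_vec \<T>"
    unfolding P1_vec_def using P1_cong(1)[OF nodal_interp_P1] eqn by simp
  assume K: "K \<in> \<T>"
  have 1: "elgrad (\<lambda>y. dt u t y $ i) K = (\<Sum>a\<in>nodes \<T>. dt u t a $ i *\<^sub>R elgrad (hat \<T> a) K)"
    using P1_cong(2)[OF nodal_interp_P1 eqn K] elgrad_nodal_interp[OF K] by simp
  have 2: "elgrad (\<lambda>y. u s y $ i) K = (\<Sum>a\<in>nodes \<T>. u s a $ i *\<^sub>R elgrad (hat \<T> a) K)" if "s \<ge> 0" for s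
    using P1_cong(2)[OF nodal_interp_P1 nodal_interp_of_P1[OF uP[OF that], symmetric] K] elgrad_nodal_interp[OF K] by simp
  have "((\<lambda>s. \<Sum>a\<in>nodes \<T>. u s a $ i *\<^sub>R elgrad (hat \<T> a) K) has_vector_derivative
      (\<Sum>a\<in>nodes \<T>. dt u t a $ i *\<^sub>R elgrad (hat \<T> a) K)) (at t within {0..})"
    by (intro has_vector_derivative_sum bounded_linear.has_vector_derivative[OF bounded_linear_scaleR_left] comp)
      (use nodes_subset in blast)
  then show "((\<lambda>s. elgrad (\<lambda>y. u s y $ i) K) has_vector_derivative elgrad (\<lambda>y. dt u t y $ i) K) (at t within {0..})"
    unfolding 1 by (rule has_vector_derivative_transform[rotated 2]) (use t 2 in auto)
qed

text \<open>The curve enters the energy only through finitely many element gradients, differentiable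
  by \<open>dt_P1_vec\<close>, with weights that do not depend on time.\<close>

lemma energy_has_derivative:
  fixes u :: "real \<Rightarrow> real^'n \<Rightarrow> real^'m"
  assumes sc: "smooth_curve \<T> (P1_vec \<T>) u" and t: "t \<ge> 0"
  shows "((\<lambda>s. (L2_norm \<Omega> (grad_vec \<Omega> (u s)))\<^sup>2) has_vector_derivative
     2 * L2_inner \<Omega> (grad_vec \<Omega> (u t)) (grad_vec \<Omega> (dt u t))) (at t within {0..})"
proof -
  have uP: "u s \<in> P1_vec \<T>" if "s \<ge> 0" for s using sc that by (auto simp: smooth_curve_def)
  let ?g = "\<lambda>s K i. elgrad (\<lambda>y. u s y $ i) K" and ?d = "\<lambda>K i. elgrad (\<lambda>y. dt u t y $ i) K"
  have sq: "((\<lambda>s. ?g s K i \<bullet> ?g s K i) has_vector_derivative ?g t K i \<bullet> ?d K i + ?d K i \<bullet> ?g t K i) (at t within {0..})"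
    if "K \<in> \<T>" for K i
    by (rule bounded_bilinear.has_vector_derivative[OF bounded_bilinear_inner dt_P1_vec(2)[OF sc t that] dt_P1_vec(2)[OF sc t that]])
  have "((\<lambda>s. \<Sum>K\<in>\<T>. area K * (\<Sum>i\<in>UNIV. ?g s K i \<bullet> ?g s K i)) has_vector_derivative
     (\<Sum>K\<in>\<T>. area K * (\<Sum>i\<in>UNIV. ?g t K i \<bullet> ?d K i + ?d K i \<bullet> ?g t K i))) (at t within {0..})"
    by (intro has_vector_derivative_sum has_vector_derivative_mult_right sq)
  moreover have "(\<Sum>K\<in>\<T>. area K * (\<Sum>i\<in>UNIV. ?g t K i \<bullet> ?d K i + ?d K i \<bullet> ?g t K i))
      = 2 * L2_inner \<Omega> (grad_vec \<Omega> (u t)) (grad_vec \<Omega> (dt u t))"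
    unfolding grad_vec_inner[OF uP[OF t] dt_P1_vec(1)[OF sc t]]
    by (simp add: inner_commute sum_distrib_left mult_ac flip: mult_2)
  moreover have "(\<Sum>K\<in>\<T>. area K * (\<Sum>i\<in>UNIV. ?g s K i \<bullet> ?g s K i)) = (L2_norm \<Omega> (grad_vec \<Omega> (u s)))\<^sup>2" if "s \<ge> 0" for s
  proof -
    have "(L2_norm \<Omega> (grad_vec \<Omega> (u s)))\<^sup>2 = L2_inner \<Omega> (grad_vec \<Omega> (u s)) (grad_vec \<Omega> (u s))"
      unfolding L2_norm_def by (rule real_sqrt_pow2) (simp add: L2_inner_def)
    then show ?thesis by (simp add: grad_vec_inner[OF uP[OF that] uP[OF that]])
  qed
  ultimately show ?thesis
    by (metis (no_types, lifting) atLeast_iff has_vector_derivative_transform t)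
qed

end

lemma semidiscrete_estimates:
  fixes \<Omega> :: "(real^'n::{finite,linorder}) set"
  assumes fe: "fe_mesh \<Omega> \<T> h c" and \<gamma>: "\<gamma> > 0"
    and sc: "smooth_curve \<T> (P1_vec \<T>) u" and sol: "solves_semidiscrete \<Omega> \<T> \<gamma> \<alpha> u q"
    and t: "t \<ge> 0"
  shows "a \<in> nodes \<T> \<Longrightarrow> norm (u t a) = 1"
    and "L2_inner \<Omega> (grad_vec \<Omega> (u t)) (grad_vec \<Omega> (dt u t)) \<le> 0"
    and "p \<in> P1 \<T> \<Longrightarrow> L2_inner \<Omega> (q t) p = - L2_inner \<Omega> (grad_vec \<Omega> (u t)) (grad_vec \<Omega> (fe_mesh.nodal_multiple \<T> (u t) p))"
proof -
  interpret fe_mesh \<Omega> \<T> h c by fact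
  have unit: "norm (u s a) = 1" if "s \<ge> 0" "a \<in> nodes \<T>" for s a
  proof (rule unit_length_constraint[OF _ that(2)])
    fix p assume "p \<in> P1 \<T>"
    moreover have "u s \<in> P1_vec \<T>" using sc that(1) by (simp add: smooth_curve_def)
    ultimately show "L2_inner \<Omega> (nodal_interp \<T> (\<lambda>x. u s x \<bullet> u s x)) p = L2_inner \<Omega> (\<lambda>_. 1) p"
      using sol that(1) unfolding solves_semidiscrete_def by blast
  qed
  have zero: "(\<lambda>_. 0) \<in> P1 \<T>" by (rule P1_const)
  have eqn: "lumped_inner \<Omega> \<T> (dt u t) v + \<gamma> * L2_inner \<Omega> (grad_vec \<Omega> (u t)) (grad_vec \<Omega> v)
      + \<gamma> * L2_inner \<Omega> (q t) (nodal_interp \<T> (\<lambda>x. u t x \<bullet> v x))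
      + \<alpha> * lumped_inner \<Omega> \<T> (\<lambda>x. vcross (u t x) (dt u t x)) v = 0" if "v \<in> P1_vec \<T>" for v
    using sol t that zero unfolding solves_semidiscrete_def by blast
  \<comment> \<open>This differentiates |u(a)|^2 = 1, valid for all times s \<ge> 0; at t = 0 the
    uniqueness of the one-sided derivative is used.\<close>
  have orth: "u t a \<bullet> dt u t a = 0" if a: "a \<in> nodes \<T>" for a
  proof -
    have d: "((\<lambda>s. u s a) has_vector_derivative dt u t a) (at t within {0..})"
      using smooth_curve_has_derivative[OF sc _ t] nodes_subset a by blast
    have "((\<lambda>s. u s a \<bullet> u s a) has_vector_derivative u t a \<bullet> dt u t a + dt u t a \<bullet> u t a) (at t within {0..})"
      by (rule bounded_bilinear.has_vector_derivative[OF bounded_bilinear_inner d d])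
    moreover have "((\<lambda>s. u s a \<bullet> u s a) has_vector_derivative 0) (at t within {0..})"
      by (rule has_vector_derivative_transform[OF _ _ has_vector_derivative_const[of 1]])
        (use t unit[OF _ a] in \<open>auto simp: norm_eq_1\<close>)
    ultimately have "u t a \<bullet> dt u t a + dt u t a \<bullet> u t a = 0"
      by (rule vector_derivative_unique_within[OF at_within_Ici_neq_bot[OF t]])
    then show ?thesis by (simp add: inner_commute)
  qed
  show "a \<in> nodes \<T> \<Longrightarrow> norm (u t a) = 1" using unit[OF t] .
  \<comment> \<open>The multiplier is paired with the interpolant of the scalar product and not with
    the product itself, so orthogonality at the nodes removes the term exactly.\<close>
  have "nodal_interp \<T> (\<lambda>x. u t x \<bullet> dt u t x) = nodal_interp \<T> (\<lambda>x. 0)"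
    by (rule nodal_interp_cong[OF orth])
  then have 1: "L2_inner \<Omega> (q t) (nodal_interp \<T> (\<lambda>x. u t x \<bullet> dt u t x)) = 0"
    by (simp add: L2_inner_def nodal_interp_def)
  have 2: "lumped_inner \<Omega> \<T> (\<lambda>x. vcross (u t x) (dt u t x)) (dt u t) = 0"
    by (rule lumped_inner_zero) (rule vcross_orthogonal)
  have "\<gamma> * L2_inner \<Omega> (grad_vec \<Omega> (u t)) (grad_vec \<Omega> (dt u t)) = - lumped_inner \<Omega> \<T> (dt u t) (dt u t)"
    using eqn[OF dt_P1_vec(1)[OF sc t]] 1 2 by simp
  also have "\<dots> \<le> 0" using lumped_inner_self_nonneg by simp
  finally show "L2_inner \<Omega> (grad_vec \<Omega> (u t)) (grad_vec \<Omega> (dt u t)) \<le> 0"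
    using \<gamma> by (simp add: mult_le_0_iff)
  assume p: "p \<in> P1 \<T>"
  let ?v = "nodal_multiple (u t) p"
  have va: "?v a = p a *\<^sub>R u t a" if "a \<in> nodes \<T>" for a
    using nodal_interp_node[OF that] by (simp add: nodal_multiple_def vec_eq_iff)
  have 3: "lumped_inner \<Omega> \<T> (dt u t) ?v = 0"
    by (rule lumped_inner_zero) (simp add: va orth inner_commute)
  have 4: "lumped_inner \<Omega> \<T> (\<lambda>x. vcross (u t x) (dt u t x)) ?v = 0"
    by (rule lumped_inner_zero) (simp add: va vcross_orthogonal)
  \<comment> \<open>At a node the scalar product of u with the test function is p |u|^2 = p, so
    interpolation reproduces the given p.\<close>
  have "nodal_interp \<T> (\<lambda>x. u t x \<bullet> ?v x) = nodal_interp \<T> p"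
    using unit[OF t] by (intro nodal_interp_cong) (simp add: va norm_eq_1)
  then have "L2_inner \<Omega> (q t) (nodal_interp \<T> (\<lambda>x. u t x \<bullet> ?v x)) = L2_inner \<Omega> (q t) p"
    unfolding L2_inner_def
    by (intro Bochner_Integration.integral_cong refl) (use nodal_interp_of_P1[OF p] closure_subset in auto)
  then have "\<gamma> * (L2_inner \<Omega> (grad_vec \<Omega> (u t)) (grad_vec \<Omega> ?v) + L2_inner \<Omega> (q t) p) = 0"
    using eqn[OF nodal_multiple_P1, of "u t" p] 3 4 by (simp add: algebra_simps)
  then show "L2_inner \<Omega> (q t) p = - L2_inner \<Omega> (grad_vec \<Omega> (u t)) (grad_vec \<Omega> ?v)"
    using \<gamma> by (simp add: add_eq_0_iff)
qed

lemma energy_decreasing: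
  fixes \<Omega> :: "(real^'n::{finite,linorder}) set"
  assumes fe: "fe_mesh \<Omega> \<T> h c" and \<gamma>: "\<gamma> > 0"
    and sc: "smooth_curve \<T> (P1_vec \<T>) u" and sol: "solves_semidiscrete \<Omega> \<T> \<gamma> \<alpha> u q"
    and t: "t \<ge> 0"
  shows "L2_norm \<Omega> (grad_vec \<Omega> (u t)) \<le> L2_norm \<Omega> (grad_vec \<Omega> (u 0))"
proof (cases "t = 0")
  case False
  then have t0: "0 < t" using t by simp
  interpret fe_mesh \<Omega> \<T> h c by fact
  let ?E = "\<lambda>s. (L2_norm \<Omega> (grad_vec \<Omega> (u s)))\<^sup>2"
  have d: "(?E has_derivative (\<lambda>x. x *\<^sub>R (2 * L2_inner \<Omega> (grad_vec \<Omega> (u s)) (grad_vec \<Omega> (dt u s))))) (at s within {0..t})"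
    if "0 \<le> s" "s \<le> t" for s
    using energy_has_derivative[OF sc that(1)] unfolding has_vector_derivative_def
    by (rule has_derivative_subset) auto
  obtain s where s: "s \<in> {0<..<t}"
    "?E t - ?E 0 = (t - 0) *\<^sub>R (2 * L2_inner \<Omega> (grad_vec \<Omega> (u s)) (grad_vec \<Omega> (dt u s)))"
    using mvt_simple[OF t0 d] by blast
  have "L2_inner \<Omega> (grad_vec \<Omega> (u s)) (grad_vec \<Omega> (dt u s)) \<le> 0"
    using s(1) by (intro semidiscrete_estimates(2)[OF fe \<gamma> sc sol]) auto
  then have "t * (2 * L2_inner \<Omega> (grad_vec \<Omega> (u s)) (grad_vec \<Omega> (dt u s))) \<le> 0"
    using t0 by (intro mult_nonneg_nonpos) auto
  then have "?E t \<le> ?E 0" using s(2) by simp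
  then show ?thesis using L2_norm_nonneg by (metis power2_le_imp_le)
qed simp

section \<open>Regularity constants of a mesh family and integration in time\<close>

lemma mesh_family_fe_mesh:
  fixes \<Omega> :: "(real^'n) set"
  assumes \<Omega>: "polyhedral_lipschitz_domain \<Omega>" and mf: "mesh_family \<Omega> \<sigma> \<tau> H \<T>" and h: "h \<in> H"
  shows "\<sigma> > 0" "\<tau> > 0" "fe_mesh \<Omega> (\<T> h) h (1 / (4 * \<sigma> * \<tau>))"
proof -
  have O: "open \<Omega>" "bounded \<Omega>" "\<Omega> \<noteq> {}" "lipschitz_boundary \<Omega>"
    using \<Omega> by (auto simp: polyhedral_lipschitz_domain_def)
  have M: "h > 0" "conforming_mesh \<Omega> (\<T> h)" "mesh_size (\<T> h) = h" "shape_regular \<sigma> (\<T> h)" "quasi_uniform \<tau> (\<T> h)"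
    using mf h by (auto simp: mesh_family_def)
  have fin: "finite (\<T> h)" and Un: "\<Union>(\<T> h) = closure \<Omega>"
    using M(2) by (auto simp: conforming_mesh_def triangulation_def)
  have comp: "compact K" if "K \<in> \<T> h" for K
    using M(2) that by (auto simp: conforming_mesh_def intro: compact_simplex)
  have diam: "h \<le> \<tau> * diameter K" "diameter K \<le> h" "diameter K \<le> \<sigma> * inball_diameter K" "0 \<le> diameter K" if "K \<in> \<T> h" for K
    using M(3-5) that fin diameter_ge_0[OF compact_imp_bounded[OF comp[OF that]]] Max_ge[of "diameter ` \<T> h" "diameter K"]
    by (auto simp: quasi_uniform_def shape_regular_def mesh_size_def)
  have "\<T> h \<noteq> {}" using O(3) Un closure_subset by fastforce
  then obtain K0 where K0: "K0 \<in> \<T> h" by blast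
  \<comment> \<open>The signs of \<sigma> and \<tau> are deduced: h > 0 and quasi-uniformity force
    \<tau> and every diameter to be positive, and an element exists because \<Omega> is
    nonempty.\<close>
  have d0: "\<tau> > 0 \<and> diameter K > 0" if "K \<in> \<T> h" for K
    using diam(1)[OF that] diam(4)[OF that] M(1) by (smt (verit) mult_nonneg_nonneg mult_nonpos_nonneg zero_less_mult_iff)
  then show \<tau>: "\<tau> > 0" using K0 by blast
  have ib0: "inball_diameter K \<ge> 0" and bdd: "bdd_above {2 * r | c r. 0 \<le> r \<and> cball c r \<subseteq> K}"
    and nes: "{2 * r | c r. 0 \<le> r \<and> cball c r \<subseteq> K} \<noteq> {}" if K: "K \<in> \<T> h" for K
  proof -
    have "K \<noteq> {}" using d0[OF K] by auto
    then obtain x where "x \<in> K" by blast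
    then have x: "2 * 0 \<in> {2 * r | c r. 0 \<le> r \<and> cball c r \<subseteq> K}" by (intro CollectI exI[of _ x] exI[of _ 0]) auto
    then show "{2 * r | c r. 0 \<le> r \<and> cball c r \<subseteq> K} \<noteq> {}" by blast
    have "2 * r \<le> diameter K" if "0 \<le> r" "cball y r \<subseteq> K" for y r
      using diameter_subset[OF that(2) compact_imp_bounded[OF comp[OF K]]] that(1) by simp
    then show "bdd_above {2 * r | c r. 0 \<le> r \<and> cball c r \<subseteq> K}" by (intro bdd_aboveI[where M = "diameter K"]) auto
    from cSup_upper[OF x this] show "inball_diameter K \<ge> 0" by (simp add: inball_diameter_def)
  qed
  show \<sigma>: "\<sigma> > 0"
    using diam(3)[OF K0] d0[OF K0] ib0[OF K0] by (smt (verit) mult_nonpos_nonneg)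
  show "fe_mesh \<Omega> (\<T> h) h (1 / (4 * \<sigma> * \<tau>))"
  proof
    show "open \<Omega>" "bounded \<Omega>" "interior (closure \<Omega>) = \<Omega>" "conforming_mesh \<Omega> (\<T> h)" "h > 0"
      using O M interior_closure_lipschitz by auto
    show "1 / (4 * \<sigma> * \<tau>) > 0" using \<sigma> \<tau> by simp
    fix K assume K: "K \<in> \<T> h"
    show "diameter K \<le> h" by (rule diam(2)[OF K])
    have "h \<le> \<tau> * (\<sigma> * inball_diameter K)"
      using diam(1)[OF K] mult_left_mono[OF diam(3)[OF K], of \<tau>] \<tau> by linarith
    then have "h / (2 * \<sigma> * \<tau>) < inball_diameter K"
      using \<sigma> \<tau> M(1) by (simp add: pos_divide_less_eq mult_ac)
    then obtain r z where "h / (2 * \<sigma> * \<tau>) < 2 * r" "cball z r \<subseteq> K"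
      using less_cSup_iff[OF nes[OF K] bdd[OF K]] unfolding inball_diameter_def by auto
    then have "1 / (4 * \<sigma> * \<tau>) * h \<le> r" by simp
    then show "\<exists>z. cball z (1 / (4 * \<sigma> * \<tau>) * h) \<subseteq> K"
      using \<open>cball z r \<subseteq> K\<close> subset_cball by blast
  qed
qed

lemma L2_time_norm_le:
  assumes "T > 0" "B \<ge> 0" "\<And>t. 0 \<le> t \<Longrightarrow> \<bar>N t\<bar> \<le> B"
  shows "L2_time_norm T N \<le> sqrt T * B"
proof -
  have "(LINT t|lebesgue_on {0..T}. (N t)\<^sup>2) \<le> T * B\<^sup>2"
  proof (cases "integrable (lebesgue_on {0..T}) (\<lambda>t. (N t)\<^sup>2)")
    case True
    interpret finite_measure "lebesgue_on {0..T}" by (rule finite_measure_lebesgue_on_bounded) auto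
    have "(LINT t|lebesgue_on {0..T}. (N t)\<^sup>2) \<le> (LINT t|lebesgue_on {0..T}. B\<^sup>2)"
    proof (rule integral_mono[OF True])
      fix t assume "t \<in> space (lebesgue_on {0..T})"
      then have "\<bar>N t\<bar> \<le> B" using assms(3) by simp
      then show "(N t)\<^sup>2 \<le> B\<^sup>2" by (metis abs_ge_zero power2_abs power_mono)
    qed simp
    also have "\<dots> = T * B\<^sup>2" using assms(1) by (simp add: measure_restrict_space)
    finally show ?thesis .
  next
    \<comment> \<open>The Bochner integral of a non-integrable function is 0, so the bound holds
      here as well.\<close>
    case False
    then show ?thesis using assms(1) by (simp add: not_integrable_integral_eq)
  qed
  then have "L2_time_norm T N \<le> sqrt (T * B\<^sup>2)" unfolding L2_time_norm_def by (rule real_sqrt_le_mono)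
  then show ?thesis using assms(2) by (simp add: real_sqrt_mult)
qed

theorem corollary4p8:
  fixes \<Omega> :: "(real^'n::{finite,linorder}) set"
    and \<gamma> \<alpha> T \<sigma> \<tau> :: real
  assumes "CARD('n) = 2 \<or> CARD('n) = 3"
    and "polyhedral_lipschitz_domain \<Omega>"
    and "\<gamma> > 0"
    and "\<alpha> \<ge> 0"
    and "CARD('n) = 2 \<Longrightarrow> \<alpha> = 0"
    and "T > 0"
  shows "\<exists>C>0. \<forall>H \<T>. mesh_family \<Omega> \<sigma> \<tau> H \<T> \<longrightarrow>
    (\<forall>h\<in>H. \<forall>(u0 :: real^'n::{finite,linorder} \<Rightarrow> real^'n::{finite,linorder}) u0h u q.
       u0 \<in> H1_vec \<Omega> \<and> (AE x in lebesgue_on \<Omega>. norm (u0 x) = 1) \<and>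
       u0h \<in> P1_vec (\<T> h) \<and> (\<forall>a\<in>nodes (\<T> h). norm (u0h a) = 1) \<and>
       L2_norm \<Omega> (grad_vec \<Omega> u0h) \<le> L2_norm \<Omega> (grad_vec \<Omega> u0) \<and>
       smooth_curve (\<T> h) (P1_vec (\<T> h)) u \<and> smooth_curve (\<T> h) (P1 (\<T> h)) q \<and>
       (\<forall>x\<in>closure \<Omega>. u 0 x = u0h x) \<and>
       solves_semidiscrete \<Omega> (\<T> h) \<gamma> \<alpha> u q \<longrightarrow>
       L2_time_norm T (\<lambda>t. H1Linf_dual_norm \<Omega> (q t))
         \<le> C * (1 + L2_norm \<Omega> (grad_vec \<Omega> u0))
             * L2_norm \<Omega> (grad_vec \<Omega> u0))"
proof -
  have O: "open \<Omega>" "bounded \<Omega>" "\<Omega> \<noteq> {}" "lipschitz_boundary \<Omega>"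
    using assms(2) by (auto simp: polyhedral_lipschitz_domain_def)
  obtain h0 \<kappa> where h0: "h0 > 0" "\<kappa> \<ge> 0"
    and push: "\<And>a h. a \<in> closure \<Omega> \<Longrightarrow> 0 < h \<Longrightarrow> h < h0 \<Longrightarrow>
       \<exists>w. norm w \<le> \<kappa> * h \<and> ball (a - w) (2 * h) \<subseteq> \<Omega> \<and>
         (\<forall>x\<in>\<Omega> \<inter> ball a (2 * h). \<forall>s. 0 \<le> s \<and> s \<le> 1 \<longrightarrow> x - s *\<^sub>R w \<in> \<Omega>)"
    using lipschitz_push[OF O(1,2,4)] by blast
  \<comment> \<open>D is fixed before any mesh is given; it depends only on \<Omega>, \<sigma>,
    \<tau> and the dimension. For values \<sigma>, \<tau> that admit no mesh it may be negative or
    rest on a division by zero, hence the absolute value and the added 1, which keep the final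
    constant positive.\<close>
  define D where "D = dual_const CARD('n) CARD('n) (1 / (4 * \<sigma> * \<tau>)) \<kappa> h0 (measure lebesgue \<Omega>)"
  show ?thesis
  proof (intro exI[of _ "sqrt T * \<bar>D\<bar> + 1"] conjI allI impI ballI)
    show "0 < sqrt T * \<bar>D\<bar> + 1" using assms(6) by (simp add: add_nonneg_pos)
    fix H \<T> h u0 u0h u q
    assume mf: "mesh_family \<Omega> \<sigma> \<tau> H \<T>" and h: "h \<in> H"
      and *: "u0 \<in> H1_vec \<Omega> \<and> (AE x in lebesgue_on \<Omega>. norm (u0 x) = 1) \<and>
       u0h \<in> P1_vec (\<T> h) \<and> (\<forall>a\<in>nodes (\<T> h). norm (u0h a) = 1) \<and>
       L2_norm \<Omega> (grad_vec \<Omega> u0h) \<le> L2_norm \<Omega> (grad_vec \<Omega> u0) \<and>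
       smooth_curve (\<T> h) (P1_vec (\<T> h)) u \<and> smooth_curve (\<T> h) (P1 (\<T> h)) q \<and>
       (\<forall>x\<in>closure \<Omega>. u 0 x = u0h x) \<and>
       solves_semidiscrete \<Omega> (\<T> h) \<gamma> \<alpha> u q"
    then have u0h: "u0h \<in> P1_vec (\<T> h)" "L2_norm \<Omega> (grad_vec \<Omega> u0h) \<le> L2_norm \<Omega> (grad_vec \<Omega> u0)"
      and sc: "smooth_curve (\<T> h) (P1_vec (\<T> h)) u" "smooth_curve (\<T> h) (P1 (\<T> h)) q"
      and ini: "\<And>x. x \<in> closure \<Omega> \<Longrightarrow> u 0 x = u0h x"
      and sol: "solves_semidiscrete \<Omega> (\<T> h) \<gamma> \<alpha> u q" by auto
    note fe = mesh_family_fe_mesh(3)[OF assms(2) mf h]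
    interpret fe_mesh \<Omega> "\<T> h" h "1 / (4 * \<sigma> * \<tau>)" by (rule fe)
    define U0 where "U0 = L2_norm \<Omega> (grad_vec \<Omega> u0)"
    have U0: "U0 \<ge> 0" unfolding U0_def by (rule L2_norm_nonneg)
    have u0P: "u 0 \<in> P1_vec (\<T> h)" using sc(1) by (simp add: smooth_curve_def)
    \<comment> \<open>The initial functions are known to agree only on the closure of \<Omega>.
      Element gradients see nothing else, so the two gradient norms coincide.\<close>
    have "elgrad (\<lambda>y. u 0 y $ i) K = elgrad (\<lambda>y. u0h y $ i) K" if "K \<in> \<T> h" for K i
      using u0h(1) ini that by (intro P1_cong(2)) (auto simp: P1_vec_def)
    then have "L2_norm \<Omega> (grad_vec \<Omega> (u 0)) = L2_norm \<Omega> (grad_vec \<Omega> u0h)"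
      unfolding L2_norm_grad_vec[OF u0P] L2_norm_grad_vec[OF u0h(1)] by simp
    then have U: "L2_norm \<Omega> (grad_vec \<Omega> (u t)) \<le> U0" if "t \<ge> 0" for t
      using energy_decreasing[OF fe assms(3) sc(1) sol that] u0h(2) by (simp add: U0_def)
    have "\<bar>H1Linf_dual_norm \<Omega> (q t)\<bar> \<le> \<bar>D\<bar> * (1 + U0) * U0" if t: "t \<ge> 0" for t
    proof (rule dual_norm_bound[OF O(3)])
      fix f assume f: "f \<in> H1 \<Omega>" "f \<in> Linf \<Omega>"
      define U where "U = L2_norm \<Omega> (grad_vec \<Omega> (u t))"
      define S where "S = L2_norm \<Omega> (grad \<Omega> f) + Linf_norm \<Omega> f"
      have S: "S \<ge> 0"
        unfolding S_def by (intro add_nonneg_nonneg L2_norm_nonneg Linf_norm_bound(2)[OF O(1,3) f(2)])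
      have U': "0 \<le> U" "U \<le> U0" unfolding U_def using U[OF t] L2_norm_nonneg by auto
      have "u t \<in> P1_vec (\<T> h)" "q t \<in> P1 (\<T> h)" using sc t by (auto simp: smooth_curve_def)
      then have "\<bar>L2_inner \<Omega> (q t) f\<bar> \<le> D * (1 + U) * U * S"
        unfolding U_def D_def S_def
        by (intro multiplier_dual_bound semidiscrete_estimates(1,3)[OF fe assms(3) sc(1) sol t] h0 O(3) f push h_pos)
      also have "\<dots> \<le> \<bar>D\<bar> * (1 + U0) * U0 * S"
        using U' U0 S by (intro mult_right_mono mult_mono) auto
      finally show "\<bar>L2_inner \<Omega> (q t) f\<bar> \<le> \<bar>D\<bar> * (1 + U0) * U0 * (L2_norm \<Omega> (grad \<Omega> f) + Linf_norm \<Omega> f)"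
        by (simp add: S_def)
    qed
    then have "L2_time_norm T (\<lambda>t. H1Linf_dual_norm \<Omega> (q t)) \<le> sqrt T * (\<bar>D\<bar> * (1 + U0) * U0)"
      using U0 by (intro L2_time_norm_le assms(6)) auto
    also have "\<dots> \<le> (sqrt T * \<bar>D\<bar> + 1) * (1 + U0) * U0" using U0 by (simp add: algebra_simps)
    finally show "L2_time_norm T (\<lambda>t. H1Linf_dual_norm \<Omega> (q t))
         \<le> (sqrt T * \<bar>D\<bar> + 1) * (1 + L2_norm \<Omega> (grad_vec \<Omega> u0)) * L2_norm \<Omega> (grad_vec \<Omega> u0)"
      unfolding U0_def .
  qed
qed

end
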